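(* There exists a planar hypotraceable graph on exactly $130$ vertices, and for every integer $n \geq 154$ there exists a planar hypotraceable graph on exactly $n$ vertices.
   Context: All graphs are finite and simple. A graph is traceable if it has a Hamiltonian path (a path through all of its vertices). A graph $G$ is hypotraceable if $G$ is not traceable, but for every vertex $v$ of $G$ the graph $G - v$ is traceable. *)

theory Defs
  imports "HOL-Analysis.Analysis"
begin

type_synonym 'a ugraph = "'a set \<times> 'a set set"

abbreviation uverts :: "'a ugraph \<Rightarrow> 'a set" where
  "uverts G \<equiv> fst G"

abbreviation uedges :: "'a ugraph \<Rightarrow> 'a set set" where
  "uedges G \<equiv> snd G"

definition finite_simple_graph :: "'a ugraph \<Rightarrow> bool" where
  "finite_simple_graph G \<longleftrightarrow>
     finite (uverts G) \<and> (\<forall>e \<in> uedges G. e \<subseteq> uverts G \<and> card e = 2)"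

definition del_vertex :: "'a ugraph \<Rightarrow> 'a \<Rightarrow> 'a ugraph" where
  "del_vertex G v = (uverts G - {v}, {e \<in> uedges G. v \<notin> e})"

definition is_upath :: "'a ugraph \<Rightarrow> 'a list \<Rightarrow> bool" where
  "is_upath G p \<longleftrightarrow>
     p \<noteq> [] \<and> distinct p \<and> set p \<subseteq> uverts G \<and> successively (\<lambda>u v. {u, v} \<in> uedges G) p"

definition is_hamiltonian_path :: "'a ugraph \<Rightarrow> 'a list \<Rightarrow> bool" where
  "is_hamiltonian_path G p \<longleftrightarrow> is_upath G p \<and> set p = uverts G"

definition traceable :: "'a ugraph \<Rightarrow> bool" where
  "traceable G \<longleftrightarrow> (\<exists>p. is_hamiltonian_path G p)"

definition hypotraceable :: "'a ugraph \<Rightarrow> bool" where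
  "hypotraceable G \<longleftrightarrow> \<not> traceable G \<and> (\<forall>v \<in> uverts G. traceable (del_vertex G v))"

text \<open>
  A drawing places the vertices at distinct points of the plane and represents each edge by a
  simple arc joining its two end vertices; the interior of an edge contains no vertex and no
  point of any other edge.
\<close>

definition plane_drawing ::
    "'a ugraph \<Rightarrow> ('a \<Rightarrow> real \<times> real) \<Rightarrow> ('a set \<Rightarrow> real \<Rightarrow> real \<times> real) \<Rightarrow> bool" where
  "plane_drawing G pos \<gamma> \<longleftrightarrow>
     inj_on pos (uverts G) \<and>
     (\<forall>e \<in> uedges G. arc (\<gamma> e) \<and> {pathstart (\<gamma> e), pathfinish (\<gamma> e)} = pos ` e) \<and>
     (\<forall>e \<in> uedges G. (path_image (\<gamma> e) - pos ` e) \<inter> pos ` uverts G = {}) \<and>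
     (\<forall>e \<in> uedges G. \<forall>e' \<in> uedges G. e \<noteq> e' \<longrightarrow>
        (path_image (\<gamma> e) - pos ` e) \<inter> path_image (\<gamma> e') = {})"

definition planar :: "'a ugraph \<Rightarrow> bool" where
  "planar G \<longleftrightarrow> (\<exists>pos \<gamma>. plane_drawing G pos \<gamma>)"

end

theory Submission
  imports Defs
begin

text \<open>
  Removing a cubic vertex from a hypohamiltonian graph leaves a \<^emph>\<open>fragment\<close>: a graph with three
  terminals (the neighbours of that vertex) that has no spanning path between two terminals, although
  the deletion of any vertex creates one. Following Thomassen, four fragments are glued in pairs at a
  terminal \<open>c\<close> resp. \<open>d\<close> and the remaining terminals of the two pairs are joined by four edges.
  A spanning path of the result would alternate between the two pairs and thereby induce a spanning
  path between two terminals of some fragment, so there is none; the deletion paths of the fragments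
  can be assembled to spanning paths of the vertex-deleted graphs. Replacing a 4-cycle of a fragment
  by a ladder with four more vertices again yields a fragment. Starting from a planar fragment with 33
  vertices and such a 4-cycle, and one with 36 vertices, the composites have
  \<open>130 + 3 * k + 4 * j\<close> vertices with \<open>k \<le> 3\<close>, which covers 130 and all numbers from 139 on.
  The two initial fragments are verified by computation.
\<close>

section \<open>Composites of four fragments\<close>

text \<open>In a hypohamiltonian graph \<open>G\<close> with a cubic vertex \<open>z\<close>, a
  Hamiltonian cycle of \<open>G - v\<close> passes through \<open>z\<close> and, without
  \<open>z\<close>, is a path between two terminals; a spanning path of \<open>G - z\<close> between
  two terminals would close up through \<open>z\<close>. A Hamiltonian cycle of \<open>G - z\<close>
  yields spanning paths of the fragment from every terminal, which some deletions need as well. The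
  obstacle to excluding spanning paths of the composite is that they may change sides up to four
  times. A block that spans a pair cannot end at a linked terminal, and of two blocks sharing a
  pair, one that runs between linked terminals leaves the gluing vertex to the other; each possible
  number of blocks contradicts this or the pattern of the four edges. A ladder grows by two rungs at
  once: with a single new rung, a path could pass both new vertices on its way between opposite
  corners of the 4-cycle, which no old edge imitates. With two new rungs such a passage strands one
  of the four new vertices. The bound \<open>k \<le> 3\<close> on the number of large fragments
  keeps one place for the laddered small fragment.\<close>

definition spath :: "'a set set \<Rightarrow> 'a set \<Rightarrow> 'a \<Rightarrow> 'a \<Rightarrow> bool" where
  "spath E S s t \<longleftrightarrow> (\<exists>p. p \<noteq> [] \<and> distinct p \<and> set p = S \<and>
     successively (\<lambda>u v. {u, v} \<in> E) p \<and> hd p = s \<and> last p = t)"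

lemma spathI:
  assumes "p \<noteq> []" "distinct p" "set p = S" "successively (\<lambda>u v. {u, v} \<in> E) p" "hd p = s" "last p = t"
  shows "spath E S s t"
  using assms unfolding spath_def by blast

lemma spath_mono:
  assumes "spath E S s t" "E \<subseteq> E'"
  shows "spath E' S s t"
proof -
  obtain p where p: "p \<noteq> []" "distinct p" "set p = S" "successively (\<lambda>u v. {u, v} \<in> E) p" "hd p = s" "last p = t"
    using assms(1) unfolding spath_def by blast
  have "successively (\<lambda>u v. {u, v} \<in> E') p"
    using p(4) by (rule successively_mono) (use assms(2) in auto)
  then show ?thesis using p by (intro spathI)
qed

lemma spath_rev:
  assumes "spath E S s t"
  shows "spath E S t s"
proof -
  obtain p where p: "p \<noteq> []" "distinct p" "set p = S" "successively (\<lambda>u v. {u, v} \<in> E) p" "hd p = s" "last p = t"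
    using assms(1) unfolding spath_def by blast
  have "successively (\<lambda>u v. {u, v} \<in> E) (rev p)"
    using p(4) by (simp add: insert_commute)
  then show ?thesis using p by (intro spathI[of "rev p"]) (auto simp: hd_rev last_rev)
qed

lemma spath_singleton: "spath E {x} x x"
  by (rule spathI[of "[x]"]) auto

lemma spath_append:
  assumes "spath E S s t" "spath E S' s' t'" "{t, s'} \<in> E" "S \<inter> S' = {}"
  shows "spath E (S \<union> S') s t'"
proof -
  obtain p where p: "p \<noteq> []" "distinct p" "set p = S" "successively (\<lambda>u v. {u, v} \<in> E) p" "hd p = s" "last p = t"
    using assms(1) unfolding spath_def by blast
  obtain q where q: "q \<noteq> []" "distinct q" "set q = S'" "successively (\<lambda>u v. {u, v} \<in> E) q" "hd q = s'" "last q = t'"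
    using assms(2) unfolding spath_def by blast
  show ?thesis
    by (rule spathI[of "p @ q"]) (use p q assms(3,4) in \<open>auto simp: successively_append_iff\<close>)
qed

lemma spath_join:
  assumes "spath E S s t" "spath E S' t u" "S \<inter> S' = {t}"
  shows "spath E (S \<union> S') s u"
proof -
  obtain p where p: "p \<noteq> []" "distinct p" "set p = S" "successively (\<lambda>u v. {u, v} \<in> E) p" "hd p = s" "last p = t"
    using assms(1) unfolding spath_def by blast
  obtain q where q: "q \<noteq> []" "distinct q" "set q = S'" "successively (\<lambda>u v. {u, v} \<in> E) q" "hd q = t" "last q = u"
    using assms(2) unfolding spath_def by blast
  obtain q' where q': "q = t # q'"
    using q(1,5) by (cases q) auto
  have d: "set p \<inter> set q' = {}"
    using p q q' assms(3) by auto
  have *: "successively (\<lambda>u v. {u, v} \<in> E) q'" "q' = [] \<or> {t, hd q'} \<in> E"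
    using q(4) unfolding q' by (cases q'; simp)+
  show ?thesis
  proof (rule spathI[of "p @ q'"])
    show "set (p @ q') = S \<union> S'"
      using p q q' last_in_set[of p] by auto
    show "successively (\<lambda>u v. {u, v} \<in> E) (p @ q')"
      using p * by (auto simp: successively_append_iff)
    show "last (p @ q') = u"
      using p q q' by (cases "q' = []") auto
  qed (use p q q' d in auto)
qed

lemma spath_subset: "spath E S s t \<Longrightarrow> s \<in> S \<and> t \<in> S"
  unfolding spath_def by auto

lemma spath_traceable:
  assumes "spath E S s t"
  shows "traceable (S, E)"
  using assms unfolding spath_def traceable_def is_hamiltonian_path_def is_upath_def by auto

section \<open>Fragments and pairs glued at a terminal\<close>

text \<open>\<open>path_from_a\<close> and \<open>path_from_b\<close> leave the other end free: a
  route through the composite may begin by exhausting a whole fragment and leave it through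
  \<open>a\<close> or \<open>b\<close>. The terminal \<open>c\<close> plays a different part, as the
  vertex at which two fragments are glued.\<close>

locale fragment =
  fixes V :: "'a set" and E :: "'a set set" and a b c :: 'a
  assumes finite_verts: "finite V"
    and edges: "e \<in> E \<Longrightarrow> e \<subseteq> V \<and> card e = 2"
    and terminals: "a \<in> V" "b \<in> V" "c \<in> V" "a \<noteq> b" "a \<noteq> c" "b \<noteq> c"
    and no_terminal_path: "s \<in> {a, b, c} \<Longrightarrow> t \<in> {a, b, c} \<Longrightarrow> s \<noteq> t \<Longrightarrow> \<not> spath E V s t"
    and deletion_path: "v \<in> V \<Longrightarrow> \<exists>s\<in>{a, b, c}. \<exists>t\<in>{a, b, c}. s \<noteq> t \<and> spath E (V - {v}) s t"
    and path_from_a: "\<exists>t. spath E V a t"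
    and path_from_b: "\<exists>t. spath E V b t"
begin

lemma fragment_swap: "fragment V E b a c"
  using finite_verts edges terminals no_terminal_path deletion_path path_from_a path_from_b
  by unfold_locales (auto simp: insert_commute)

lemma deletion_path_cases:
  assumes "v \<in> V"
  shows "spath E (V - {v}) a b \<or> spath E (V - {v}) a c \<or> spath E (V - {v}) b c"
proof -
  obtain s t where "s \<in> {a, b, c}" "t \<in> {a, b, c}" "s \<noteq> t" "spath E (V - {v}) s t"
    using deletion_path[OF assms] by blast
  moreover have "spath E (V - {v}) t s"
    using spath_rev[OF calculation(4)] .
  ultimately show ?thesis by auto
qed

text \<open>A path that avoids \<open>a\<close> cannot end there, which leaves only the pair
  \<open>b\<close>, \<open>c\<close> of ends.\<close>

lemma path_avoiding_a: "spath E (V - {a}) b c"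
  using deletion_path_cases[OF terminals(1)] by (auto dest: spath_subset)

lemma path_avoiding_c: "spath E (V - {c}) a b"
  using deletion_path_cases[OF terminals(3)] by (auto dest: spath_subset)

end

locale glued_pair = F: fragment V E a b c + G: fragment V' E' a' b' c
  for V :: "'a set" and E a b c V' E' a' b' +
  assumes meet: "V \<inter> V' = {c}"
begin

lemma glued_pair_swap: "glued_pair V' E' a' b' c V E a b"
  using meet F.fragment_axioms G.fragment_axioms unfolding glued_pair_def glued_pair_axioms_def by blast

lemma meetD: "x \<in> V \<Longrightarrow> x \<in> V' \<Longrightarrow> x = c"
  using meet by blast

lemma terminals_sides: "a \<notin> V'" "b \<notin> V'" "a' \<notin> V" "b' \<notin> V"
  using F.terminals G.terminals meetD by metis+

text \<open>Every edge lies inside one of the two fragments, so a path can change fragments only at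
  the common vertex \<open>c\<close>.\<close>

lemma one_sided:
  assumes "p \<noteq> []" "successively (\<lambda>u v. {u, v} \<in> E \<union> E') p" "set p \<subseteq> V \<union> V'" "c \<notin> set p"
  shows "set p \<subseteq> V \<or> set p \<subseteq> V'"
  using assms
proof (induction p rule: induct_list012)
  case (3 x y zs)
  have xy: "{x, y} \<subseteq> V \<or> {x, y} \<subseteq> V'"
    using 3(4) F.edges G.edges by fastforce
  have "set (y # zs) \<subseteq> V \<or> set (y # zs) \<subseteq> V'"
    by (rule 3(2)) (use 3 in auto)
  moreover have "y \<noteq> c" using 3 by auto
  ultimately show ?case
    using xy meetD[of y] by auto
qed auto

text \<open>An edge of the other fragment with both ends in \<open>V\<close> would have both ends
  equal to \<open>c\<close>.\<close>

lemma edges_one_sided: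
  assumes "successively (\<lambda>u v. {u, v} \<in> E \<union> E') p" "set p \<subseteq> V" "distinct p"
  shows "successively (\<lambda>u v. {u, v} \<in> E) p"
  using assms
proof (induction p rule: induct_list012)
  case (3 x y zs)
  have "{x, y} \<in> E"
  proof (rule ccontr)
    assume "{x, y} \<notin> E"
    then have "{x, y} \<in> E'" using 3(3) by auto
    then have "{x, y} \<subseteq> V'" using G.edges by blast
    then have "x = c" "y = c" using 3(4) meetD by auto
    then show False using 3(5) by auto
  qed
  then show ?case using 3 by auto
qed auto

text \<open>The path is cut at \<open>c\<close>. Its tail ends in \<open>V\<close> and so stays in
  \<open>V\<close>; the part before \<open>c\<close> then has to cover \<open>V'\<close>, so that
  \<open>c\<close> followed by the tail spans \<open>V\<close> between two terminals.\<close>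

lemma no_path_ending_at_terminal_aux:
  assumes "p \<noteq> []" "distinct p" "set p = V \<union> V'" "successively (\<lambda>u v. {u, v} \<in> E \<union> E') p"
    and last: "last p \<in> {a, b}"
  shows False
proof -
  have "c \<in> set p" using assms(3) F.terminals by auto
  then obtain xs ys where p: "p = xs @ c # ys" by (meson split_list)
  have ys: "ys \<noteq> []" using last F.terminals p by (cases ys) auto
  have sy: "successively (\<lambda>u v. {u, v} \<in> E \<union> E') ys" "successively (\<lambda>u v. {u, v} \<in> E \<union> E') (c # ys)"
    "successively (\<lambda>u v. {u, v} \<in> E \<union> E') xs"
    using assms(4) ys unfolding p by (auto simp: successively_append_iff successively_Cons)
  have cn: "c \<notin> set xs" "c \<notin> set ys" and sub: "set xs \<subseteq> V \<union> V'" "set ys \<subseteq> V \<union> V'"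
    and cov: "V \<union> V' \<subseteq> insert c (set xs \<union> set ys)"
    using assms(2,3) unfolding p by auto
  have "last p \<in> set ys" using ys p by simp
  moreover have "last p \<notin> V'" using last terminals_sides by auto
  ultimately have yV: "set ys \<subseteq> V"
    using one_sided[OF ys sy(1) sub(2) cn(2)] by blast
  have "a' \<in> V \<union> V'" "a' \<noteq> c" "a' \<notin> set ys" using G.terminals terminals_sides yV by auto
  then have "a' \<in> set xs" using cov by blast
  then have "xs \<noteq> []" "\<not> set xs \<subseteq> V" using terminals_sides by auto
  then have xV: "set xs \<subseteq> V'"
    using one_sided[OF _ sy(3) sub(1) cn(1)] by blast
  have "V \<subseteq> insert c (set ys)"
    using cov xV meetD by blast
  then have cys: "set (c # ys) = V" using yV F.terminals by auto
  then have "successively (\<lambda>u v. {u, v} \<in> E) (c # ys)"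
    using edges_one_sided[OF sy(2)] assms(2) p by auto
  then have "spath E V c (last p)"
    using cys assms(2) ys p by (intro spathI[of "c # ys"]) auto
  then show False using F.no_terminal_path[of c "last p"] last F.terminals by auto
qed

lemma no_path_ending_at_terminal:
  assumes "p \<noteq> []" "distinct p" "set p = V \<union> V'" "successively (\<lambda>u v. {u, v} \<in> E \<union> E') p"
  shows "last p \<notin> {a, b, a', b'}"
proof -
  have "successively (\<lambda>u v. {u, v} \<in> E' \<union> E) p" using assms(4) by (simp add: Un_commute)
  then have "last p \<notin> {a', b'}"
    using glued_pair.no_path_ending_at_terminal_aux[OF glued_pair_swap assms(1,2)] assms(3) by auto
  then show ?thesis
    using no_path_ending_at_terminal_aux[OF assms] by auto
qed

text \<open>With \<open>q\<close> inside \<open>V\<close>, all of \<open>V'\<close> except possibly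
  \<open>c\<close> is left to \<open>r\<close>. Depending on the sides on which the parts of
  \<open>r\<close> before and after \<open>c\<close> lie, the part from \<open>c\<close> on, the
  part up to \<open>c\<close>, or all of \<open>r\<close> spans \<open>V'\<close> between two
  terminals.\<close>

lemma two_paths_aux:
  assumes "distinct (q @ r)" "r \<noteq> []" "set q \<union> set r = V \<union> V'"
    and r: "successively (\<lambda>u v. {u, v} \<in> E \<union> E') r"
    and hd: "hd r \<in> {a, b, a', b'}" and last: "last r \<in> {a, b, a', b'}" and "hd r \<noteq> last r"
    and "c \<in> set r" and qV: "set q \<subseteq> V"
  shows False
proof -
  obtain xs ys where p: "r = xs @ c # ys" using assms(8) by (meson split_list)
  have "c \<notin> {a, b, a', b'}" using F.terminals G.terminals by auto
  then have ne: "ys \<noteq> []" "xs \<noteq> []" using hd last unfolding p by force+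
  have sy: "successively (\<lambda>u v. {u, v} \<in> E \<union> E') ys" "successively (\<lambda>u v. {u, v} \<in> E \<union> E') (c # ys)"
    "successively (\<lambda>u v. {u, v} \<in> E \<union> E') xs" "successively (\<lambda>u v. {u, v} \<in> E \<union> E') (xs @ [c])"
    using r ne unfolding p by (auto simp: successively_append_iff successively_Cons)
  have cn: "c \<notin> set xs" "c \<notin> set ys" "c \<notin> set q" and sub: "set xs \<subseteq> V \<union> V'" "set ys \<subseteq> V \<union> V'"
    and cov: "V \<union> V' \<subseteq> insert c (set q \<union> set xs \<union> set ys)"
    and dist: "distinct (c # ys)" "distinct (xs @ [c])" "distinct r"
    using assms(1,3) unfolding p by auto
  have side: "set xs \<subseteq> V \<or> set xs \<subseteq> V'" "set ys \<subseteq> V \<or> set ys \<subseteq> V'"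
    using one_sided[OF ne(1) sy(1) sub(2) cn(2)] one_sided[OF ne(2) sy(3) sub(1) cn(1)] by blast+
  have E'I: "successively (\<lambda>u v. {u, v} \<in> E') l"
    if "successively (\<lambda>u v. {u, v} \<in> E \<union> E') l" "set l = V'" "distinct l" for l
    using glued_pair.edges_one_sided[OF glued_pair_swap, of l] that by (simp add: Un_commute)
  have ends: "x \<in> {a', b'}" if "x \<in> {a, b, a', b'}" "x \<in> V'" for x
    using that terminals_sides by auto
  have V'sub: "x \<in> set xs \<or> x \<in> set ys" if "x \<in> V'" "x \<noteq> c" for x
    using cov that qV meetD by blast
  consider "set xs \<subseteq> V" | "set ys \<subseteq> V" "set xs \<subseteq> V'" | "set xs \<subseteq> V'" "set ys \<subseteq> V'" using side by blast
  then show False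
  proof cases
    case 1
    then have V'ys: "V' \<subseteq> insert c (set ys)" using V'sub meetD by blast
    then have "a' \<in> set ys" using G.terminals by auto
    then have ys: "set (c # ys) = V'" using side V'ys G.terminals terminals_sides by auto
    then have "spath E' V' c (last r)"
      using E'I[OF sy(2) ys dist(1)] dist ne p by (intro spathI[of "c # ys"]) auto
    moreover have "last r \<in> {a', b'}"
      using ends[OF last] spath_subset[OF calculation] by blast
    ultimately show False using G.no_terminal_path[of c "last r"] G.terminals by auto
  next
    case 2
    then have "V' \<subseteq> insert c (set xs)" using V'sub meetD by blast
    then have xs: "set (xs @ [c]) = V'" using 2 G.terminals by auto
    then have "spath E' V' (hd r) c"
      using E'I[OF sy(4) xs dist(2)] dist ne p by (intro spathI[of "xs @ [c]"]) auto
    moreover have "hd r \<in> {a', b'}"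
      using ends[OF hd] spath_subset[OF calculation] by blast
    ultimately show False using G.no_terminal_path[of "hd r" c] G.terminals by auto
  next
    case 3
    then have r': "set r = V'" using V'sub G.terminals p by auto
    then have "spath E' V' (hd r) (last r)"
      using E'I[OF r r' dist(3)] dist assms(2) by (intro spathI[of r]) auto
    moreover have "hd r \<in> {a', b'}" "last r \<in> {a', b'}"
      using ends[OF hd] ends[OF last] spath_subset[OF calculation] by blast+
    ultimately show False using G.no_terminal_path assms(7) by auto
  qed
qed

text \<open>Made for a spanning path of the composite that visits a pair in two blocks, one of
  which, \<open>r\<close>, is entered and left through links. If \<open>c\<close> were on
  \<open>r\<close>, then \<open>q\<close> would lie on one side and \<open>two_paths_aux\<close>
  would apply.\<close>

lemma two_paths:
  assumes "q \<noteq> []" "distinct (q @ r)" "r \<noteq> []" "set q \<union> set r = V \<union> V'"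
    and q: "successively (\<lambda>u v. {u, v} \<in> E \<union> E') q" and r: "successively (\<lambda>u v. {u, v} \<in> E \<union> E') r"
    and "hd r \<in> {a, b, a', b'}" "last r \<in> {a, b, a', b'}" "hd r \<noteq> last r"
  shows "c \<in> set q \<and> (set r \<subseteq> V \<or> set r \<subseteq> V')"
proof -
  have "c \<notin> set r"
  proof
    assume c: "c \<in> set r"
    then have "c \<notin> set q" using assms(2) by auto
    then consider "set q \<subseteq> V" | "set q \<subseteq> V'" using one_sided[OF assms(1) q] assms(4) by auto
    then show False
    proof cases
      case 1
      then show False using two_paths_aux[OF assms(2,3,4) r assms(7,8,9) c] by blast
    next
      case 2
      have "successively (\<lambda>u v. {u, v} \<in> E' \<union> E) r" using r by (simp add: Un_commute)
      moreover have "set q \<union> set r = V' \<union> V" using assms(4) by auto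
      moreover have "hd r \<in> {a', b', a, b}" "last r \<in> {a', b', a, b}" using assms(7,8) by auto
      ultimately show False
        using glued_pair.two_paths_aux[OF glued_pair_swap assms(2,3)] assms(9) c 2 by blast
    qed
  qed
  moreover have "c \<in> set q \<union> set r" using assms(4) F.terminals by blast
  ultimately show ?thesis
    using one_sided[OF assms(3) r] assms(4) by auto
qed

end

section \<open>The composite has no spanning path\<close>

lemma split_block:
  assumes "p \<noteq> []" "hd p \<in> L"
  obtains q r where "p = q @ r" "q \<noteq> []" "set q \<subseteq> L" "r = [] \<or> hd r \<notin> L"
proof
  show "p = takeWhile (\<lambda>x. x \<in> L) p @ dropWhile (\<lambda>x. x \<in> L) p" by simp
  show "takeWhile (\<lambda>x. x \<in> L) p \<noteq> []" using assms by (cases p) auto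
  show "set (takeWhile (\<lambda>x. x \<in> L) p) \<subseteq> L" using set_takeWhileD by fastforce
  show "dropWhile (\<lambda>x. x \<in> L) p = [] \<or> hd (dropWhile (\<lambda>x. x \<in> L) p) \<notin> L" using hd_dropWhile by fast
qed

lemma Un_eq_disjoint:
  assumes "A \<union> B = L \<union> R" "A \<subseteq> L" "B \<subseteq> R" "L \<inter> R = {}"
  shows "A = L" "B = R"
  using assms by blast+

locale four_fragments =
  L: glued_pair V1 E1 a1 b1 c V2 E2 a2 b2 + R: glued_pair V3 E3 a3 b3 d V4 E4 a4 b4
  for V1 :: "'a set" and E1 a1 b1 c V2 E2 a2 b2 V3 E3 a3 b3 d V4 E4 a4 b4 +
  assumes disjoint: "(V1 \<union> V2) \<inter> (V3 \<union> V4) = {}"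
begin

definition verts :: "'a set" where
  "verts = (V1 \<union> V2) \<union> (V3 \<union> V4)"

definition links :: "'a set set" where
  "links = {{a1, a3}, {b1, b3}, {a2, a4}, {b2, b4}}"

definition edges :: "'a set set" where
  "edges = E1 \<union> E2 \<union> (E3 \<union> E4) \<union> links"

lemma L_terminals: "a1 \<in> V1 \<union> V2" "b1 \<in> V1 \<union> V2" "a2 \<in> V1 \<union> V2" "b2 \<in> V1 \<union> V2"
  and R_terminals: "a3 \<in> V3 \<union> V4" "b3 \<in> V3 \<union> V4" "a4 \<in> V3 \<union> V4" "b4 \<in> V3 \<union> V4"
  using L.F.terminals L.G.terminals R.F.terminals R.G.terminals by auto

lemma L_distinct: "distinct [a1, b1, a2, b2]" and R_distinct: "distinct [a3, b3, a4, b4]"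
  using L.F.terminals L.G.terminals R.F.terminals R.G.terminals L.terminals_sides R.terminals_sides by auto

lemma sides: "x \<in> V1 \<union> V2 \<Longrightarrow> x \<notin> V3 \<union> V4"
  using disjoint by blast

text \<open>The composite has three symmetries: exchanging the two pairs, exchanging the fragments
  within both pairs, and exchanging \<open>a\<close> and \<open>b\<close> throughout. They reduce
  the case analysis to paths starting in the first pair and to deletions in the first
  fragment.\<close>

lemma four_fragments_flip: "four_fragments V3 E3 a3 b3 d V4 E4 a4 b4 V1 E1 a1 b1 c V2 E2 a2 b2"
  using disjoint L.glued_pair_axioms R.glued_pair_axioms
  unfolding four_fragments_def four_fragments_axioms_def by blast

lemma four_fragments_swap: "four_fragments V2 E2 a2 b2 c V1 E1 a1 b1 V4 E4 a4 b4 d V3 E3 a3 b3"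
  using disjoint L.glued_pair_swap R.glued_pair_swap
  unfolding four_fragments_def four_fragments_axioms_def by blast

lemma four_fragments_exchange: "four_fragments V1 E1 b1 a1 c V2 E2 b2 a2 V3 E3 b3 a3 d V4 E4 b4 a4"
  using disjoint L.meet R.meet L.F.fragment_swap L.G.fragment_swap R.F.fragment_swap R.G.fragment_swap
  unfolding four_fragments_def four_fragments_axioms_def glued_pair_def glued_pair_axioms_def by blast

lemma edge_within_L:
  assumes "{u, v} \<in> edges" "u \<in> V1 \<union> V2" "v \<in> V1 \<union> V2"
  shows "{u, v} \<in> E1 \<union> E2"
proof -
  have "{u, v} \<notin> E3 \<union> E4"
  proof
    assume "{u, v} \<in> E3 \<union> E4"
    then have "{u, v} \<subseteq> V3 \<or> {u, v} \<subseteq> V4" using R.F.edges R.G.edges by auto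
    then show False using sides[OF assms(2)] by auto
  qed
  moreover have "{u, v} \<notin> links"
  proof
    assume "{u, v} \<in> links"
    then have "{u, v} \<inter> (V3 \<union> V4) \<noteq> {}" using R_terminals unfolding links_def by blast
    then show False using sides[OF assms(2)] sides[OF assms(3)] by blast
  qed
  ultimately show ?thesis using assms(1) unfolding edges_def by blast
qed

lemma edge_across:
  assumes "{u, v} \<in> edges" "u \<in> V1 \<union> V2" "v \<in> V3 \<union> V4"
  shows "(u, v) \<in> {(a1, a3), (b1, b3), (a2, a4), (b2, b4)}"
proof -
  have "{u, v} \<notin> E3 \<union> E4"
  proof
    assume "{u, v} \<in> E3 \<union> E4"
    then have "{u, v} \<subseteq> V3 \<or> {u, v} \<subseteq> V4" using R.F.edges R.G.edges by auto
    then show False using sides[OF assms(2)] by auto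
  qed
  moreover have "{u, v} \<notin> E1 \<union> E2"
  proof
    assume "{u, v} \<in> E1 \<union> E2"
    then have "{u, v} \<subseteq> V1 \<or> {u, v} \<subseteq> V2" using L.F.edges L.G.edges by auto
    then show False using sides[of v] assms(3) by auto
  qed
  ultimately have "{u, v} \<in> links" using assms(1) unfolding edges_def by blast
  then have cases: "{u, v} = {a1, a3} \<or> {u, v} = {b1, b3} \<or> {u, v} = {a2, a4} \<or> {u, v} = {b2, b4}"
    unfolding links_def by simp
  have "(u, v) = (x, y)" if "{u, v} = {x, y}" "x \<in> V1 \<union> V2" "y \<in> V3 \<union> V4" for x y
  proof -
    have "u = x \<and> v = y \<or> u = y \<and> v = x" using that(1) by (simp add: doubleton_eq_iff)
    moreover have "u \<noteq> y" using that(3) sides[OF assms(2)] by metis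
    ultimately show ?thesis by simp
  qed
  note pick = this[OF _ L_terminals(1) R_terminals(1)] this[OF _ L_terminals(2) R_terminals(2)]
    this[OF _ L_terminals(3) R_terminals(3)] this[OF _ L_terminals(4) R_terminals(4)]
  from cases show ?thesis
    by (elim disjE) (simp_all only: pick insert_iff simp_thms)
qed

lemma block_within_L:
  assumes "successively (\<lambda>u v. {u, v} \<in> edges) p" "set p \<subseteq> V1 \<union> V2"
  shows "successively (\<lambda>u v. {u, v} \<in> E1 \<union> E2) p"
  using assms(1) by (rule successively_mono) (use edge_within_L assms(2) in blast)

end

text \<open>The rewrites identify the flipped graph with the original one, so that every
  \<open>flip\<close> fact speaks of the same \<open>edges\<close> and \<open>verts\<close>.\<close>

sublocale four_fragments \<subseteq> flip: four_fragments V3 E3 a3 b3 d V4 E4 a4 b4 V1 E1 a1 b1 c V2 E2 a2 b2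
  rewrites "four_fragments.edges E3 a3 b3 E4 a4 b4 E1 a1 b1 E2 a2 b2 = edges"
    and "four_fragments.verts V3 V4 V1 V2 = verts"
proof -
  interpret flip: four_fragments V3 E3 a3 b3 d V4 E4 a4 b4 V1 E1 a1 b1 c V2 E2 a2 b2
    by (rule four_fragments_flip)
  show "four_fragments V3 E3 a3 b3 d V4 E4 a4 b4 V1 E1 a1 b1 c V2 E2 a2 b2"
    by (rule four_fragments_flip)
  show "flip.edges = edges"
    unfolding edges_def links_def flip.edges_def flip.links_def by (simp add: insert_commute Un_ac)
  show "flip.verts = verts"
    unfolding verts_def flip.verts_def by (simp add: Un_ac)
qed

context four_fragments
begin

text \<open>The path is cut into maximal blocks on alternating sides. Each of one to five blocks is
  impossible, which makes the remainders \<open>r1\<close> to \<open>r5\<close> nonempty, and a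
  sixth block would need more links than there are.\<close>

lemma not_traceable_aux:
  assumes p: "distinct p" "set p = verts" "successively (\<lambda>u v. {u, v} \<in> edges) p" "p \<noteq> []"
    and hd: "hd p \<in> V1 \<union> V2"
  shows False
proof -
  let ?L = "V1 \<union> V2" and ?R = "V3 \<union> V4"
  let ?adj = "\<lambda>u v. {u, v} \<in> edges"
  let ?X = "{(a1, a3), (b1, b3), (a2, a4), (b2, b4)}"
  have cover: "set p = ?L \<union> ?R" using p(2) unfolding verts_def .
  have nL: "hd r \<in> ?R" if "r \<noteq> []" "r = [] \<or> hd r \<notin> ?L" "set r \<subseteq> set p" for r
    using that cover hd_in_set[of r] by blast
  have nR: "hd r \<in> ?L" if "r \<noteq> []" "r = [] \<or> hd r \<notin> ?R" "set r \<subseteq> set p" for r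
    using that cover hd_in_set[of r] by blast
  have Lx: "u \<in> {a1, b1, a2, b2}" and Rx: "v \<in> {a3, b3, a4, b4}" if "(u, v) \<in> ?X" for u v
    using that by auto
  \<comment> \<open>The links form a matching. Hence a block between two links has two different
    ends: otherwise the neighbouring blocks would meet.\<close>
  have X_inj: "u = u' \<longleftrightarrow> v = v'" if "(u, v) \<in> ?X" "(u', v') \<in> ?X" for u u' v v'
    using that L_distinct R_distinct by auto
  have across: "(last q, hd r) \<in> ?X"
    if "?adj (last q) (hd r)" "q \<noteq> []" "r \<noteq> []" "set q \<subseteq> ?L" "hd r \<in> ?R" for q r
    using edge_across that by (meson last_in_set subsetD)
  have across': "(hd r, last q) \<in> ?X"
    if "?adj (last q) (hd r)" "q \<noteq> []" "r \<noteq> []" "set q \<subseteq> ?R" "hd r \<in> ?L" for q r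
    using edge_across[of "hd r" "last q"] that by (metis insert_commute last_in_set subsetD)
  obtain q0 r1 where p0: "p = q0 @ r1" "q0 \<noteq> []" "set q0 \<subseteq> ?L" "r1 = [] \<or> hd r1 \<notin> ?L"
    using split_block[OF p(4) hd] .
  have q0: "successively (\<lambda>u v. {u, v} \<in> E1 \<union> E2) q0"
    by (rule block_within_L) (use p(3) p0(1,3) in \<open>simp_all add: successively_append_iff\<close>)
  have "a3 \<in> set p" "a3 \<notin> ?L"
    using cover R_terminals(1) sides[of a3] by blast+
  then have "r1 \<noteq> []"
    using p0(1,3) by auto
  have hd1: "hd r1 \<in> ?R"
    by (rule nL[OF \<open>r1 \<noteq> []\<close> p0(4)]) (auto simp: p0(1))
  obtain q1 r2 where p1: "r1 = q1 @ r2" "q1 \<noteq> []" "set q1 \<subseteq> ?R" "r2 = [] \<or> hd r2 \<notin> ?R"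
    using split_block[OF \<open>r1 \<noteq> []\<close> hd1] .
  have q1: "successively (\<lambda>u v. {u, v} \<in> E3 \<union> E4) q1"
    by (rule flip.block_within_L) (use p(3) p0(1,3) p1(1,3) in \<open>simp_all add: successively_append_iff\<close>)
  have X1: "(last q0, hd q1) \<in> ?X"
    using across[of q0 r1] p(3) p0(1,2,3) p1(1,2) hd1 by (simp add: successively_append_iff)
  \<comment> \<open>Two blocks: \<open>q0\<close> would span the left pair and end at a
    terminal.\<close>
  have "r2 \<noteq> []"
  proof
    assume "r2 = []"
    then have "set q0 \<union> set q1 = ?L \<union> ?R" using cover p0(1) p1(1) by simp
    then have "set q0 = ?L" by (rule Un_eq_disjoint[OF _ p0(3) p1(3) disjoint])
    then show False
      using L.no_path_ending_at_terminal[OF p0(2) _ _ q0] p p0 X1 by auto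
  qed
  have hd2: "hd r2 \<in> ?L"
    by (rule nR[OF \<open>r2 \<noteq> []\<close> p1(4)]) (auto simp: p0(1) p1(1))
  obtain q2 r3 where p2: "r2 = q2 @ r3" "q2 \<noteq> []" "set q2 \<subseteq> ?L" "r3 = [] \<or> hd r3 \<notin> ?L"
    using split_block[OF \<open>r2 \<noteq> []\<close> hd2] .
  have q2: "successively (\<lambda>u v. {u, v} \<in> E1 \<union> E2) q2"
    by (rule block_within_L) (use p(3) p0(1,3) p1(1,3) p2(1,3) in \<open>simp_all add: successively_append_iff\<close>)
  have X2: "(hd q2, last q1) \<in> ?X"
    using across'[of q1 r2] p(3) p0(1) p1(1,2,3) p2(1,2) hd2 by (simp add: successively_append_iff)
  \<comment> \<open>Three blocks: \<open>q1\<close> would span the right pair and end at a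
    terminal.\<close>
  have "r3 \<noteq> []"
  proof
    assume "r3 = []"
    then have "(set q0 \<union> set q2) \<union> set q1 = ?L \<union> ?R" using cover p0(1) p1(1) p2(1) by auto
    then have "set q1 = ?R" by (rule Un_eq_disjoint[OF _ Un_least[OF p0(3) p2(3)] p1(3) disjoint])
    then show False
      using R.no_path_ending_at_terminal[OF p1(2) _ _ q1] p p0 p1 Rx[OF X2] by auto
  qed
  have hd3: "hd r3 \<in> ?R"
    by (rule nL[OF \<open>r3 \<noteq> []\<close> p2(4)]) (auto simp: p0(1) p1(1) p2(1))
  obtain q3 r4 where p3: "r3 = q3 @ r4" "q3 \<noteq> []" "set q3 \<subseteq> ?R" "r4 = [] \<or> hd r4 \<notin> ?R"
    using split_block[OF \<open>r3 \<noteq> []\<close> hd3] .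
  have q3: "successively (\<lambda>u v. {u, v} \<in> E3 \<union> E4) q3"
    by (rule flip.block_within_L) (use p(3) p0(1,3) p1(1,3) p2(1,3) p3(1,3) in \<open>simp_all add: successively_append_iff\<close>)
  have X3: "(last q2, hd q3) \<in> ?X"
    using across[of q2 r3] p(3) p0(1) p1(1) p2(1,2,3) p3(1,2) hd3 by (simp add: successively_append_iff)
  have dist: "distinct (q0 @ q1 @ q2 @ q3 @ r4)" using p(1) p0 p1 p2 p3 by simp
  have dd: "distinct (q0 @ q2)" "distinct (q3 @ q1)" "distinct (q1 @ q3)" using dist by auto
  have mem: "last q0 \<in> set q0" "hd q1 \<in> set q1" "last q1 \<in> set q1" "hd q2 \<in> set q2" "last q2 \<in> set q2"
    "hd q3 \<in> set q3" "last q3 \<in> set q3" using p0 p1 p2 p3 by auto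
  have ne1: "hd q1 \<noteq> last q1" using X_inj[OF X1 X2] dist mem by auto
  have ne2: "hd q2 \<noteq> last q2" using X_inj[OF X2 X3] dist mem by auto
  \<comment> \<open>Four blocks: by \<open>two_paths\<close> the inner blocks \<open>q1\<close> and
    \<open>q2\<close> each join the two linked terminals of a single fragment. A link connects them,
    so these two fragments are linked to each other; then the partner of \<open>hd q1\<close>, which
    is \<open>last q0\<close>, would be an end of \<open>q2\<close>.\<close>
  have "r4 \<noteq> []"
  proof
    assume r4: "r4 = []"
    have "(set q0 \<union> set q2) \<union> (set q3 \<union> set q1) = ?L \<union> ?R"
      using cover p0(1) p1(1) p2(1) p3(1) r4 by auto
    note s = Un_eq_disjoint[OF this Un_least[OF p0(3) p2(3)] Un_least[OF p3(3) p1(3)] disjoint]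
    have l: "c \<in> set q0 \<and> (set q2 \<subseteq> V1 \<or> set q2 \<subseteq> V2)"
      by (rule L.two_paths[OF p0(2) dd(1) p2(2) s(1) q0 q2]) (use Lx[OF X2] Lx[OF X3] ne2 in simp_all)
    have r: "d \<in> set q3 \<and> (set q1 \<subseteq> V3 \<or> set q1 \<subseteq> V4)"
      by (rule R.two_paths[OF p3(2) dd(2) p1(2) s(2) q3 q1]) (use Rx[OF X1] Rx[OF X2] ne1 in simp_all)
    have L1: "hd q2 \<in> {a1, b1} \<and> last q2 \<in> {a1, b1} \<or> hd q2 \<in> {a2, b2} \<and> last q2 \<in> {a2, b2}"
      using l mem Lx[OF X2] Lx[OF X3] L.terminals_sides by blast
    have R1: "hd q1 \<in> {a3, b3} \<and> last q1 \<in> {a3, b3} \<or> hd q1 \<in> {a4, b4} \<and> last q1 \<in> {a4, b4}"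
      using r mem Rx[OF X1] Rx[OF X2] R.terminals_sides by blast
    have "last q0 \<noteq> hd q2" "last q0 \<noteq> last q2" using dist mem by auto
    then show False
      using L1 R1 X1 X2 X3 ne2 L_distinct R_distinct by auto
  qed
  have hd4: "hd r4 \<in> ?L"
    by (rule nR[OF \<open>r4 \<noteq> []\<close> p3(4)]) (auto simp: p0(1) p1(1) p2(1) p3(1))
  obtain q4 r5 where p4: "r4 = q4 @ r5" "q4 \<noteq> []" "set q4 \<subseteq> ?L" "r5 = [] \<or> hd r5 \<notin> ?L"
    using split_block[OF \<open>r4 \<noteq> []\<close> hd4] .
  have X4: "(hd q4, last q3) \<in> ?X"
    using across'[of q3 r4] p(3) p0(1) p1(1) p2(1) p3(1,2,3) p4(1,2) hd4 by (simp add: successively_append_iff)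
  have ne3: "hd q3 \<noteq> last q3" using X_inj[OF X3 X4] dist p4 mem by auto
  \<comment> \<open>Five blocks: \<open>q1\<close> and \<open>q3\<close> share the right pair and
    both run between terminals, so each of them would have to contain \<open>d\<close>.\<close>
  have "r5 \<noteq> []"
  proof
    assume r5: "r5 = []"
    have "(set q0 \<union> (set q2 \<union> set q4)) \<union> (set q1 \<union> set q3) = ?L \<union> ?R"
      using cover p0(1) p1(1) p2(1) p3(1) p4(1) r5 by auto
    then have sR: "set q1 \<union> set q3 = ?R"
      by (rule Un_eq_disjoint[OF _ Un_least[OF p0(3) Un_least[OF p2(3) p4(3)]] Un_least[OF p1(3) p3(3)] disjoint])
    have "d \<in> set q1"
      using R.two_paths[OF p1(2) dd(3) p3(2) sR q1 q3] Rx[OF X3] Rx[OF X4] ne3 by simp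
    moreover have "d \<in> set q3"
      using R.two_paths[OF p3(2) dd(2) p1(2) _ q3 q1] sR Rx[OF X1] Rx[OF X2] ne1 by (simp add: Un_commute)
    ultimately show False using dist by auto
  qed
  have hd5: "hd r5 \<in> ?R"
    by (rule nL[OF \<open>r5 \<noteq> []\<close> p4(4)]) (auto simp: p0(1) p1(1) p2(1) p3(1) p4(1))
  have sp: "successively ?adj (q0 @ q1 @ q2 @ q3 @ q4 @ r5)" using p(3) p0 p1 p2 p3 p4 by simp
  have X5: "(last q4, hd r5) \<in> ?X"
    using across[of q4 r5] sp p4(2,3) \<open>r5 \<noteq> []\<close> hd5 by (simp add: successively_append_iff)
  \<comment> \<open>Six blocks or more: the five crossings would have five distinct ends among the
    four linked terminals on the left.\<close>
  have "distinct [last q0, hd q2, last q2, hd q4, last q4]"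
  proof -
    have "last q4 \<in> set q4" "hd q4 \<in> set q4" "hd r5 \<in> set r5" using p4 \<open>r5 \<noteq> []\<close> by auto
    moreover from this have "hd q4 \<noteq> last q4" using X_inj[OF X4 X5] dist p4 mem by auto
    ultimately show ?thesis using dist p4 mem ne2 by auto
  qed
  from distinct_card[OF this] have "card (set [last q0, hd q2, last q2, hd q4, last q4]) = 5"
    by simp
  moreover have "card (set [last q0, hd q2, last q2, hd q4, last q4]) \<le> card {a1, b1, a2, b2}"
    by (rule card_mono) (use Lx[OF X1] Lx[OF X2] Lx[OF X3] Lx[OF X4] Lx[OF X5] in auto)
  moreover have "card {a1, b1, a2, b2} \<le> 4"
    by (simp add: card_insert_if)
  ultimately show False by linarith
qed

end

context four_fragments
begin

lemma not_traceable: "\<not> traceable (verts, edges)"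
proof
  assume "traceable (verts, edges)"
  then obtain p where p: "distinct p" "set p = verts" "successively (\<lambda>u v. {u, v} \<in> edges) p" "p \<noteq> []"
    unfolding traceable_def is_hamiltonian_path_def is_upath_def by auto
  then have "hd p \<in> V1 \<union> V2 \<or> hd p \<in> V3 \<union> V4"
    using hd_in_set[OF p(4)] unfolding verts_def by auto
  then show False using not_traceable_aux[OF p] flip.not_traceable_aux[OF p] by auto
qed

end

section \<open>Spanning paths of the vertex-deleted composite\<close>

lemma spath_del_vertex:
  assumes "spath E (S - {v}) s t"
  shows "traceable (del_vertex (S, E) v)"
proof -
  obtain p where p: "p \<noteq> []" "distinct p" "set p = S - {v}" "successively (\<lambda>u v. {u, v} \<in> E) p" "hd p = s" "last p = t"
    using assms(1) unfolding spath_def by blast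
  have "successively (\<lambda>x y. {x, y} \<in> {e \<in> E. v \<notin> e}) p"
    using p(4) by (rule successively_mono) (use p(3) in auto)
  then show ?thesis
    using p spath_traceable[OF spathI, of p] unfolding del_vertex_def by auto
qed

context four_fragments
begin

lemma edges_mono: "E1 \<subseteq> edges" "E2 \<subseteq> edges" "E3 \<subseteq> edges" "E4 \<subseteq> edges"
  and link_edges: "{a1, a3} \<in> edges" "{b1, b3} \<in> edges" "{a2, a4} \<in> edges" "{b2, b4} \<in> edges"
  unfolding edges_def links_def by auto

lemma disjoint_fragments: "V1 \<inter> V3 = {}" "V1 \<inter> V4 = {}" "V2 \<inter> V3 = {}" "V2 \<inter> V4 = {}"
  using disjoint by blast+

text \<open>The route is \<open>a4\<close>, then \<open>V2 - {c}\<close> from \<open>a2\<close> to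
  \<open>b2\<close>, \<open>V4 - {a4}\<close> from \<open>b4\<close> to \<open>d\<close>,
  \<open>V3 - {a3}\<close> from \<open>d\<close> to \<open>b3\<close>, \<open>V1 - {v}\<close> from
  \<open>b1\<close> to \<open>a1\<close>, and finally \<open>a3\<close>. The vertices left out of
  \<open>V3\<close> and \<open>V4\<close> form the two ends, and \<open>c\<close> is covered in
  \<open>V1\<close> unless it is \<open>v\<close>.\<close>

lemma route_ab:
  assumes "v \<in> V1" "spath E1 (V1 - {v}) a1 b1"
  shows "\<exists>s t. spath edges (verts - {v}) s t"
proof -
  have p1: "spath edges (V1 - {v}) b1 a1"
    by (rule spath_rev[OF spath_mono[OF assms(2) edges_mono(1)]])
  have p2: "spath edges (V2 - {c}) a2 b2"
    by (rule spath_mono[OF L.G.path_avoiding_c edges_mono(2)])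
  have p3: "spath edges (V3 - {a3}) d b3"
    by (rule spath_rev[OF spath_mono[OF R.F.path_avoiding_a edges_mono(3)]])
  have p4: "spath edges (V4 - {a4}) b4 d"
    by (rule spath_mono[OF R.G.path_avoiding_a edges_mono(4)])
  have "spath edges ({a4} \<union> (V2 - {c})) a4 b2"
    by (rule spath_append[OF spath_singleton p2])
      (use link_edges R.G.terminals disjoint_fragments in \<open>auto simp: insert_commute\<close>)
  then have "spath edges ({a4} \<union> (V2 - {c}) \<union> (V4 - {a4})) a4 d"
    by (rule spath_append[OF _ p4 link_edges(4)]) (use disjoint_fragments in auto)
  then have "spath edges ({a4} \<union> (V2 - {c}) \<union> (V4 - {a4}) \<union> (V3 - {a3})) a4 b3"
    by (rule spath_join[OF _ p3])
      (use disjoint_fragments R.meet R.F.terminals R.G.terminals R.terminals_sides in auto)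
  then have "spath edges ({a4} \<union> (V2 - {c}) \<union> (V4 - {a4}) \<union> (V3 - {a3}) \<union> (V1 - {v})) a4 a1"
    by (rule spath_append[OF _ p1])
      (use disjoint_fragments link_edges L.meet R.G.terminals in \<open>auto simp: insert_commute\<close>)
  then have "spath edges ({a4} \<union> (V2 - {c}) \<union> (V4 - {a4}) \<union> (V3 - {a3}) \<union> (V1 - {v}) \<union> {a3}) a4 a3"
    by (rule spath_append[OF _ spath_singleton link_edges(1)])
      (use disjoint_fragments R.F.terminals R.G.terminals R.terminals_sides in auto)
  moreover have "{a4} \<union> (V2 - {c}) \<union> (V4 - {a4}) \<union> (V3 - {a3}) \<union> (V1 - {v}) \<union> {a3} = verts - {v}"
  proof -
    have "v \<notin> V3" "v \<notin> V4" "v \<in> V2 \<Longrightarrow> v = c" using assms(1) disjoint_fragments L.meet by blast+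
    then show ?thesis
      using L.F.terminals(3) L.meet R.F.terminals R.G.terminals unfolding verts_def by auto
  qed
  ultimately show ?thesis by auto
qed

text \<open>The route is all of \<open>V3\<close> ending at \<open>a3\<close>, then
  \<open>V1 - {v}\<close> from \<open>a1\<close> to \<open>c\<close>, \<open>V2 - {a2}\<close> from
  \<open>c\<close> to \<open>b2\<close>, \<open>V4 - {d}\<close> from \<open>b4\<close> to
  \<open>a4\<close>, and finally \<open>a2\<close>. As \<open>d\<close> is covered within
  \<open>V3\<close>, this fragment is traversed completely, with only its end \<open>a3\<close>
  prescribed.\<close>

lemma route_ac:
  assumes "v \<in> V1" "spath E1 (V1 - {v}) a1 c"
  shows "\<exists>s t. spath edges (verts - {v}) s t"
proof -
  have vc: "v \<noteq> c" using spath_subset[OF assms(2)] by auto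
  obtain t where "spath E3 V3 a3 t" using R.F.path_from_a by auto
  then have p3: "spath edges V3 t a3"
    using spath_rev spath_mono[OF _ edges_mono(3)] by metis
  have p1: "spath edges (V1 - {v}) a1 c"
    by (rule spath_mono[OF assms(2) edges_mono(1)])
  have p2: "spath edges (V2 - {a2}) c b2"
    by (rule spath_rev[OF spath_mono[OF L.G.path_avoiding_a edges_mono(2)]])
  have p4: "spath edges (V4 - {d}) b4 a4"
    by (rule spath_rev[OF spath_mono[OF R.G.path_avoiding_c edges_mono(4)]])
  have "spath edges (V3 \<union> (V1 - {v})) t c"
    by (rule spath_append[OF p3 p1]) (use link_edges disjoint_fragments in \<open>auto simp: insert_commute\<close>)
  then have "spath edges (V3 \<union> (V1 - {v}) \<union> (V2 - {a2})) t b2"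
    by (rule spath_join[OF _ p2]) (use disjoint_fragments L.meet vc L.F.terminals L.G.terminals in auto)
  then have "spath edges (V3 \<union> (V1 - {v}) \<union> (V2 - {a2}) \<union> (V4 - {d})) t a4"
    by (rule spath_append[OF _ p4 link_edges(4)]) (use disjoint_fragments R.meet in auto)
  then have "spath edges (V3 \<union> (V1 - {v}) \<union> (V2 - {a2}) \<union> (V4 - {d}) \<union> {a2}) t a2"
    by (rule spath_append[OF _ spath_singleton])
      (use disjoint_fragments link_edges L.G.terminals L.terminals_sides in \<open>auto simp: insert_commute\<close>)
  moreover have "V3 \<union> (V1 - {v}) \<union> (V2 - {a2}) \<union> (V4 - {d}) \<union> {a2} = verts - {v}"
  proof -
    have "v \<notin> V3" "v \<notin> V4" "v \<notin> V2" using assms(1) disjoint_fragments L.meet vc by blast+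
    then show ?thesis
      using L.G.terminals R.F.terminals unfolding verts_def by auto
  qed
  ultimately show ?thesis by auto
qed

end

context four_fragments
begin

lemma exchange_edges: "four_fragments.edges E1 b1 a1 E2 b2 a2 E3 b3 a3 E4 b4 a4 = edges"
  unfolding edges_def links_def four_fragments.edges_def[OF four_fragments_exchange]
    four_fragments.links_def[OF four_fragments_exchange] by (simp add: insert_commute)

lemma swap_edges: "four_fragments.edges E2 a2 b2 E1 a1 b1 E4 a4 b4 E3 a3 b3 = edges"
  unfolding edges_def links_def four_fragments.edges_def[OF four_fragments_swap]
    four_fragments.links_def[OF four_fragments_swap] by (simp add: insert_commute Un_ac)

lemma swap_verts: "four_fragments.verts V2 V1 V4 V3 = verts"
  by (simp add: verts_def four_fragments.verts_def[OF four_fragments_swap] Un_ac)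

text \<open>A deletion path between \<open>b1\<close> and \<open>c\<close> is treated by
  \<open>route_ac\<close> after exchanging \<open>a\<close> and \<open>b\<close>. The case
  \<open>v = c\<close> is included.\<close>

lemma deletion_V1:
  assumes "v \<in> V1"
  shows "\<exists>s t. spath edges (verts - {v}) s t"
  using L.F.deletion_path_cases[OF assms] route_ab[OF assms] route_ac[OF assms]
    four_fragments.route_ac[OF four_fragments_exchange assms]
  unfolding exchange_edges by blast

end

context four_fragments
begin

lemma deletion_V2:
  assumes "v \<in> V2"
  shows "\<exists>s t. spath edges (verts - {v}) s t"
  using four_fragments.deletion_V1[OF four_fragments_swap assms]
  unfolding swap_edges swap_verts .

end

context four_fragments
begin

lemma finite_verts: "finite verts"
  using L.F.finite_verts L.G.finite_verts R.F.finite_verts R.G.finite_verts unfolding verts_def by simp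

lemma hypotraceable: "hypotraceable (verts, edges)"
  unfolding hypotraceable_def
proof (intro conjI ballI)
  show "\<not> traceable (verts, edges)" by (rule not_traceable)
next
  fix v assume "v \<in> uverts (verts, edges)"
  then have "v \<in> V1 \<or> v \<in> V2 \<or> v \<in> V3 \<or> v \<in> V4" unfolding verts_def by auto
  then obtain s t where "spath edges (verts - {v}) s t"
    using deletion_V1 deletion_V2 flip.deletion_V1 flip.deletion_V2 by blast
  then show "traceable (del_vertex (verts, edges) v)"
    by (rule spath_del_vertex)
qed

lemma finite_simple_graph: "finite_simple_graph (verts, edges)"
proof -
  have "a1 \<noteq> a3" "b1 \<noteq> b3" "a2 \<noteq> a4" "b2 \<noteq> b4"
    using sides[OF L_terminals(1)] sides[OF L_terminals(2)] sides[OF L_terminals(3)] sides[OF L_terminals(4)]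
      R_terminals by metis+
  moreover have "a1 \<in> verts" "b1 \<in> verts" "a2 \<in> verts" "b2 \<in> verts"
    "a3 \<in> verts" "b3 \<in> verts" "a4 \<in> verts" "b4 \<in> verts"
    unfolding verts_def using L_terminals R_terminals by (metis UnI1 UnI2)+
  ultimately have "e \<subseteq> verts \<and> card e = 2" if "e \<in> links" for e
    using that unfolding links_def by auto
  moreover have "e \<subseteq> verts \<and> card e = 2" if "e \<in> E1 \<union> E2 \<union> (E3 \<union> E4)" for e
    using that L.F.edges[of e] L.G.edges[of e] R.F.edges[of e] R.G.edges[of e] unfolding verts_def by blast
  ultimately show ?thesis
    using finite_verts unfolding finite_simple_graph_def edges_def by auto
qed

text \<open>Each of the two gluings identifies two vertices.\<close>

lemma card_verts: "card verts + 2 = card V1 + card V2 + card V3 + card V4"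
proof -
  have "card (V1 \<union> V2) + 1 = card V1 + card V2"
    using card_Un_Int[OF L.F.finite_verts L.G.finite_verts] L.meet by simp
  moreover have "card (V3 \<union> V4) + 1 = card V3 + card V4"
    using card_Un_Int[OF R.F.finite_verts R.G.finite_verts] R.meet by simp
  moreover have "card verts = card (V1 \<union> V2) + card (V3 \<union> V4)"
    unfolding verts_def using disjoint L.F.finite_verts L.G.finite_verts R.F.finite_verts R.G.finite_verts
    by (intro card_Un_disjoint) auto
  ultimately show ?thesis by simp
qed

end

section \<open>Ladders\<close>

fun pedges :: "'a list \<Rightarrow> 'a set set" where
  "pedges (x # y # zs) = insert {x, y} (pedges (y # zs))"
| "pedges _ = {}"

lemma successively_iff_pedges: "successively (\<lambda>u v. {u, v} \<in> E) p \<longleftrightarrow> pedges p \<subseteq> E"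
  by (induction p rule: pedges.induct) auto

lemma pedges_append: "pedges (xs @ x # ys) = pedges (xs @ [x]) \<union> pedges (x # ys)"
  by (induction xs rule: pedges.induct) auto

lemma pedges_rev: "pedges (rev p) = pedges p"
proof (induction p rule: pedges.induct)
  case (1 x y zs)
  have "pedges (rev (x # y # zs)) = pedges (rev zs @ [y]) \<union> pedges [y, x]"
    using pedges_append[of "rev zs" y "[x]"] by simp
  then show ?case using 1 by (simp add: insert_commute)
qed auto

lemma pedges_subset: "e \<in> pedges p \<Longrightarrow> e \<subseteq> set p"
  by (induction p rule: pedges.induct) auto

lemma pedges_split:
  assumes "{x, y} \<in> pedges p"
  obtains xs ys where "p = xs @ x # y # ys" | xs ys where "p = xs @ y # x # ys"
proof -
  have "(\<exists>xs ys. p = xs @ x # y # ys) \<or> (\<exists>xs ys. p = xs @ y # x # ys)"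
    using assms
  proof (induction p rule: pedges.induct)
    case (1 u v zs)
    show ?case
    proof (cases "{x, y} = {u, v}")
      case True
      then have "u # v # zs = [] @ x # y # zs \<or> u # v # zs = [] @ y # x # zs"
        by (auto simp: doubleton_eq_iff)
      then show ?thesis by blast
    next
      case False
      then have "{x, y} \<in> pedges (v # zs)" using 1 by auto
      then show ?thesis using 1(1) by (metis append_Cons)
    qed
  qed auto
  then show ?thesis using that by blast
qed

text \<open>In a distinct list the edge \<open>{x, y}\<close> occurs only once, so the detour really
  removes it from the edge set.\<close>

lemma insert_into_edge_aux:
  assumes p: "p = xs @ x # y # ys" and d: "distinct p" "distinct ns" "set p \<inter> set ns = {}"
  shows "distinct (xs @ x # ns @ y # ys)" "set (xs @ x # ns @ y # ys) = set p \<union> set ns"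
    "hd (xs @ x # ns @ y # ys) = hd p" "last (xs @ x # ns @ y # ys) = last p"
    "pedges (xs @ x # ns @ y # ys) = (pedges p - {{x, y}}) \<union> pedges (x # ns @ [y])"
proof -
  have "x \<notin> set (y # ys)" "y \<notin> set (xs @ [x])" using d(1) p by auto
  then have "{x, y} \<notin> pedges (xs @ [x])" "{x, y} \<notin> pedges (y # ys)"
    using pedges_subset[of "{x, y}"] by blast+
  moreover have "pedges p = pedges (xs @ [x]) \<union> insert {x, y} (pedges (y # ys))"
    unfolding p using pedges_append[of xs x "y # ys"] by simp
  moreover have "pedges (xs @ x # ns @ y # ys) = pedges (xs @ [x]) \<union> pedges (x # ns @ [y]) \<union> pedges (y # ys)"
    using pedges_append[of xs x "ns @ y # ys"] pedges_append[of "x # ns" y ys] by (simp add: Un_assoc)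
  ultimately show "pedges (xs @ x # ns @ y # ys) = (pedges p - {{x, y}}) \<union> pedges (x # ns @ [y])"
    by auto
qed (use p d in \<open>auto simp: hd_append\<close>)

lemma insert_into_edge:
  assumes "{x, y} \<in> pedges p" "distinct p" "distinct ns" "set p \<inter> set ns = {}"
  obtains q where "q \<noteq> []" "distinct q" "set q = set p \<union> set ns" "hd q = hd p" "last q = last p"
    "pedges q = (pedges p - {{x, y}}) \<union> pedges (x # ns @ [y])"
  using assms(1)
proof (cases rule: pedges_split)
  case (1 xs ys)
  show ?thesis
    by (rule that[of "xs @ x # ns @ y # ys"]) (use insert_into_edge_aux[OF 1 assms(2-4)] in auto)
next
  case (2 xs ys)
  have "pedges (y # rev ns @ [x]) = pedges (x # ns @ [y])"
    using pedges_rev[of "x # ns @ [y]"] by simp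
  then show ?thesis
    using insert_into_edge_aux[OF 2, of "rev ns"] assms(2-4)
    by (intro that[of "xs @ y # rev ns @ x # ys"]) (auto simp: insert_commute)
qed

definition spath_via :: "'a set set \<Rightarrow> 'a set \<Rightarrow> 'a \<Rightarrow> 'a \<Rightarrow> 'a set set \<Rightarrow> bool" where
  "spath_via E S s t Q \<longleftrightarrow> (\<exists>p. p \<noteq> [] \<and> distinct p \<and> set p = S \<and> pedges p \<subseteq> E \<and> hd p = s \<and>
     last p = t \<and> pedges p \<inter> Q \<noteq> {})"

lemma spath_viaI:
  assumes "p \<noteq> []" "distinct p" "set p = S" "pedges p \<subseteq> E" "hd p = s" "last p = t" "pedges p \<inter> Q \<noteq> {}"
  shows "spath_via E S s t Q"
  using assms unfolding spath_via_def by blast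

lemma spath_via_spath: "spath_via E S s t Q \<Longrightarrow> spath E S s t"
  unfolding spath_via_def spath_def successively_iff_pedges by blast

text \<open>The 4-cycle \<open>t1 t2 b2 b1\<close> is regarded as a ladder with rails \<open>t1 t2\<close> and \<open>b1 b2\<close> and rungs
  \<open>t1 b1\<close> and \<open>t2 b2\<close>. A path through an edge of the 4-cycle can be detoured through the new
  vertices of a longer ladder; the conditions at deleted vertices of the 4-cycle serve the deletion of
  a new vertex.\<close>

locale laddered_fragment = fragment V E a b c for V :: "'a set" and E a b c +
  fixes t1 t2 b1 b2 :: 'a
  assumes quad_distinct: "distinct [t1, t2, b1, b2]"
    and quad_edges: "{t1, t2} \<in> E" "{b1, b2} \<in> E" "{t1, b1} \<in> E" "{t2, b2} \<in> E"
    and deletion_via: "v \<in> V - {t1, t2, b1, b2} \<Longrightarrow> \<exists>s\<in>{a, b, c}. \<exists>t\<in>{a, b, c}. s \<noteq> t \<and>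
        spath_via E (V - {v}) s t {{t1, t2}, {b1, b2}, {t1, b1}, {t2, b2}}"
    and deletion_t: "v \<in> {t1, t2} \<Longrightarrow> \<exists>s\<in>{a, b, c}. \<exists>t\<in>{a, b, c}. s \<noteq> t \<and> spath_via E (V - {v}) s t {{b1, b2}}"
    and deletion_b: "v \<in> {b1, b2} \<Longrightarrow> \<exists>s\<in>{a, b, c}. \<exists>t\<in>{a, b, c}. s \<noteq> t \<and> spath_via E (V - {v}) s t {{t1, t2}}"
    and path_from_a_via: "\<exists>t. spath_via E V a t {{t1, t2}, {b1, b2}, {t1, b1}, {t2, b2}}"
    and path_from_b_via: "\<exists>t. spath_via E V b t {{t1, t2}, {b1, b2}, {t1, b1}, {t2, b2}}"

section \<open>Replacing a 4-cycle by a ladder with two more rungs\<close>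

locale ladder_extension = laddered_fragment V E a b c t1 t2 b1 b2
  for V :: "'a set" and E a b c t1 t2 b1 b2 +
  fixes x1 x2 y1 y2 :: 'a
  assumes new_distinct: "distinct [x1, x2, y1, y2]"
    and new: "{x1, x2, y1, y2} \<inter> V = {}"
begin

abbreviation "W \<equiv> {x1, x2, y1, y2}"

text \<open>The rails become \<open>t1 x1 x2 t2\<close> and \<open>b1 y1 y2 b2\<close>; the old
  rungs stay. The middle cell \<open>x1 x2 y2 y1\<close> will be the distinguished 4-cycle of the
  extended fragment.\<close>

definition E' :: "'a set set" where
  "E' = (E - {{t1, t2}, {b1, b2}}) \<union>
    {{t1, x1}, {x1, x2}, {x2, t2}, {b1, y1}, {y1, y2}, {y2, b2}, {x1, y1}, {x2, y2}}"

lemma quad_verts: "t1 \<in> V" "t2 \<in> V" "b1 \<in> V" "b2 \<in> V"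
  using quad_edges edges by blast+

lemma new_notin: "x1 \<notin> V" "x2 \<notin> V" "y1 \<notin> V" "y2 \<notin> V"
  using new by auto

lemma old_new: "u \<in> V \<Longrightarrow> u \<noteq> x1 \<and> u \<noteq> x2 \<and> u \<noteq> y1 \<and> u \<noteq> y2"
  using new by auto

lemma new_adj:
  "{x1, z} \<in> E' \<longleftrightarrow> z \<in> {t1, x2, y1}" "{x2, z} \<in> E' \<longleftrightarrow> z \<in> {t2, x1, y2}"
  "{y1, z} \<in> E' \<longleftrightarrow> z \<in> {b1, y2, x1}" "{y2, z} \<in> E' \<longleftrightarrow> z \<in> {b2, y1, x2}"
proof -
  have n: "{w, z} \<notin> E" if "w \<notin> V" for w using that edges[of "{w, z}"] by auto
  note s = old_new[OF quad_verts(1)] old_new[OF quad_verts(2)] old_new[OF quad_verts(3)] old_new[OF quad_verts(4)]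
  show "{x1, z} \<in> E' \<longleftrightarrow> z \<in> {t1, x2, y1}" "{x2, z} \<in> E' \<longleftrightarrow> z \<in> {t2, x1, y2}"
    "{y1, z} \<in> E' \<longleftrightarrow> z \<in> {b1, y2, x1}" "{y2, z} \<in> E' \<longleftrightarrow> z \<in> {b2, y1, x2}"
    unfolding E'_def using n[OF new_notin(1)] n[OF new_notin(2)] n[OF new_notin(3)] n[OF new_notin(4)] s new_distinct
    by (auto simp: doubleton_eq_iff)
qed

lemma new_edges:
  "{t1, x1} \<in> E'" "{x1, x2} \<in> E'" "{x2, t2} \<in> E'" "{b1, y1} \<in> E'" "{y1, y2} \<in> E'" "{y2, b2} \<in> E'"
  "{x1, y1} \<in> E'" "{x2, y2} \<in> E'"
  "{x1, t1} \<in> E'" "{x2, x1} \<in> E'" "{t2, x2} \<in> E'" "{y1, b1} \<in> E'" "{y2, y1} \<in> E'" "{b2, y2} \<in> E'"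
  "{y1, x1} \<in> E'" "{y2, x2} \<in> E'"
  unfolding E'_def by (simp_all add: insert_commute)

lemma old_edges: "X \<subseteq> E - {{t1, t2}, {b1, b2}} \<Longrightarrow> X \<subseteq> E'"
  unfolding E'_def by (rule le_supI1)

text \<open>If the path uses both rails, each is subdivided by its two new vertices. If it uses only
  one rail, or only a rung, that edge is replaced by a detour around all four new vertices. In each
  case an edge of the middle cell is used, as the next extension requires.\<close>

lemma extend:
  assumes "spath_via E S s t Q" "Q \<subseteq> {{t1, t2}, {b1, b2}, {t1, b1}, {t2, b2}}" "S \<subseteq> V"
  shows "spath_via E' (S \<union> W) s t {{x1, x2}, {y1, y2}, {x1, y1}, {x2, y2}}"
proof -
  obtain p where p: "p \<noteq> []" "distinct p" "set p = S" "pedges p \<subseteq> E" "hd p = s" "last p = t" "pedges p \<inter> Q \<noteq> {}"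
    using assms(1) unfolding spath_via_def by blast
  have disj: "set p \<inter> W = {}" using p(3) assms(3) new by blast
  have ne: "{t1, t2} \<noteq> {b1, b2}" using quad_distinct by (auto simp: doubleton_eq_iff)
  \<comment> \<open>Common to the cases in which the single edge \<open>{u, v}\<close> gives way to
    a detour through all new vertices.\<close>
  have one: ?thesis if e: "{u, v} \<in> pedges p" and ns: "distinct ns" "set ns = W"
    and E: "pedges p - {{u, v}} \<subseteq> E - {{t1, t2}, {b1, b2}}"
    and new: "pedges (u # ns @ [v]) \<subseteq> E'"
    and used: "pedges (u # ns @ [v]) \<inter> {{x1, x2}, {y1, y2}, {x1, y1}, {x2, y2}} \<noteq> {}" for u v ns
  proof -
    have "set p \<inter> set ns = {}" using disj ns(2) by simp
    then obtain q where q: "q \<noteq> []" "distinct q" "set q = set p \<union> set ns" "hd q = hd p" "last q = last p"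
      "pedges q = (pedges p - {{u, v}}) \<union> pedges (u # ns @ [v])"
      by (rule insert_into_edge[OF e p(2) ns(1)])
    have "pedges q \<subseteq> E'" unfolding q(6) by (rule Un_least[OF old_edges[OF E] new])
    moreover have "pedges q \<inter> {{x1, x2}, {y1, y2}, {x1, y1}, {x2, y2}} \<noteq> {}"
      unfolding q(6) Int_Un_distrib2 using used by simp
    ultimately show ?thesis
      using q(1-5) p(3,5,6) ns(2) by (intro spath_viaI[of q]) simp_all
  qed
  consider (both) "{t1, t2} \<in> pedges p" "{b1, b2} \<in> pedges p"
    | (t) "{t1, t2} \<in> pedges p" "{b1, b2} \<notin> pedges p"
    | (b) "{t1, t2} \<notin> pedges p" "{b1, b2} \<in> pedges p"
    | (r1) "{t1, t2} \<notin> pedges p" "{b1, b2} \<notin> pedges p" "{t1, b1} \<in> pedges p"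
    | (r2) "{t1, t2} \<notin> pedges p" "{b1, b2} \<notin> pedges p" "{t2, b2} \<in> pedges p"
    using p(7) assms(2) by blast
  then show ?thesis
  proof cases
    case both
    have d: "distinct [x1, x2]" "set p \<inter> set [x1, x2] = {}" "distinct [y1, y2]" using new_distinct disj by auto
    obtain q where q: "q \<noteq> []" "distinct q" "set q = set p \<union> set [x1, x2]" "hd q = hd p" "last q = last p"
      "pedges q = (pedges p - {{t1, t2}}) \<union> pedges (t1 # [x1, x2] @ [t2])"
      by (rule insert_into_edge[OF both(1) p(2) d(1,2)])
    have bq: "{b1, b2} \<in> pedges q" using both q(6) ne by auto
    have "set q \<inter> set [y1, y2] = {}" using new_distinct disj q(3) by auto
    then obtain r where r: "r \<noteq> []" "distinct r" "set r = set q \<union> set [y1, y2]" "hd r = hd q" "last r = last q"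
      "pedges r = (pedges q - {{b1, b2}}) \<union> pedges (b1 # [y1, y2] @ [b2])"
      by (rule insert_into_edge[OF bq q(2) d(3)])
    have "pedges r \<subseteq> (pedges p - {{t1, t2}, {b1, b2}}) \<union> {{t1, x1}, {x1, x2}, {x2, t2}, {b1, y1}, {y1, y2}, {y2, b2}}"
      unfolding r(6) q(6) by auto
    also have "\<dots> \<subseteq> E'"
      by (rule Un_least[OF old_edges]) (use p(4) new_edges in auto)
    finally have "pedges r \<subseteq> E'" .
    moreover have "{y1, y2} \<in> pedges r" unfolding r(6) by simp
    moreover have "set r = S \<union> W" unfolding r(3) q(3) p(3) by auto
    ultimately show ?thesis
      using r(1,2,4,5) q(4,5) p(5,6) by (intro spath_viaI[of r]) auto
  next
    case t
    show ?thesis by (rule one[OF t(1), of "[x1, y1, y2, x2]"])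
      (use new_distinct p(4) t in \<open>simp_all add: new_edges insert_commute\<close>, blast+)
  next
    case b
    show ?thesis by (rule one[OF b(2), of "[y1, x1, x2, y2]"])
      (use new_distinct p(4) b in \<open>simp_all add: new_edges insert_commute\<close>, blast+)
  next
    case r1
    show ?thesis by (rule one[OF r1(3), of "[x1, x2, y2, y1]"])
      (use new_distinct p(4) r1 in \<open>simp_all add: new_edges insert_commute\<close>, blast+)
  next
    case r2
    show ?thesis by (rule one[OF r2(3), of "[x2, x1, y1, y2]"])
      (use new_distinct p(4) r2 in \<open>simp_all add: new_edges insert_commute\<close>, blast+)
  qed
qed

text \<open>Deleting the new vertex \<open>w\<close> is reduced to deleting an old corner
  \<open>z\<close>: the rail \<open>{u, v}\<close> away from \<open>z\<close> is replaced by a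
  detour through \<open>z\<close> and the three remaining new vertices.\<close>

lemma replace_rail:
  assumes "spath_via E (V - {z}) s t {{u, v}}" "z \<in> {t1, t2, b1, b2}" "{u, v} \<in> {{t1, t2}, {b1, b2}}"
    and "z \<notin> {u, v}" "distinct ns" "set ns = insert z (W - {w})" "w \<in> W"
    and "pedges (u # ns @ [v]) \<subseteq> E'" "pedges (u # ns @ [v]) \<inter> Q \<noteq> {}"
  shows "spath_via E' ((V \<union> W) - {w}) s t Q"
proof -
  obtain p where p: "p \<noteq> []" "distinct p" "set p = V - {z}" "pedges p \<subseteq> E" "hd p = s" "last p = t"
    "{u, v} \<in> pedges p"
    using assms(1) unfolding spath_via_def by auto
  have zV: "z \<in> V" using assms(2) quad_verts by auto
  have "set p \<inter> set ns = {}" using p(3) assms(6) new by auto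
  then obtain q where q: "q \<noteq> []" "distinct q" "set q = set p \<union> set ns" "hd q = hd p" "last q = last p"
    "pedges q = (pedges p - {{u, v}}) \<union> pedges (u # ns @ [v])"
    by (rule insert_into_edge[OF p(7) p(2) assms(5)])
  have "{t1, t2} \<in> pedges p \<Longrightarrow> z \<notin> {t1, t2}" "{b1, b2} \<in> pedges p \<Longrightarrow> z \<notin> {b1, b2}"
    using pedges_subset[of _ p] p(3) by auto
  then have "pedges p - {{u, v}} \<subseteq> E - {{t1, t2}, {b1, b2}}"
    using p(4) assms(2,3,4) by auto
  from Un_least[OF old_edges[OF this] assms(8)] have "pedges q \<subseteq> E'" unfolding q(6) .
  moreover have "pedges q \<inter> Q \<noteq> {}" unfolding q(6) Int_Un_distrib2 using assms(9) by simp
  moreover have "set q = (V \<union> W) - {w}" unfolding q(3) p(3) assms(6) using zV assms(7) new by blast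
  ultimately show ?thesis
    using q(1,2,4,5) p(5,6) by (intro spath_viaI[of q]) simp_all
qed


lemma rungs: "{t1, b1} \<in> E'" "{b1, t1} \<in> E'" "{t2, b2} \<in> E'" "{b2, t2} \<in> E'"
proof -
  have "{{t1, b1}, {t2, b2}} \<subseteq> E'"
    by (rule old_edges) (use quad_edges quad_distinct in \<open>auto simp: doubleton_eq_iff\<close>)
  then show "{t1, b1} \<in> E'" "{b1, t1} \<in> E'" "{t2, b2} \<in> E'" "{b2, t2} \<in> E'"
    by (simp_all add: insert_commute)
qed

lemma E'_avoiding_new:
  assumes "pedges l \<subseteq> E'" "set l \<inter> W = {}"
  shows "pedges l \<subseteq> E"
proof
  fix e assume e: "e \<in> pedges l"
  then have "e \<inter> W = {}" using pedges_subset[of e l] assms(2) by blast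
  moreover have "e \<in> E'" using e assms(1) by blast
  ultimately show "e \<in> E" unfolding E'_def by auto
qed

lemma quad_edges_sym: "{t2, t1} \<in> E" "{b2, b1} \<in> E" "{b1, t1} \<in> E" "{b2, t2} \<in> E"
  using quad_edges by (simp_all add: insert_commute)

lemma new_quad_distinct:
  "t1 \<noteq> x1" "t1 \<noteq> x2" "t1 \<noteq> y1" "t1 \<noteq> y2" "t2 \<noteq> x1" "t2 \<noteq> x2" "t2 \<noteq> y1" "t2 \<noteq> y2"
  "b1 \<noteq> x1" "b1 \<noteq> x2" "b1 \<noteq> y1" "b1 \<noteq> y2" "b2 \<noteq> x1" "b2 \<noteq> x2" "b2 \<noteq> y1" "b2 \<noteq> y2"
  using old_new quad_verts by blast+

section \<open>Contracting the new vertices out of a path\<close>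

text \<open>Every new vertex has just one neighbour outside \<open>W\<close>, so a run of a single
  new vertex would have to return to where it came from.\<close>

lemma run1:
  assumes "{w, x} \<in> E'" "{w, y} \<in> E'" "w \<in> W" "x \<notin> W" "y \<notin> W"
  shows "x = y"
proof -
  consider "w = x1" | "w = x2" | "w = y1" | "w = y2" using assms(3) by blast
  then show ?thesis
    by cases (use assms(1,2,4,5) in \<open>auto simp: new_adj\<close>)
qed

text \<open>Adjacent new vertices are attached to adjacent corners of the old 4-cycle.\<close>

lemma run2:
  assumes "{w1, x} \<in> E'" "{w1, w2} \<in> E'" "{w2, y} \<in> E'" "w1 \<in> W" "w2 \<in> W" "x \<notin> W" "y \<notin> W"
  shows "{x, y} \<in> E"
proof -
  consider "w1 = x1" | "w1 = x2" | "w1 = y1" | "w1 = y2" using assms(4) by blast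
  then show ?thesis
    by cases (use assms(1-3,5-7) new_distinct new_quad_distinct quad_edges quad_edges_sym in
        \<open>auto simp: new_adj\<close>)
qed

text \<open>The new vertices form a 4-cycle, so the two ends of a run through all of them are
  adjacent and \<open>run2\<close> applies.\<close>

lemma run4:
  assumes "{w1, x} \<in> E'" "{w1, w2} \<in> E'" "{w2, w3} \<in> E'" "{w3, w4} \<in> E'" "{w4, y} \<in> E'"
    "w1 \<in> W" "w2 \<in> W" "w3 \<in> W" "w4 \<in> W" "distinct [w1, w2, w3, w4]" "x \<notin> W" "y \<notin> W"
  shows "{x, y} \<in> E"
proof -
  have "{w4, w1} \<in> E'"
  proof -
    consider "w1 = x1" | "w1 = x2" | "w1 = y1" | "w1 = y2" using assms(6) by blast
    then show ?thesis
      by cases (use assms(2-4,7-10) new_distinct new_quad_distinct in \<open>auto simp: new_adj\<close>)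
  qed
  then have "{y, x} \<in> E"
    using run2[of w4 y w1 x] assms by simp
  then show ?thesis by (simp add: insert_commute)
qed

end

lemma short_list_cases:
  assumes "ns \<noteq> []" "length ns \<le> 4"
  obtains w1 where "ns = [w1]" | w1 w2 where "ns = [w1, w2]" | w1 w2 w3 where "ns = [w1, w2, w3]"
    | w1 w2 w3 w4 where "ns = [w1, w2, w3, w4]"
proof -
  obtain w1 r1 where 1: "ns = w1 # r1" using assms(1) by (cases ns) auto
  show ?thesis
  proof (cases r1)
    case Nil
    then show ?thesis using 1 that(1) by simp
  next
    case 2: (Cons w2 r2)
    show ?thesis
    proof (cases r2)
      case Nil
      then show ?thesis using 1 2 that(2) by simp
    next
      case 3: (Cons w3 r3)
      show ?thesis
      proof (cases r3)
        case Nil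
        then show ?thesis using 1 2 3 that(3) by simp
      next
        case 4: (Cons w4 r4)
        then have "r4 = []" using assms(2) 1 2 3 by simp
        then show ?thesis using 1 2 3 4 that(4) by simp
      qed
    qed
  qed
qed

lemma first_run:
  assumes "p \<noteq> []" "hd p \<notin> W" "last p \<notin> W" "set p \<inter> W \<noteq> {}"
  obtains xs x ns y ys where "p = xs @ x # ns @ y # ys" "set xs \<inter> W = {}" "x \<notin> W" "ns \<noteq> []"
    "set ns \<subseteq> W" "y \<notin> W"
proof -
  define A B where "A = takeWhile (\<lambda>v. v \<notin> W) p" and "B = dropWhile (\<lambda>v. v \<notin> W) p"
  have AB: "p = A @ B" unfolding A_def B_def by simp
  have B: "B \<noteq> []" using assms(4) unfolding B_def by (auto simp: dropWhile_eq_Nil_conv)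
  then have hdB: "hd B \<in> W" using hd_dropWhile[of "\<lambda>v. v \<notin> W" p] unfolding B_def by simp
  have A: "A \<noteq> []" "set A \<inter> W = {}"
    unfolding A_def using assms(1,2) by (cases p, auto dest: set_takeWhileD)
  define N C where "N = takeWhile (\<lambda>v. v \<in> W) B" and "C = dropWhile (\<lambda>v. v \<in> W) B"
  have NC: "B = N @ C" unfolding N_def C_def by simp
  have N: "N \<noteq> []" "set N \<subseteq> W"
    unfolding N_def using B hdB by (cases B, auto dest: set_takeWhileD)
  have "last B \<notin> W" using assms(3) AB B by simp
  then have C: "C \<noteq> []" using last_in_set[OF B] unfolding C_def by (auto simp: dropWhile_eq_Nil_conv)
  then have "hd C \<notin> W" using hd_dropWhile[of "\<lambda>v. v \<in> W" B] unfolding C_def by simp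
  moreover have "p = butlast A @ last A # N @ hd C # tl C" using AB NC A(1) C by simp
  moreover have "set (butlast A) \<inter> W = {}" "last A \<notin> W"
    using A in_set_butlastD[of _ A] last_in_set[of A] by blast+
  ultimately show ?thesis using that[OF _ _ _ N] by simp
qed

context ladder_extension
begin

text \<open>Nothing is claimed about the outer neighbours of a run of three vertices: they are
  opposite corners, and such runs are excluded later by counting.\<close>

lemma contract_run:
  assumes p: "pedges p \<subseteq> E'" "distinct p" "p \<noteq> []" "hd p \<notin> W" "last p \<notin> W" "set p \<inter> W \<noteq> {}"
  obtains xs x ns y ys where "p = xs @ x # ns @ y # ys" "set xs \<inter> W = {}" "x \<notin> W" "y \<notin> W"
    "set ns \<subseteq> W" "2 \<le> length ns" "length ns \<noteq> 3 \<Longrightarrow> {x, y} \<in> E"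
proof -
  obtain xs x ns y ys where s: "p = xs @ x # ns @ y # ys" "set xs \<inter> W = {}" "x \<notin> W" "ns \<noteq> []"
    "set ns \<subseteq> W" "y \<notin> W"
    using first_run[OF p(3-6)] .
  have xy: "x \<noteq> y" "distinct ns" using p(2) s(1) by auto
  have "pedges (x # ns @ y # ys) \<subseteq> E'" using p(1) pedges_append[of xs x "ns @ y # ys"] unfolding s(1) by simp
  moreover have "pedges (x # ns @ y # ys) = pedges (x # ns @ [y]) \<union> pedges (y # ys)"
    using pedges_append[of "x # ns" y ys] by simp
  ultimately have run: "pedges (x # ns @ [y]) \<subseteq> E'" by simp
  have "length ns \<le> 4"
    using card_mono[OF _ s(5)] distinct_card[OF xy(2)] new_distinct by simp
  from s(4) this have "2 \<le> length ns \<and> (length ns \<noteq> 3 \<longrightarrow> {x, y} \<in> E)"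
  proof (cases rule: short_list_cases)
    case (1 w)
    then have "{w, x} \<in> E'" "{w, y} \<in> E'" "w \<in> W" using run s(5) by (simp_all add: insert_commute)
    then have "x = y" using run1 s(3,6) by blast
    then show ?thesis using xy(1) by simp
  next
    case (2 w1 w2)
    then have "{w1, x} \<in> E'" "{w1, w2} \<in> E'" "{w2, y} \<in> E'" "w1 \<in> W" "w2 \<in> W"
      using run s(5) by (simp_all add: insert_commute)
    from run2[OF this s(3,6)] show ?thesis using 2 by simp
  next
    case 3
    then show ?thesis by simp
  next
    case (4 w1 w2 w3 w4)
    then have "{w1, x} \<in> E'" "{w1, w2} \<in> E'" "{w2, w3} \<in> E'" "{w3, w4} \<in> E'" "{w4, y} \<in> E'"
      "w1 \<in> W" "w2 \<in> W" "w3 \<in> W" "w4 \<in> W" "distinct [w1, w2, w3, w4]"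
      using run s(5) xy(2) by (simp_all add: insert_commute)
    from run4[OF this s(3,6)] show ?thesis using 4 by simp
  qed
  then show ?thesis using that[OF s(1,2,3,6,5)] by blast
qed

text \<open>The ends of the path are old vertices, so the new ones form runs of at least two
  vertices, four in total: one run of four or two runs of two. Dropping them leaves a terminal path
  of the old fragment, because the gaps are bridged by edges of the old 4-cycle.\<close>

lemma no_terminal_path_extended:
  assumes st: "s \<in> {a, b, c}" "t \<in> {a, b, c}" "s \<noteq> t"
  shows "\<not> spath E' (V \<union> W) s t"
proof
  assume "spath E' (V \<union> W) s t"
  then obtain p where p: "p \<noteq> []" "distinct p" "set p = V \<union> W" "pedges p \<subseteq> E'" "hd p = s" "last p = t"
    unfolding spath_def successively_iff_pedges by blast
  have stV: "s \<notin> W" "t \<notin> W" using st(1,2) terminals new_notin by auto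
  define r where "r = filter (\<lambda>v. v \<notin> W) p"
  have "set p \<inter> W \<noteq> {}" using p(3) by auto
  then obtain xs x ns y ys where 1: "p = xs @ x # ns @ y # ys" "set xs \<inter> W = {}" "x \<notin> W" "y \<notin> W"
    "set ns \<subseteq> W" "2 \<le> length ns" "length ns \<noteq> 3 \<Longrightarrow> {x, y} \<in> E"
    using contract_run[OF p(4,2,1)] p(5,6) stV by metis
  have fxs: "filter (\<lambda>v. v \<notin> W) xs = xs" and fns: "filter (\<lambda>v. v \<notin> W) ns = []"
    using 1(2,5) by (auto simp: filter_id_conv filter_empty_conv)
  have r1: "r = xs @ x # y # filter (\<lambda>v. v \<notin> W) ys" unfolding r_def 1(1) using fxs fns 1(3,4) by simp
  have dns: "distinct ns" and Wns: "set (y # ys) \<inter> W = W - set ns"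
    using p(2,3) 1(2-5) unfolding 1(1) by auto
  have cardW: "card W = 4" using new_distinct by simp
  have cns: "card (set ns) = length ns" by (rule distinct_card[OF dns])
  have P: "pedges (xs @ [x]) \<subseteq> E'" "pedges (y # ys) \<subseteq> E'"
    using p(4) unfolding 1(1) pedges_append[of xs x "ns @ y # ys"] using pedges_append[of "x # ns" y ys] by auto
  have Px: "pedges (xs @ [x]) \<subseteq> E" using E'_avoiding_new[OF P(1)] 1(2,3) by auto
  have "pedges r \<subseteq> E"
  proof (cases "set (y # ys) \<inter> W = {}")
    case True
    \<comment> \<open>No second run exists, so the first one contains all new vertices.\<close>
    then have "length ns = 4" using Wns cns cardW 1(5) by (metis Diff_eq_empty_iff subset_antisym)
    then have "{x, y} \<in> E" using 1(7) by simp
    moreover have "filter (\<lambda>v. v \<notin> W) ys = ys" using True by (auto simp: filter_id_conv)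
    moreover have "pedges (y # ys) \<subseteq> E" by (rule E'_avoiding_new[OF P(2) True])
    ultimately show ?thesis
      unfolding r1 using Px pedges_append[of xs x "y # ys"] by simp
  next
    case False
    have "distinct (y # ys)" "last (y # ys) \<notin> W" using p(2,6) stV(2) unfolding 1(1) by auto
    then obtain zs x' ms y' us where 2: "y # ys = zs @ x' # ms @ y' # us" "set zs \<inter> W = {}" "x' \<notin> W" "y' \<notin> W"
      "set ms \<subseteq> W" "2 \<le> length ms" "length ms \<noteq> 3 \<Longrightarrow> {x', y'} \<in> E"
      using contract_run[OF P(2) _ _ _ _ False] 1(4) by (metis list.distinct(1) list.sel(1))
    have dms: "distinct ms" using \<open>distinct (y # ys)\<close> unfolding 2(1) by auto
    have cms: "card (set ms) = length ms" by (rule distinct_card[OF dms])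
    have "set ms \<subseteq> W - set ns" using Wns 2(5) unfolding 2(1) by auto
    then have disj: "set ns \<inter> set ms = {}" by auto
    then have "card (set ns \<union> set ms) = length ns + length ms"
      using cns cms card_Un_disjoint[of "set ns" "set ms"] by simp
    moreover have sub: "set ns \<union> set ms \<subseteq> W" using 1(5) 2(5) by auto
    then have "card (set ns \<union> set ms) \<le> 4" using card_mono[OF _ sub] cardW by simp
    \<comment> \<open>Both runs have at least two of the four new vertices, which rules out a run of
      three.\<close>
    ultimately have len: "length ns = 2" "length ms = 2" using 1(6) 2(6) by auto
    then have W: "set ns \<union> set ms = W"
      using card_subset_eq[OF _ sub] cardW \<open>card (set ns \<union> set ms) = length ns + length ms\<close> by simp
    have xy: "{x, y} \<in> E" "{x', y'} \<in> E" using 1(7) 2(7) len by auto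
    have "set us \<inter> set ns = {}" "set us \<inter> set ms = {}"
      using p(2) \<open>distinct (y # ys)\<close> Wns 2(1) unfolding 1(1) by auto
    then have us: "set us \<inter> W = {}" using W by blast
    have f: "filter (\<lambda>v. v \<notin> W) (y # ys) = zs @ x' # y' # us"
    proof -
      have "filter (\<lambda>v. v \<notin> W) zs = zs" "filter (\<lambda>v. v \<notin> W) ms = []" "filter (\<lambda>v. v \<notin> W) us = us"
        using 2(2,5) us by (auto simp: filter_id_conv filter_empty_conv)
      then show ?thesis unfolding 2(1) using 2(3,4) by simp
    qed
    then have r2: "r = xs @ x # (zs @ x' # y' # us)" unfolding r1 using 1(4) by simp
    have "pedges (zs @ [x']) \<subseteq> E'" "pedges (y' # us) \<subseteq> E'"
      using P(2) unfolding 2(1) pedges_append[of zs x' "ms @ y' # us"]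
      using pedges_append[of "x' # ms" y' us] by auto
    then have Q: "pedges (zs @ [x']) \<subseteq> E" "pedges (y' # us) \<subseteq> E"
      using E'_avoiding_new[of "zs @ [x']"] E'_avoiding_new[of "y' # us"] 2(2-4) us by auto
    have "pedges (zs @ x' # y' # us) \<subseteq> E"
      using Q xy(2) pedges_append[of zs x' "y' # us"] by simp
    \<comment> \<open>The contracted remainder still starts with \<open>y\<close>; if
      \<open>zs\<close> is empty, then \<open>x'\<close> is \<open>y\<close>.\<close>
    moreover have "zs @ x' # y' # us = y # tl (zs @ x' # y' # us)"
      using 2(1) by (cases zs) auto
    ultimately have "pedges (x # (zs @ x' # y' # us)) \<subseteq> E"
      using xy(1) by (metis insert_subset pedges.simps(1))
    then show ?thesis
      unfolding r2 using Px pedges_append[of xs x "zs @ x' # y' # us"] by simp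
  qed
  moreover have "set r = V" unfolding r_def using p(3) new by auto
  moreover have "distinct r" unfolding r_def using p(2) by simp
  moreover have "r \<noteq> []" using r1 by simp
  moreover have "hd r = s" using p(5) unfolding r1 1(1) by (cases xs) auto
  moreover have "last r = t"
  proof -
    have "p = butlast p @ [last p]" using p(1) by simp
    then have "r = filter (\<lambda>v. v \<notin> W) (butlast p) @ [t]"
      unfolding r_def using p(6) stV(2) by (metis (no_types, lifting) filter.simps filter_append)
    then show ?thesis by simp
  qed
  ultimately have "spath E V s t"
    unfolding spath_def successively_iff_pedges by blast
  then show False using no_terminal_path[OF st] by simp
qed

section \<open>Deletion paths of the extended fragment\<close>

lemma terminal_path_map:
  assumes "\<exists>s\<in>{a, b, c}. \<exists>t\<in>{a, b, c}. s \<noteq> t \<and> P s t" "\<And>s t. P s t \<Longrightarrow> P' s t"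
  shows "\<exists>s\<in>{a, b, c}. \<exists>t\<in>{a, b, c}. s \<noteq> t \<and> P' s t"
  using assms(1) by (elim bexE conjE) (intro bexI conjI assms(2))

text \<open>For an old corner the available path uses the rail away from it, which
  \<open>extend\<close> accepts just as it accepts any edge of the 4-cycle. Old corners become
  ordinary vertices of the extended fragment.\<close>

lemma deletion_old:
  assumes "v \<in> V"
  shows "\<exists>s\<in>{a, b, c}. \<exists>t\<in>{a, b, c}. s \<noteq> t \<and> spath_via E' ((V \<union> W) - {v}) s t {{x1, x2}, {y1, y2}, {x1, y1}, {x2, y2}}"
proof -
  have eq: "(V - {v}) \<union> W = (V \<union> W) - {v}" using assms new by auto
  have ext: "spath_via E' ((V \<union> W) - {v}) s t {{x1, x2}, {y1, y2}, {x1, y1}, {x2, y2}}"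
    if "spath_via E (V - {v}) s t Q" "Q \<subseteq> {{t1, t2}, {b1, b2}, {t1, b1}, {t2, b2}}" for s t Q
    using extend[OF that] unfolding eq by simp
  consider "v \<in> V - {t1, t2, b1, b2}" | "v \<in> {t1, t2}" | "v \<in> {b1, b2}" using assms by blast
  then show ?thesis
  proof cases
    case 1
    show ?thesis by (rule terminal_path_map[OF deletion_via[OF 1]]) (erule ext, simp)
  next
    case 2
    show ?thesis by (rule terminal_path_map[OF deletion_t[OF 2]]) (erule ext, simp)
  next
    case 3
    show ?thesis by (rule terminal_path_map[OF deletion_b[OF 3]]) (erule ext, simp)
  qed
qed

text \<open>For \<open>x1\<close>, the deletion path of \<open>b1\<close> has its top rail replaced
  by \<open>t1 b1 y1 y2 x2 t2\<close>; for \<open>x2\<close>, that of \<open>b2\<close> by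
  \<open>t1 x1 y1 y2 b2 t2\<close>. Both contain \<open>{y1, y2}\<close>, the rail that the new
  4-cycle demands at these vertices.\<close>

lemma deletion_x:
  assumes "v \<in> {x1, x2}"
  shows "\<exists>s\<in>{a, b, c}. \<exists>t\<in>{a, b, c}. s \<noteq> t \<and> spath_via E' ((V \<union> W) - {v}) s t {{y1, y2}}"
proof -
  consider "v = x1" | "v = x2" using assms by blast
  then show ?thesis
  proof cases
    case 1
    show ?thesis unfolding 1
      by (rule terminal_path_map[OF deletion_b[of b1]], simp, rule replace_rail[where ns = "[b1, y1, y2, x2]" and z = b1], assumption)
        (use quad_distinct new_distinct new_quad_distinct new_edges rungs in auto)
  next
    case 2
    show ?thesis unfolding 2
      by (rule terminal_path_map[OF deletion_b[of b2]], simp, rule replace_rail[where ns = "[x1, y1, y2, b2]" and z = b2], assumption)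
        (use quad_distinct new_distinct new_quad_distinct new_edges rungs in auto)
  qed
qed

lemma deletion_y:
  assumes "v \<in> {y1, y2}"
  shows "\<exists>s\<in>{a, b, c}. \<exists>t\<in>{a, b, c}. s \<noteq> t \<and> spath_via E' ((V \<union> W) - {v}) s t {{x1, x2}}"
proof -
  consider "v = y1" | "v = y2" using assms by blast
  then show ?thesis
  proof cases
    case 1
    show ?thesis unfolding 1
      by (rule terminal_path_map[OF deletion_t[of t1]], simp, rule replace_rail[where ns = "[t1, x1, x2, y2]" and z = t1], assumption)
        (use quad_distinct new_distinct new_quad_distinct new_edges rungs in auto)
  next
    case 2
    show ?thesis unfolding 2
      by (rule terminal_path_map[OF deletion_t[of t2]], simp, rule replace_rail[where ns = "[y1, x1, x2, t2]" and z = t2], assumption)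
        (use quad_distinct new_distinct new_quad_distinct new_edges rungs in auto)
  qed
qed

lemma extended: "laddered_fragment (V \<union> W) E' a b c x1 x2 y1 y2"
proof
  show "finite (V \<union> W)" using finite_verts by simp
  show "e \<subseteq> V \<union> W \<and> card e = 2" if "e \<in> E'" for e
  proof (cases "e \<in> E")
    case True
    then show ?thesis using edges[OF True] by blast
  next
    case False
    have "e \<in> {{t1, x1}, {x1, x2}, {x2, t2}, {b1, y1}, {y1, y2}, {y2, b2}, {x1, y1}, {x2, y2}}"
      using False that unfolding E'_def by simp
    then show ?thesis
      using quad_verts new_distinct
      by (elim insertE emptyE) (simp_all add: new_quad_distinct new_quad_distinct[symmetric])
  qed
  show "a \<in> V \<union> W" "b \<in> V \<union> W" "c \<in> V \<union> W" "a \<noteq> b" "a \<noteq> c" "b \<noteq> c" using terminals by auto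
  show "s \<in> {a, b, c} \<Longrightarrow> t \<in> {a, b, c} \<Longrightarrow> s \<noteq> t \<Longrightarrow> \<not> spath E' (V \<union> W) s t" for s t
    by (rule no_terminal_path_extended)
  show "\<exists>s\<in>{a, b, c}. \<exists>t\<in>{a, b, c}. s \<noteq> t \<and> spath E' ((V \<union> W) - {v}) s t" if v: "v \<in> V \<union> W" for v
  proof -
    consider "v \<in> V" | "v \<in> {x1, x2}" | "v \<in> {y1, y2}" using v by blast
    then show ?thesis
    proof cases
      case 1
      show ?thesis by (rule terminal_path_map[OF deletion_old[OF 1] spath_via_spath])
    next
      case 2
      show ?thesis by (rule terminal_path_map[OF deletion_x[OF 2] spath_via_spath])
    next
      case 3
      show ?thesis by (rule terminal_path_map[OF deletion_y[OF 3] spath_via_spath])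
    qed
  qed
  have a: "\<exists>t. spath_via E' (V \<union> W) z t {{x1, x2}, {y1, y2}, {x1, y1}, {x2, y2}}"
    if "\<exists>t. spath_via E V z t {{t1, t2}, {b1, b2}, {t1, b1}, {t2, b2}}" for z
    using that extend by blast
  show "\<exists>t. spath_via E' (V \<union> W) a t {{x1, x2}, {y1, y2}, {x1, y1}, {x2, y2}}"
    "\<exists>t. spath_via E' (V \<union> W) b t {{x1, x2}, {y1, y2}, {x1, y1}, {x2, y2}}"
    by (rule a[OF path_from_a_via] a[OF path_from_b_via])+
  then show "\<exists>t. spath E' (V \<union> W) a t" "\<exists>t. spath E' (V \<union> W) b t"
    using spath_via_spath by metis+
  show "distinct [x1, x2, y1, y2]" by (rule new_distinct)
  show "{x1, x2} \<in> E'" "{y1, y2} \<in> E'" "{x1, y1} \<in> E'" "{x2, y2} \<in> E'" by (rule new_edges)+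
  show "\<exists>s\<in>{a, b, c}. \<exists>t\<in>{a, b, c}. s \<noteq> t \<and>
      spath_via E' ((V \<union> W) - {v}) s t {{x1, x2}, {y1, y2}, {x1, y1}, {x2, y2}}"
    if "v \<in> V \<union> W - {x1, x2, y1, y2}" for v
    by (rule deletion_old) (use that in blast)
  show "v \<in> {x1, x2} \<Longrightarrow> \<exists>s\<in>{a, b, c}. \<exists>t\<in>{a, b, c}. s \<noteq> t \<and> spath_via E' ((V \<union> W) - {v}) s t {{y1, y2}}" for v
    by (rule deletion_x)
  show "v \<in> {y1, y2} \<Longrightarrow> \<exists>s\<in>{a, b, c}. \<exists>t\<in>{a, b, c}. s \<noteq> t \<and> spath_via E' ((V \<union> W) - {v}) s t {{x1, x2}}" for v
    by (rule deletion_y)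
qed

end

section \<open>Straight-line drawings\<close>

text \<open>The convex hull of the image of an edge is its segment. Since every vertex is required
  to lie on an edge, the condition on pairs of edges already keeps vertices off the edges not
  containing them.\<close>

definition straight :: "'a set \<Rightarrow> 'a set set \<Rightarrow> ('a \<Rightarrow> real \<times> real) \<Rightarrow> bool" where
  "straight V E pos \<longleftrightarrow> inj_on pos V \<and> (\<forall>e\<in>E. e \<subseteq> V) \<and> (\<forall>v\<in>V. \<exists>e\<in>E. v \<in> e) \<and>
     (\<forall>e\<in>E. \<forall>e'\<in>E. e \<noteq> e' \<longrightarrow> convex hull (pos ` e) \<inter> convex hull (pos ` e') \<subseteq> pos ` (e \<inter> e'))"

lemma straightD:
  assumes "straight V E pos"
  shows "inj_on pos V" "\<And>e. e \<in> E \<Longrightarrow> e \<subseteq> V" "\<And>v. v \<in> V \<Longrightarrow> \<exists>e\<in>E. v \<in> e"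
    "\<And>e e' x. e \<in> E \<Longrightarrow> e' \<in> E \<Longrightarrow> e \<noteq> e' \<Longrightarrow> x \<in> convex hull (pos ` e) \<Longrightarrow> x \<in> convex hull (pos ` e')
       \<Longrightarrow> x \<in> pos ` (e \<inter> e')"
proof -
  show "inj_on pos V" "\<And>e. e \<in> E \<Longrightarrow> e \<subseteq> V" "\<And>v. v \<in> V \<Longrightarrow> \<exists>e\<in>E. v \<in> e"
    using assms unfolding straight_def by simp_all
  fix e e' x assume e: "e \<in> E" "e' \<in> E" "e \<noteq> e'" "x \<in> convex hull (pos ` e)" "x \<in> convex hull (pos ` e')"
  have "convex hull (pos ` e) \<inter> convex hull (pos ` e') \<subseteq> pos ` (e \<inter> e')"
    using assms e(1-3) unfolding straight_def by simp
  then show "x \<in> pos ` (e \<inter> e')" using e(4,5) by blast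
qed

text \<open>Some edge at \<open>v\<close> meets \<open>e\<close> in \<open>pos v\<close>, which is
  then the image of a common end; injectivity identifies that end with \<open>v\<close>.\<close>

lemma straight_vertex:
  assumes "straight V E pos" "v \<in> V" "e \<in> E" "pos v \<in> convex hull (pos ` e)"
  shows "v \<in> e"
proof (rule ccontr)
  assume v: "v \<notin> e"
  obtain e' where e': "e' \<in> E" "v \<in> e'" using straightD(3)[OF assms(1,2)] by blast
  then have "pos v \<in> pos ` (e \<inter> e')"
    using straightD(4)[OF assms(1,3), of e' "pos v"] v assms(4) hull_inc[of "pos v" "pos ` e'"] by blast
  then obtain w where "w \<in> e" "pos v = pos w" by blast
  then show False
    using straightD(1,2)[OF assms(1)] assms(2,3) v unfolding inj_on_def by blast
qed

lemma straight_planar: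
  assumes "finite_simple_graph (V, E)" "straight V E pos"
  shows "planar (V, E)"
proof -
  have "\<exists>g. arc g \<and> {pathstart g, pathfinish g} = pos ` e \<and> path_image g = convex hull (pos ` e)" if e: "e \<in> E" for e
  proof -
    obtain u v where uv: "e = {u, v}" "u \<noteq> v" "u \<in> V" "v \<in> V"
      using assms(1) e unfolding finite_simple_graph_def by (auto simp: card_2_iff)
    then have "pos u \<noteq> pos v" using straightD(1)[OF assms(2)] unfolding inj_on_def by blast
    then show ?thesis
      using uv(1) by (intro exI[of _ "linepath (pos u) (pos v)"]) (auto simp: arc_linepath segment_convex_hull)
  qed
  then obtain \<gamma> where g: "\<And>e. e \<in> E \<Longrightarrow> arc (\<gamma> e)"
    "\<And>e. e \<in> E \<Longrightarrow> {pathstart (\<gamma> e), pathfinish (\<gamma> e)} = pos ` e"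
    "\<And>e. e \<in> E \<Longrightarrow> path_image (\<gamma> e) = convex hull (pos ` e)"
    by metis
  have "plane_drawing (V, E) pos \<gamma>"
    unfolding plane_drawing_def fst_conv snd_conv
  proof (intro conjI ballI impI)
    show "inj_on pos V" by (rule straightD(1)[OF assms(2)])
    fix e assume e: "e \<in> E"
    show "arc (\<gamma> e)" "{pathstart (\<gamma> e), pathfinish (\<gamma> e)} = pos ` e" by (rule g[OF e])+
    show "(path_image (\<gamma> e) - pos ` e) \<inter> pos ` V = {}"
      using straight_vertex[OF assms(2) _ e] g(3)[OF e] by blast
    fix e' assume e': "e' \<in> E" "e \<noteq> e'"
    show "(path_image (\<gamma> e) - pos ` e) \<inter> path_image (\<gamma> e') = {}"
      using straightD(4)[OF assms(2) e e'] g(3)[OF e] g(3)[OF e'(1)] by blast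
  qed
  then show ?thesis unfolding planar_def by blast
qed

lemma straight_cong:
  assumes "straight V E pos" "\<And>v. v \<in> V \<Longrightarrow> pos' v = pos v"
  shows "straight V E pos'"
proof -
  have "pos' ` e = pos ` e" if "e \<subseteq> V" for e using assms(2) that by (intro image_cong) auto
  moreover have "inj_on pos' V" using straightD(1)[OF assms(1)] assms(2) by (simp cong: inj_on_cong)
  ultimately show ?thesis
    using assms(1) straightD(2)[OF assms(1)] unfolding straight_def
    by (metis (no_types, lifting) inf.coboundedI1)
qed

lemma straight_compose:
  assumes "straight V E pos" "inj f" "\<And>S. f ` (convex hull S) = convex hull (f ` S)"
  shows "straight V E (f \<circ> pos)"
proof -
  have hull: "convex hull ((f \<circ> pos) ` e) = f ` (convex hull (pos ` e))" for e
    by (simp add: assms(3) image_comp)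
  show ?thesis
    unfolding straight_def hull
  proof (intro conjI ballI impI)
    show "inj_on (f \<circ> pos) V"
      using straightD(1)[OF assms(1)] inj_on_subset[OF assms(2) subset_UNIV] by (rule comp_inj_on)
    show "\<And>e. e \<in> E \<Longrightarrow> e \<subseteq> V" by (rule straightD(2)[OF assms(1)])
    show "\<And>v. v \<in> V \<Longrightarrow> \<exists>e\<in>E. v \<in> e" by (rule straightD(3)[OF assms(1)])
    fix e e' assume e: "e \<in> E" "e' \<in> E" "e \<noteq> e'"
    have "f ` (convex hull (pos ` e)) \<inter> f ` (convex hull (pos ` e')) = f ` (convex hull (pos ` e) \<inter> convex hull (pos ` e'))"
      by (rule image_Int[OF assms(2), symmetric])
    also have "\<dots> \<subseteq> f ` (pos ` (e \<inter> e'))"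
      by (rule image_mono) (use straightD(4)[OF assms(1) e] in blast)
    finally show "f ` (convex hull (pos ` e)) \<inter> f ` (convex hull (pos ` e')) \<subseteq> (f \<circ> pos) ` (e \<inter> e')"
      by (simp add: image_comp)
  qed
qed

lemma straight_relabel:
  assumes "straight V E pos" "inj_on \<phi> V"
  shows "straight (\<phi> ` V) ((`) \<phi> ` E) (pos \<circ> inv_into V \<phi>)"
proof -
  have im: "(pos \<circ> inv_into V \<phi>) ` \<phi> ` e = pos ` e" if "e \<subseteq> V" for e
    using that assms(2) by (force simp: image_comp inv_into_f_f)
  have Int: "\<phi> ` e \<inter> \<phi> ` e' = \<phi> ` (e \<inter> e')" if "e \<subseteq> V" "e' \<subseteq> V" for e e'
    by (rule inj_on_image_Int[OF assms(2) that, symmetric])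
  show ?thesis
    unfolding straight_def
  proof (intro conjI ballI impI)
    show "inj_on (pos \<circ> inv_into V \<phi>) (\<phi> ` V)"
      by (rule comp_inj_on[OF inj_on_inv_into[OF subset_refl]])
        (simp add: inv_into_image_cancel[OF assms(2) subset_refl] straightD(1)[OF assms(1)])
    show "e \<subseteq> \<phi> ` V" if "e \<in> (`) \<phi> ` E" for e
      using that by (elim imageE) (simp add: image_mono straightD(2)[OF assms(1)])
    show "\<exists>e\<in>(`) \<phi> ` E. v \<in> e" if "v \<in> \<phi> ` V" for v
    proof -
      from that obtain w where w: "w \<in> V" "v = \<phi> w" by (elim imageE)
      obtain e where "e \<in> E" "w \<in> e" using straightD(3)[OF assms(1) w(1)] by (elim bexE)
      then show ?thesis using w(2) by (intro bexI[of _ "\<phi> ` e"] imageI) simp_all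
    qed
    fix d d' assume "d \<in> (`) \<phi> ` E" "d' \<in> (`) \<phi> ` E" and ne: "d \<noteq> d'"
    then obtain e e' where e: "e \<in> E" "e' \<in> E" "d = \<phi> ` e" "d' = \<phi> ` e'" by blast
    have V: "e \<subseteq> V" "e' \<subseteq> V" "e \<inter> e' \<subseteq> V" using straightD(2)[OF assms(1)] e by blast+
    show "convex hull ((pos \<circ> inv_into V \<phi>) ` d) \<inter> convex hull ((pos \<circ> inv_into V \<phi>) ` d')
        \<subseteq> (pos \<circ> inv_into V \<phi>) ` (d \<inter> d')"
      unfolding e(3,4) Int[OF V(1,2)] im[OF V(1)] im[OF V(2)] im[OF V(3)]
    proof
      fix x assume x: "x \<in> convex hull (pos ` e) \<inter> convex hull (pos ` e')"
      have "e \<noteq> e'" using ne e(3,4) by auto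
      from straightD(4)[OF assms(1) e(1,2) this] x show "x \<in> pos ` (e \<inter> e')" by simp
    qed
  qed
qed

lemma straight_Un:
  assumes "straight V E pos" "straight V' E' pos" "inj_on pos (V \<union> V')"
    and "\<And>e e' x. e \<in> E \<Longrightarrow> e' \<in> E' \<Longrightarrow> e \<noteq> e' \<Longrightarrow> x \<in> convex hull (pos ` e) \<Longrightarrow> x \<in> convex hull (pos ` e')
      \<Longrightarrow> x \<in> pos ` (e \<inter> e')"
  shows "straight (V \<union> V') (E \<union> E') pos"
  unfolding straight_def
proof (intro conjI ballI impI)
  show "inj_on pos (V \<union> V')" by (rule assms(3))
  show "\<And>e. e \<in> E \<union> E' \<Longrightarrow> e \<subseteq> V \<union> V'" using straightD(2)[OF assms(1)] straightD(2)[OF assms(2)] by blast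
  show "\<And>v. v \<in> V \<union> V' \<Longrightarrow> \<exists>e\<in>E \<union> E'. v \<in> e" using straightD(3)[OF assms(1)] straightD(3)[OF assms(2)] by blast
  fix e e' assume e: "e \<in> E \<union> E'" "e' \<in> E \<union> E'" "e \<noteq> e'"
  show "convex hull (pos ` e) \<inter> convex hull (pos ` e') \<subseteq> pos ` (e \<inter> e')"
  proof
    fix x assume x: "x \<in> convex hull (pos ` e) \<inter> convex hull (pos ` e')"
    consider "e \<in> E" "e' \<in> E" | "e \<in> E'" "e' \<in> E'" | "e \<in> E" "e' \<in> E'" | "e \<in> E'" "e' \<in> E" using e by blast
    then show "x \<in> pos ` (e \<inter> e')"
    proof cases
      case 1 then show ?thesis using straightD(4)[OF assms(1) 1 e(3)] x by blast
    next
      case 2 then show ?thesis using straightD(4)[OF assms(2) 2 e(3)] x by blast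
    next
      case 3 then show ?thesis using assms(4)[OF 3 e(3)] x by blast
    next
      case 4 then show ?thesis using assms(4)[OF 4(2,1) e(3)[symmetric]] x by (simp add: Int_commute)
    qed
  qed
qed

text \<open>Contacts between a new and an old edge only have to be at an end of the new one;
  \<open>straight_vertex\<close> turns such an end into a common vertex.\<close>

lemma straight_add_edges:
  assumes "straight V E pos" "\<And>l. l \<in> L \<Longrightarrow> l \<subseteq> V"
    and "\<And>l e x. l \<in> L \<Longrightarrow> e \<in> E \<Longrightarrow> x \<in> convex hull (pos ` l) \<Longrightarrow> x \<in> convex hull (pos ` e) \<Longrightarrow> x \<in> pos ` l"
    and "\<And>l l'. l \<in> L \<Longrightarrow> l' \<in> L \<Longrightarrow> l \<noteq> l' \<Longrightarrow> convex hull (pos ` l) \<inter> convex hull (pos ` l') = {}"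
  shows "straight V (E \<union> L) pos"
  unfolding straight_def
proof (intro conjI ballI impI)
  show "inj_on pos V" by (rule straightD(1)[OF assms(1)])
  show "\<And>e. e \<in> E \<union> L \<Longrightarrow> e \<subseteq> V" using straightD(2)[OF assms(1)] assms(2) by blast
  show "\<And>v. v \<in> V \<Longrightarrow> \<exists>e\<in>E \<union> L. v \<in> e" using straightD(3)[OF assms(1)] by blast
  have mixed: "x \<in> pos ` (l \<inter> e)" if m: "l \<in> L" "e \<in> E" "x \<in> convex hull (pos ` l)" "x \<in> convex hull (pos ` e)" for l e x
  proof -
    obtain u where u: "u \<in> l" "x = pos u" using assms(3)[OF m] by blast
    then have "u \<in> e" using straight_vertex[OF assms(1) _ m(2)] assms(2)[OF m(1)] m(4) by blast
    then show ?thesis using u by blast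
  qed
  fix e e' assume e: "e \<in> E \<union> L" "e' \<in> E \<union> L" "e \<noteq> e'"
  show "convex hull (pos ` e) \<inter> convex hull (pos ` e') \<subseteq> pos ` (e \<inter> e')"
  proof
    fix x assume x: "x \<in> convex hull (pos ` e) \<inter> convex hull (pos ` e')"
    consider "e \<in> E" "e' \<in> E" | "e \<in> L" "e' \<in> L" | "e \<in> L" "e' \<in> E" | "e \<in> E" "e' \<in> L" using e by blast
    then show "x \<in> pos ` (e \<inter> e')"
    proof cases
      case 1 then show ?thesis using straightD(4)[OF assms(1) 1 e(3)] x by blast
    next
      case 2 then show ?thesis using assms(4)[OF 2 e(3)] x by blast
    next
      case 3 then show ?thesis using mixed[OF 3] x by blast
    next
      case 4 then show ?thesis using mixed[OF 4(2,1), of x] x by (simp add: Int_commute)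
    qed
  qed
qed

section \<open>Placing the four fragments in the plane\<close>

text \<open>With signs for \<open>\<alpha>\<close> and \<open>\<beta>\<close>, and \<open>k\<close>
  equal to 0 or 4 accordingly, these are the reflections in \<open>y = 0\<close> and
  \<open>x = 2\<close>, their product and the identity.\<close>

definition aff :: "real \<Rightarrow> real \<Rightarrow> real \<Rightarrow> real \<times> real \<Rightarrow> real \<times> real" where
  "aff k \<alpha> \<beta> z = (k + \<alpha> * fst z, \<beta> * snd z)"

lemma aff_hull: "aff k \<alpha> \<beta> ` (convex hull S) = convex hull (aff k \<alpha> \<beta> ` S)"
proof -
  let ?g = "\<lambda>z::real \<times> real. (\<alpha> * fst z, \<beta> * snd z)"
  have "linear ?g" by (rule linearI) (simp_all add: distrib_left prod_eq_iff)
  then have g: "?g ` (convex hull S) = convex hull (?g ` S)" by (rule convex_hull_linear_image)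
  have aff: "aff k \<alpha> \<beta> ` X = (\<lambda>x. (k, 0) + x) ` (?g ` X)" for X
    by (simp add: image_image aff_def)
  show ?thesis unfolding aff g by (rule convex_hull_translation[symmetric])
qed

lemma aff_inj: "\<alpha> \<noteq> 0 \<Longrightarrow> \<beta> \<noteq> 0 \<Longrightarrow> inj (aff k \<alpha> \<beta>)"
  by (rule injI) (simp add: aff_def prod_eq_iff)

text \<open>The closed triangle with corners (0, 0), (1, 1) and (1, 2), as an intersection of
  half-planes.\<close>

definition sector :: "(real \<times> real) set" where
  "sector = {z. fst z \<le> 1 \<and> fst z \<le> snd z \<and> snd z \<le> 2 * fst z}"

lemma convex_sector: "convex sector"
proof -
  have eq: "sector = {z. inner (1, 0) z \<le> 1} \<inter> {z. inner (1, - 1) z \<le> 0} \<inter> {z. inner (- 2, 1) z \<le> 0}"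
    unfolding sector_def by auto
  show ?thesis unfolding eq by (intro convex_Int convex_halfspace_le)
qed

text \<open>The terminals occupy the corners of the triangle: \<open>c\<close> the apex at which a
  pair is glued, \<open>a\<close> and \<open>b\<close> the side \<open>x = 1\<close> facing the
  links.\<close>

definition drawn :: "'a set \<Rightarrow> 'a set set \<Rightarrow> 'a \<Rightarrow> 'a \<Rightarrow> 'a \<Rightarrow> ('a \<Rightarrow> real \<times> real) \<Rightarrow> bool" where
  "drawn V E a b c pos \<longleftrightarrow> straight V E pos \<and> pos ` V \<subseteq> sector \<and>
     pos a = (1, 2) \<and> pos b = (1, 1) \<and> pos c = (0, 0)"

text \<open>The four fragments are drawn in the four images of \<open>sector\<close> under the reflections in the
  lines \<open>y = 0\<close> and \<open>x = 2\<close>; the linking edges are then horizontal segments.\<close>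

lemma (in four_fragments) planar:
  assumes "drawn V1 E1 a1 b1 c p1" "drawn V2 E2 a2 b2 c p2" "drawn V3 E3 a3 b3 d p3" "drawn V4 E4 a4 b4 d p4"
  shows "planar (verts, edges)"
proof -
  \<comment> \<open>At \<open>c\<close> and \<open>d\<close> two of the formulas compete; they
    agree, because these vertices sit at the origin of their triangles, which lies on the reflection
    axis of the pair.\<close>
  define pos where "pos v = (if v \<in> V1 then aff 0 1 1 (p1 v) else if v \<in> V2 then aff 0 1 (-1) (p2 v)
    else if v \<in> V3 then aff 4 (-1) 1 (p3 v) else aff 4 (-1) (-1) (p4 v))" for v
  note D = assms[unfolded drawn_def]
  have pos1: "pos v = aff 0 1 1 (p1 v)" if "v \<in> V1" for v using that by (simp add: pos_def)
  have pos2: "pos v = aff 0 1 (-1) (p2 v)" if "v \<in> V2" for v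
    using that L.meetD[of v] D by (auto simp: pos_def aff_def)
  have pos3: "pos v = aff 4 (-1) 1 (p3 v)" if "v \<in> V3" for v
    using that disjoint by (auto simp: pos_def)
  have pos4: "pos v = aff 4 (-1) (-1) (p4 v)" if "v \<in> V4" for v
    using that disjoint R.meetD[of v] D by (auto simp: pos_def aff_def)
  have S: "straight V E pos \<and> (\<forall>e\<in>E. convex hull (pos ` e) \<subseteq> aff k \<alpha> \<beta> ` sector) \<and> pos ` V \<subseteq> aff k \<alpha> \<beta> ` sector"
    if "straight V E p" "p ` V \<subseteq> sector" "\<And>v. v \<in> V \<Longrightarrow> pos v = aff k \<alpha> \<beta> (p v)" "\<alpha> \<noteq> 0" "\<beta> \<noteq> 0"
    for V E p k \<alpha> \<beta>
  proof (intro conjI ballI)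
    have "straight V E (aff k \<alpha> \<beta> \<circ> p)"
      by (rule straight_compose[OF that(1) aff_inj[OF that(4,5)] aff_hull])
    then show "straight V E pos" by (rule straight_cong) (simp add: that(3))
    show "pos ` V \<subseteq> aff k \<alpha> \<beta> ` sector" using that(2,3) by auto
    fix e assume "e \<in> E"
    then have e: "e \<subseteq> V" by (rule straightD(2)[OF that(1)])
    have "pos ` e = (aff k \<alpha> \<beta> \<circ> p) ` e" by (rule image_cong) (use that(3) e in auto)
    then have "pos ` e = aff k \<alpha> \<beta> ` (p ` e)" by (simp add: image_comp)
    then have "convex hull (pos ` e) = aff k \<alpha> \<beta> ` (convex hull (p ` e))" by (simp add: aff_hull)
    moreover have "convex hull (p ` e) \<subseteq> sector"
      using that(2) e by (intro hull_minimal convex_sector) auto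
    ultimately show "convex hull (pos ` e) \<subseteq> aff k \<alpha> \<beta> ` sector" by auto
  qed
  have D': "straight V1 E1 p1" "p1 ` V1 \<subseteq> sector" "straight V2 E2 p2" "p2 ` V2 \<subseteq> sector"
    "straight V3 E3 p3" "p3 ` V3 \<subseteq> sector" "straight V4 E4 p4" "p4 ` V4 \<subseteq> sector"
    using D by simp_all
  note S1 = S[OF D'(1,2) pos1] and S2 = S[OF D'(3,4) pos2] and S3 = S[OF D'(5,6) pos3] and S4 = S[OF D'(7,8) pos4]
  have st: "straight V1 E1 pos" "straight V2 E2 pos" "straight V3 E3 pos" "straight V4 E4 pos"
    and hl: "\<And>e. e \<in> E1 \<Longrightarrow> convex hull (pos ` e) \<subseteq> aff 0 1 1 ` sector"
    "\<And>e. e \<in> E2 \<Longrightarrow> convex hull (pos ` e) \<subseteq> aff 0 1 (-1) ` sector"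
    "\<And>e. e \<in> E3 \<Longrightarrow> convex hull (pos ` e) \<subseteq> aff 4 (-1) 1 ` sector"
    "\<And>e. e \<in> E4 \<Longrightarrow> convex hull (pos ` e) \<subseteq> aff 4 (-1) (-1) ` sector"
    and ps: "pos ` V1 \<subseteq> aff 0 1 1 ` sector" "pos ` V2 \<subseteq> aff 0 1 (-1) ` sector"
    "pos ` V3 \<subseteq> aff 4 (-1) 1 ` sector" "pos ` V4 \<subseteq> aff 4 (-1) (-1) ` sector"
    using S1 S2 S3 S4 by simp_all
  \<comment> \<open>A triangle and its mirror image in the axis \<open>y = 0\<close> share only the
    apex.\<close>
  have meet12: "aff k \<alpha> 1 ` sector \<inter> aff k \<alpha> (-1) ` sector \<subseteq> {(k, 0)}" for k \<alpha>
    unfolding sector_def aff_def by auto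
  have cd: "pos c = (0, 0)" "pos d = (4, 0)"
    using pos1[OF L.F.terminals(3)] pos3[OF R.F.terminals(3)] D by (simp_all add: aff_def)
  have glue: "straight (V \<union> V') (E \<union> E') pos"
    if "straight V E pos" "straight V' E' pos" "z \<in> V" "z \<in> V'" "pos z = (k, 0)"
      and h: "\<And>e. e \<in> E \<Longrightarrow> convex hull (pos ` e) \<subseteq> aff k \<alpha> 1 ` sector"
        "\<And>e. e \<in> E' \<Longrightarrow> convex hull (pos ` e) \<subseteq> aff k \<alpha> (-1) ` sector"
      and p: "pos ` V \<subseteq> aff k \<alpha> 1 ` sector" "pos ` V' \<subseteq> aff k \<alpha> (-1) ` sector"
    for V V' E E' z k \<alpha>
  proof (rule straight_Un[OF that(1,2)])
    have z: "v = z" if "v \<in> V" "w \<in> V'" "pos v = pos w" for v w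
    proof -
      have "pos v \<in> aff k \<alpha> 1 ` sector \<inter> aff k \<alpha> (-1) ` sector"
        using subsetD[OF p(1) imageI[OF that(1)]] subsetD[OF p(2) imageI[OF that(2)]] that(3) by simp
      from subsetD[OF meet12 this] have "pos v = pos z" using \<open>pos z = (k, 0)\<close> by simp
      then show ?thesis by (rule inj_onD[OF straightD(1)[OF \<open>straight V E pos\<close>] _ that(1) \<open>z \<in> V\<close>])
    qed
    have z': "w = z" if "v \<in> V" "w \<in> V'" "pos v = pos w" for v w
    proof -
      have "pos w = pos z" using z[OF that] that by simp
      then show ?thesis by (rule inj_onD[OF straightD(1)[OF \<open>straight V' E' pos\<close>] _ that(2) \<open>z \<in> V'\<close>])
    qed
    show "inj_on pos (V \<union> V')"
    proof (rule inj_onI)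
      fix v w assume "v \<in> V \<union> V'" "w \<in> V \<union> V'" and eq: "pos v = pos w"
      then consider "v \<in> V" "w \<in> V" | "v \<in> V'" "w \<in> V'" | "v \<in> V" "w \<in> V'" | "v \<in> V'" "w \<in> V" by blast
      then show "v = w"
      proof cases
        case 1 then show ?thesis using inj_onD[OF straightD(1)[OF that(1)] eq] by simp
      next
        case 2 then show ?thesis using inj_onD[OF straightD(1)[OF that(2)] eq] by simp
      next
        case 3 then show ?thesis using z[OF 3 eq] z'[OF 3 eq] by simp
      next
        case 4 then show ?thesis using z[OF 4(2,1) eq[symmetric]] z'[OF 4(2,1) eq[symmetric]] by simp
      qed
    qed
    fix e e' x assume e: "e \<in> E" "e' \<in> E'" "x \<in> convex hull (pos ` e)" "x \<in> convex hull (pos ` e')"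
    have "x \<in> aff k \<alpha> 1 ` sector \<inter> aff k \<alpha> (-1) ` sector"
      by (rule IntI[OF subsetD[OF h(1)[OF e(1)] e(3)] subsetD[OF h(2)[OF e(2)] e(4)]])
    from subsetD[OF meet12 this] have "x = pos z" using \<open>pos z = (k, 0)\<close> by simp
    have "z \<in> e" "z \<in> e'"
      using \<open>x = pos z\<close> straight_vertex[OF that(1) that(3) e(1)] straight_vertex[OF that(2) that(4) e(2)] e(3,4) by auto
    then show "x \<in> pos ` (e \<inter> e')" unfolding \<open>x = pos z\<close> by simp
  qed
  have sL: "straight (V1 \<union> V2) (E1 \<union> E2) pos"
    by (rule glue[OF st(1,2) L.F.terminals(3) L.G.terminals(3) cd(1) hl(1,2) ps(1,2)])
  have sR: "straight (V3 \<union> V4) (E3 \<union> E4) pos"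
    by (rule glue[OF st(3,4) R.F.terminals(3) R.G.terminals(3) cd(2) hl(3,4) ps(3,4)])
  \<comment> \<open>The left triangles lie in \<open>x \<le> 1\<close>, the right ones in
    \<open>x \<ge> 3\<close>; the links cross the strip between them at the heights 2, 1, -1 and
    -2.\<close>
  have tL: "fst x \<le> 1" if "x \<in> aff 0 1 \<beta> ` sector" for x \<beta>
    using that unfolding sector_def aff_def by auto
  have tR: "3 \<le> fst x" if "x \<in> aff 4 (-1) \<beta> ` sector" for x \<beta>
    using that unfolding sector_def aff_def by auto
  have eL: "fst x \<le> 1" if "e \<in> E1 \<union> E2" "x \<in> convex hull (pos ` e)" for e x
    using that(1) tL[OF subsetD[OF hl(1) that(2)]] tL[OF subsetD[OF hl(2) that(2)]] by (elim UnE)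
  have eR: "3 \<le> fst x" if "e \<in> E3 \<union> E4" "x \<in> convex hull (pos ` e)" for e x
    using that(1) tR[OF subsetD[OF hl(3) that(2)]] tR[OF subsetD[OF hl(4) that(2)]] by (elim UnE)
  have vL: "fst (pos v) \<le> 1" if "v \<in> V1 \<union> V2" for v
    using that tL[OF subsetD[OF ps(1) imageI]] tL[OF subsetD[OF ps(2) imageI]] by (elim UnE)
  have vR: "3 \<le> fst (pos v)" if "v \<in> V3 \<union> V4" for v
    using that tR[OF subsetD[OF ps(3) imageI]] tR[OF subsetD[OF ps(4) imageI]] by (elim UnE)
  have base: "straight verts (E1 \<union> E2 \<union> (E3 \<union> E4)) pos"
    unfolding verts_def
  proof (rule straight_Un[OF sL sR])
    show "inj_on pos (V1 \<union> V2 \<union> (V3 \<union> V4))"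
    proof (rule inj_onI)
      fix v w assume vw: "v \<in> V1 \<union> V2 \<union> (V3 \<union> V4)" "w \<in> V1 \<union> V2 \<union> (V3 \<union> V4)" "pos v = pos w"
      then consider "v \<in> V1 \<union> V2" "w \<in> V1 \<union> V2" | "v \<in> V3 \<union> V4" "w \<in> V3 \<union> V4"
        | "v \<in> V1 \<union> V2" "w \<in> V3 \<union> V4" | "v \<in> V3 \<union> V4" "w \<in> V1 \<union> V2" by blast
      then show "v = w"
      proof cases
        case 1 then show ?thesis by (rule inj_onD[OF straightD(1)[OF sL] vw(3)])
      next
        case 2 then show ?thesis by (rule inj_onD[OF straightD(1)[OF sR] vw(3)])
      next
        case 3 then show ?thesis using vL[OF 3(1)] vR[OF 3(2)] vw(3) by simp
      next
        case 4 then show ?thesis using vR[OF 4(1)] vL[OF 4(2)] vw(3) by simp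
      qed
    qed
    fix e e' x assume "e \<in> E1 \<union> E2" "e' \<in> E3 \<union> E4" "x \<in> convex hull (pos ` e)" "x \<in> convex hull (pos ` e')"
    then have False using eL[of e x] eR[of e' x] by simp
    then show "x \<in> pos ` (e \<inter> e')" ..
  qed
  have corners: "pos a1 = (1, 2)" "pos b1 = (1, 1)" "pos a2 = (1, -2)" "pos b2 = (1, -1)"
    "pos a3 = (3, 2)" "pos b3 = (3, 1)" "pos a4 = (3, -2)" "pos b4 = (3, -1)"
    using pos1 pos2 pos3 pos4 L.F.terminals L.G.terminals R.F.terminals R.G.terminals D
    by (simp_all add: aff_def)
  have seg: "1 \<le> fst x \<and> fst x \<le> 3 \<and> snd x = y" if "x \<in> convex hull {(1, y), (3, y)}" for x :: "real \<times> real" and y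
  proof -
    have "x \<in> closed_segment (1, y) (3, y)" using that by (simp add: segment_convex_hull)
    then obtain u where "0 \<le> u" "u \<le> 1" "x = (1 - u) *\<^sub>R (1, y) + u *\<^sub>R (3, y)"
      unfolding in_segment by blast
    then show ?thesis by (simp add: algebra_simps)
  qed
  have linkE: "\<exists>u w y. l = {u, w} \<and> pos u = (1, y) \<and> pos w = (3, y) \<and> u \<in> verts \<and> w \<in> verts \<and>
     (y = 2 \<and> l = {a1, a3} \<or> y = 1 \<and> l = {b1, b3} \<or> y = -2 \<and> l = {a2, a4} \<or> y = -1 \<and> l = {b2, b4})"
    if "l \<in> links" for l
  proof -
    have v: "a1 \<in> verts" "b1 \<in> verts" "a2 \<in> verts" "b2 \<in> verts" "a3 \<in> verts" "b3 \<in> verts" "a4 \<in> verts" "b4 \<in> verts"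
      unfolding verts_def using L_terminals R_terminals by (metis UnI1 UnI2)+
    from that consider "l = {a1, a3}" | "l = {b1, b3}" | "l = {a2, a4}" | "l = {b2, b4}"
      unfolding links_def by (elim insertE emptyE)
    then show ?thesis
    proof cases
      case 1 then show ?thesis using corners v by (intro exI[of _ a1] exI[of _ a3] exI[of _ 2]) simp
    next
      case 2 then show ?thesis using corners v by (intro exI[of _ b1] exI[of _ b3] exI[of _ 1]) simp
    next
      case 3 then show ?thesis using corners v by (intro exI[of _ a2] exI[of _ a4] exI[of _ "-2"]) simp
    next
      case 4 then show ?thesis using corners v by (intro exI[of _ b2] exI[of _ b4] exI[of _ "-1"]) simp
    qed
  qed
  have "straight verts (E1 \<union> E2 \<union> (E3 \<union> E4) \<union> links) pos"
  proof (rule straight_add_edges[OF base])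
    show "l \<subseteq> verts" if "l \<in> links" for l using linkE[OF that] by (elim exE conjE) simp
    show "x \<in> pos ` l" if l: "l \<in> links" and e: "e \<in> E1 \<union> E2 \<union> (E3 \<union> E4)"
      and x: "x \<in> convex hull (pos ` l)" "x \<in> convex hull (pos ` e)" for l e x
    proof -
      obtain u w y where u: "l = {u, w}" "pos u = (1, y)" "pos w = (3, y)"
        using linkE[OF l] by (elim exE conjE)
      then have s: "1 \<le> fst x" "fst x \<le> 3" "snd x = y" using seg[of x y] x(1) by auto
      \<comment> \<open>A link can meet a fragment only on the boundary of the strip, that is, at an
        end of the link.\<close>
      from e have "fst x = 1 \<or> fst x = 3"
      proof
        assume "e \<in> E1 \<union> E2"
        from eL[OF this x(2)] s(1) show ?thesis by simp
      next
        assume "e \<in> E3 \<union> E4"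
        from eR[OF this x(2)] s(2) show ?thesis by simp
      qed
      then have "x = pos u \<or> x = pos w" using s u(2,3) by (auto simp: prod_eq_iff)
      then show ?thesis using u(1) by auto
    qed
    show "convex hull (pos ` l) \<inter> convex hull (pos ` l') = {}" if l: "l \<in> links" "l' \<in> links" "l \<noteq> l'" for l l'
    proof (rule ccontr)
      assume "convex hull (pos ` l) \<inter> convex hull (pos ` l') \<noteq> {}"
      then obtain x where x: "x \<in> convex hull (pos ` l)" "x \<in> convex hull (pos ` l')" by blast
      obtain u w y where u: "l = {u, w}" "pos u = (1, y)" "pos w = (3, y)"
        "y = 2 \<and> l = {a1, a3} \<or> y = 1 \<and> l = {b1, b3} \<or> y = -2 \<and> l = {a2, a4} \<or> y = -1 \<and> l = {b2, b4}"
        using linkE[OF l(1)] by (elim exE conjE)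
      obtain u' w' y' where u': "l' = {u', w'}" "pos u' = (1, y')" "pos w' = (3, y')"
        "y' = 2 \<and> l' = {a1, a3} \<or> y' = 1 \<and> l' = {b1, b3} \<or> y' = -2 \<and> l' = {a2, a4} \<or> y' = -1 \<and> l' = {b2, b4}"
        using linkE[OF l(2)] by (elim exE conjE)
      have "snd x = y" "snd x = y'" using seg[of x y] seg[of x y'] x u(1-3) u'(1-3) by auto
      then have "y = y'" by simp
      with u(4) u'(4) have "l = l'" by (elim disjE conjE) simp_all
      then show False using l(3) by simp
    qed
  qed
  from straight_planar[OF finite_simple_graph[unfolded edges_def] this] show ?thesis
    unfolding edges_def .
qed

section \<open>Drawing a ladder inside a parallelogram\<close>

text \<open>The 4-cycle bounds a nondegenerate parallelogram with \<open>A\<close> along the rails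
  and \<open>B\<close> along the rungs. Its closed region, and not only its boundary, is kept free
  of the other edges except at the corners, which makes room for the new vertices.\<close>

definition ladder_drawn :: "'a set \<Rightarrow> 'a set set \<Rightarrow> 'a \<Rightarrow> 'a \<Rightarrow> 'a \<Rightarrow> 'a \<Rightarrow> 'a \<Rightarrow> 'a \<Rightarrow> 'a \<Rightarrow>
    ('a \<Rightarrow> real \<times> real) \<Rightarrow> real \<times> real \<Rightarrow> real \<times> real \<Rightarrow> bool" where
  "ladder_drawn V E a b c t1 t2 b1 b2 pos A B \<longleftrightarrow> drawn V E a b c pos \<and>
     pos t2 = pos t1 + A \<and> pos b1 = pos t1 + B \<and> pos b2 = pos t1 + A + B \<and>
     (\<forall>s u. s *\<^sub>R A + u *\<^sub>R B = 0 \<longrightarrow> s = 0 \<and> u = 0) \<and>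
     (\<forall>e \<in> E - {{t1, t2}, {b1, b2}, {t1, b1}, {t2, b2}}. \<forall>s u. 0 \<le> s \<longrightarrow> s \<le> 1 \<longrightarrow> 0 \<le> u \<longrightarrow> u \<le> 1 \<longrightarrow>
        pos t1 + s *\<^sub>R A + u *\<^sub>R B \<in> convex hull (pos ` e) \<longrightarrow>
        pos t1 + s *\<^sub>R A + u *\<^sub>R B \<in> pos ` (e \<inter> {t1, t2, b1, b2}))"

lemma hull_pair:
  assumes "x \<in> convex hull {p, q}"
  obtains u where "0 \<le> u" "u \<le> 1" "x = (1 - u) *\<^sub>R p + u *\<^sub>R q"
  using assms unfolding segment_convex_hull[symmetric] in_segment by (elim exE conjE)

lemma Diff_insert_back:
  assumes "r \<in> X" "s \<in> X" "r \<noteq> p" "r \<noteq> q" "s \<noteq> p" "s \<noteq> q"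
  shows "X - {p, q} = (X - {p, q, r, s}) \<union> {r, s}"
  using assms by blast

context ladder_extension
begin

text \<open>Column \<open>i\<close> and rail \<open>k\<close> of the ladder: columns 0 and 3 hold
  the old corners, 1 and 2 the new vertices, and \<open>k = 0\<close> is the top rail. The uniform
  indexing avoids comparing ten ladder edges pairwise by hand.\<close>

definition node :: "nat \<Rightarrow> nat \<Rightarrow> 'a" where
  "node i k = (if k = 0 then (if i = 0 then t1 else if i = 1 then x1 else if i = 2 then x2 else t2)
     else (if i = 0 then b1 else if i = 1 then y1 else if i = 2 then y2 else b2))"

definition rail :: "nat \<Rightarrow> nat \<Rightarrow> 'a set" where "rail i k = {node i k, node (Suc i) k}"
definition rung :: "nat \<Rightarrow> 'a set" where "rung i = {node i 0, node i 1}"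

abbreviation "quad_set \<equiv> {{t1, t2}, {b1, b2}, {t1, b1}, {t2, b2}}"

definition ladder_edges :: "'a set set" where
  "ladder_edges = {rail 0 0, rail 1 0, rail 2 0, rail 0 1, rail 1 1, rail 2 1, rung 0, rung 1, rung 2, rung 3}"

text \<open>The old rungs, which \<open>E'\<close> keeps from \<open>E\<close>, are counted as
  ladder edges here, so that the remaining old edges meet the parallelogram at corners only.\<close>

lemma E'_split: "E' = (E - quad_set) \<union> ladder_edges"
proof -
  have 1: "rail 0 0 = {t1, x1}" "rail 1 0 = {x1, x2}" "rail 2 0 = {x2, t2}" "rail 0 1 = {b1, y1}"
    "rail 1 1 = {y1, y2}" "rail 2 1 = {y2, b2}" "rung 0 = {t1, b1}" "rung 1 = {x1, y1}" "rung 2 = {x2, y2}"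
    "rung 3 = {t2, b2}"
    unfolding rail_def rung_def node_def by simp_all
  have d: "{t1, b1} \<noteq> {t1, t2}" "{t1, b1} \<noteq> {b1, b2}" "{t2, b2} \<noteq> {t1, t2}" "{t2, b2} \<noteq> {b1, b2}"
    using quad_distinct by (auto simp: doubleton_eq_iff)
  have "E - {{t1, t2}, {b1, b2}} = (E - quad_set) \<union> {{t1, b1}, {t2, b2}}"
    by (rule Diff_insert_back[OF quad_edges(3,4) d])
  then show ?thesis unfolding E'_def ladder_edges_def 1
    by (simp only: Un_assoc Un_insert_left Un_empty_left insert_commute)
qed

lemma ladder_edge_cases:
  assumes "l \<in> ladder_edges"
  obtains i k where "i < 3" "k < 2" "l = rail i k" | i where "i < 4" "l = rung i"
  using assms that(1)[of 0 0] that(1)[of 1 0] that(1)[of 2 0] that(1)[of 0 1] that(1)[of 1 1] that(1)[of 2 1]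
    that(2)[of 0] that(2)[of 1] that(2)[of 2] that(2)[of 3]
  unfolding ladder_edges_def by (elim insertE emptyE) simp_all

text \<open>The new vertices cut the rails into thirds. In the coordinates
  \<open>\<Psi> s u\<close>, with \<open>s\<close> from 0 to 3 along the rails and \<open>u\<close>
  from 0 to 1 across, \<open>node i k\<close> has the coordinates \<open>i\<close> and
  \<open>k\<close>, and the middle cell is a parallelogram again, with sides \<open>A / 3\<close>
  and \<open>B\<close>.\<close>

lemma ladder_drawn_extended:
  assumes "ladder_drawn V E a b c t1 t2 b1 b2 pos A B"
  shows "\<exists>pos' A' B'. ladder_drawn (V \<union> W) E' a b c x1 x2 y1 y2 pos' A' B'"
proof -
  define \<Psi> where "\<Psi> s u = pos t1 + (s / 3) *\<^sub>R A + u *\<^sub>R B" for s u :: real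
  define pos' where "pos' = pos(x1 := \<Psi> 1 0, x2 := \<Psi> 2 0, y1 := \<Psi> 1 1, y2 := \<Psi> 2 1)"
  have D: "straight V E pos" "pos ` V \<subseteq> sector" "pos a = (1, 2)" "pos b = (1, 1)" "pos c = (0, 0)"
    and q: "pos t2 = pos t1 + A" "pos b1 = pos t1 + B" "pos b2 = pos t1 + A + B"
    and indep: "\<And>s u. s *\<^sub>R A + u *\<^sub>R B = 0 \<Longrightarrow> s = 0 \<and> u = 0"
    using assms unfolding ladder_drawn_def drawn_def by simp_all
  have away: "\<Psi> s u \<in> pos ` (e \<inter> {t1, t2, b1, b2})"
    if h: "e \<in> E - quad_set" "0 \<le> s" "s \<le> 3" "0 \<le> u" "u \<le> 1" "\<Psi> s u \<in> convex hull (pos ` e)" for e s u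
  proof -
    have "\<forall>s u. 0 \<le> s \<longrightarrow> s \<le> 1 \<longrightarrow> 0 \<le> u \<longrightarrow> u \<le> 1 \<longrightarrow> pos t1 + s *\<^sub>R A + u *\<^sub>R B \<in> convex hull (pos ` e) \<longrightarrow>
        pos t1 + s *\<^sub>R A + u *\<^sub>R B \<in> pos ` (e \<inter> {t1, t2, b1, b2})"
      using assms h(1) unfolding ladder_drawn_def by (elim conjE) (erule bspec)
    from this[rule_format, of "s / 3" u] show ?thesis using h(2-6) unfolding \<Psi>_def by simp
  qed
  have inj: "s = s' \<and> u = u'" if h: "\<Psi> s u = \<Psi> s' u'" for s u s' u'
  proof -
    have "((s - s') / 3) *\<^sub>R A + (u - u') *\<^sub>R B = 0"
      using h unfolding \<Psi>_def by (simp add: algebra_simps diff_divide_distrib)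
    from indep[OF this] show ?thesis by simp
  qed
  have old: "pos' v = pos v" if h: "v \<in> V" for v
    using old_new[OF h] unfolding pos'_def by simp
  have node: "pos' (node i k) = \<Psi> (real i) (real k)" if h: "i < 4" "k < 2" for i k
  proof -
    have "i = 0 \<or> i = 1 \<or> i = 2 \<or> i = 3" "k = 0 \<or> k = 1" using h by auto
    then show ?thesis
      using old[OF quad_verts(1)] old[OF quad_verts(2)] old[OF quad_verts(3)] old[OF quad_verts(4)] q new_distinct
      unfolding node_def by (elim disjE) (simp_all add: pos'_def \<Psi>_def)
  qed
  have hull_node: "\<exists>s u. x = \<Psi> s u \<and> real i \<le> s \<and> s \<le> real i' \<and> real k \<le> u \<and> u \<le> real k'"
    if h: "x \<in> convex hull (pos' ` {node i k, node i' k'})" "i \<le> i'" "k \<le> k'" "i' < 4" "k' < 2" for x i i' k k'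
  proof -
    have "x \<in> convex hull {\<Psi> i k, \<Psi> i' k'}" using h node[of i k] node[of i' k'] by simp
    then obtain w where w: "0 \<le> w" "w \<le> 1" "x = (1 - w) *\<^sub>R \<Psi> i k + w *\<^sub>R \<Psi> i' k'" by (rule hull_pair)
    have "x = \<Psi> (real i + w * (real i' - real i)) (real k + w * (real k' - real k))"
      unfolding w(3) \<Psi>_def by (simp add: algebra_simps diff_divide_distrib add_divide_distrib)
    moreover have "w * (real i' - real i) \<le> 1 * (real i' - real i)" "w * (real k' - real k) \<le> 1 * (real k' - real k)"
      using w h(2,3) by (intro mult_right_mono; simp)+
    moreover have "0 \<le> w * (real i' - real i)" "0 \<le> w * (real k' - real k)" using w h(2,3) by simp_all
    ultimately show ?thesis by (intro exI conjI) auto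
  qed
  have rail_hull: "\<exists>s. x = \<Psi> s (real k) \<and> real i \<le> s \<and> s \<le> real i + 1"
    if h: "x \<in> convex hull (pos' ` rail i k)" "i < 3" "k < 2" for x i k
  proof -
    obtain s u where "x = \<Psi> s u \<and> real i \<le> s \<and> s \<le> real (Suc i) \<and> real k \<le> u \<and> u \<le> real k"
      using hull_node[of x i k "Suc i" k] h unfolding rail_def by auto
    then show ?thesis by (intro exI[of _ s]) auto
  qed
  have rung_hull: "\<exists>u. x = \<Psi> (real i) u \<and> 0 \<le> u \<and> u \<le> 1"
    if h: "x \<in> convex hull (pos' ` rung i)" "i < 4" for x i
  proof -
    obtain s u where "x = \<Psi> s u \<and> real i \<le> s \<and> s \<le> real i \<and> real 0 \<le> u \<and> u \<le> real 1"
      using hull_node[of x i 0 i 1] h unfolding rung_def by auto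
    then show ?thesis by (intro exI[of _ u]) auto
  qed
  have at_node: "node i k \<in> l" if h: "l \<in> ladder_edges" "\<Psi> (real i) (real k) \<in> convex hull (pos' ` l)" "i < 4" "k < 2" for l i k
    using h(1)
  proof (cases rule: ladder_edge_cases)
    case (1 j m)
    then obtain s where s: "\<Psi> (real i) (real k) = \<Psi> s (real m)" "real j \<le> s" "s \<le> real j + 1"
      using rail_hull[of "\<Psi> (real i) (real k)" j m] h(2) by auto
    from inj[OF s(1)] s(2,3) have "k = m" "i = j \<or> i = Suc j" by auto
    then show ?thesis unfolding 1(3) rail_def by auto
  next
    case (2 j)
    then obtain u where "\<Psi> (real i) (real k) = \<Psi> (real j) u"
      using rung_hull[of "\<Psi> (real i) (real k)" j] h(2) by auto
    from inj[OF this] have "i = j" by simp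
    moreover have "k = 0 \<or> k = 1" using h(4) by auto
    ultimately show ?thesis unfolding 2(2) rung_def by auto
  qed
  have quad_node: "\<exists>i k. z = node i k \<and> (i = 0 \<or> i = 3) \<and> k < 2" if h: "z \<in> {t1, t2, b1, b2}" for z
  proof -
    have "t1 = node 0 0" "t2 = node 3 0" "b1 = node 0 1" "b2 = node 3 1" by (simp_all add: node_def)
    moreover have "(0::nat) < 2" "(1::nat) < 2" by simp_all
    ultimately show ?thesis using h by (elim insertE emptyE) metis+
  qed
  have param: "\<exists>s u. x = \<Psi> s u \<and> 0 \<le> s \<and> s \<le> 3 \<and> 0 \<le> u \<and> u \<le> 1"
    if h: "l \<in> ladder_edges" "x \<in> convex hull (pos' ` l)" for l x
    using h(1)
  proof (cases rule: ladder_edge_cases)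
    case (1 i k)
    then obtain s where "x = \<Psi> s (real k)" "real i \<le> s" "s \<le> real i + 1" using rail_hull[of x i k] h(2) by auto
    then show ?thesis using 1 by (intro exI[of _ s] exI[of _ "real k"]) auto
  next
    case (2 i)
    then obtain u where "x = \<Psi> (real i) u" "0 \<le> u" "u \<le> 1" using rung_hull[of x i] h(2) by auto
    then show ?thesis using 2 by (intro exI[of _ "real i"] exI[of _ u]) auto
  qed
  have old_image: "pos' ` e = pos ` e" if h: "e \<subseteq> V" for e
    by (rule image_cong) (use h old in auto)
  \<comment> \<open>Old edges outside the 4-cycle touch the ladder region only at corners, hence
    only in the columns 0 and 3.\<close>
  have old_away: "\<exists>i k. x = \<Psi> (real i) (real k) \<and> node i k \<in> e \<and> (i = 0 \<or> i = 3) \<and> k < 2 \<and> s = real i"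
    if e: "e \<in> E - quad_set" and x: "x \<in> convex hull (pos' ` e)" and s: "x = \<Psi> s u" "0 \<le> s" "s \<le> 3" "0 \<le> u" "u \<le> 1" for e x s u
  proof -
    have eV: "e \<subseteq> V" using straightD(2)[OF D(1)] e by simp
    have "x \<in> pos ` (e \<inter> {t1, t2, b1, b2})"
      using away[OF e s(2-5)] x s(1) old_image[OF eV] by simp
    then obtain z where z: "z \<in> e" "z \<in> {t1, t2, b1, b2}" "x = pos z" by auto
    obtain i k where ik: "z = node i k" "i = 0 \<or> i = 3" "k < 2" using quad_node[OF z(2)] by (elim exE conjE)
    have "x = \<Psi> (real i) (real k)"
      using node[of i k] ik z(1,3) old[of z] eV by auto
    moreover from this have "s = real i" using inj[of s u "real i" "real k"] s(1) by simp
    ultimately show ?thesis using ik z(1) by (intro exI[of _ i] exI[of _ k]) simp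
  qed
  have nodeV: "node i k \<in> V \<union> W" for i k using quad_verts unfolding node_def by simp
  have W_node: "\<exists>i k. w = node i k \<and> (i = 1 \<or> i = 2) \<and> k < 2" if h: "w \<in> W" for w
  proof -
    have "x1 = node 1 0" "x2 = node 2 0" "y1 = node 1 1" "y2 = node 2 1" by (simp_all add: node_def)
    moreover have "(0::nat) < 2" "(1::nat) < 2" by simp_all
    ultimately show ?thesis using h by (elim insertE emptyE) metis+
  qed
  \<comment> \<open>Some edge contains \<open>v\<close>. If it belongs to the 4-cycle,
    \<open>v\<close> is a corner; otherwise \<open>old_away\<close> applies to it. Either way the
    common point would lie in column 0 or 3, whereas \<open>w\<close> lies in column 1 or 2.\<close>
  have new_old: "pos' v \<noteq> pos' w" if h: "v \<in> V" "w \<in> W" for v w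
  proof
    assume eq: "pos' v = pos' w"
    obtain i k where ik: "w = node i k" "i = 1 \<or> i = 2" "k < 2" using W_node[OF h(2)] by (elim exE conjE)
    then have x: "pos' v = \<Psi> (real i) (real k)" using eq node[of i k] by auto
    obtain e where e: "e \<in> E" "v \<in> e" using straightD(3)[OF D(1) h(1)] by (elim bexE)
    show False
    proof (cases "e \<in> quad_set")
      case True
      then have vq: "v \<in> {t1, t2, b1, b2}" using e(2) by auto
      obtain j m where jm: "v = node j m" "j = 0 \<or> j = 3" "m < 2" using quad_node[OF vq] by (elim exE conjE)
      then have "\<Psi> (real j) (real m) = \<Psi> (real i) (real k)" using x node[of j m] by auto
      from inj[OF this] jm(2) ik(2) show False by auto
    next
      case False
      have hull: "pos' v \<in> convex hull (pos' ` e)" using e(2) by (simp add: hull_inc)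
      have bounds: "0 \<le> real i" "real i \<le> 3" "0 \<le> real k" "real k \<le> 1" using ik(2,3) by auto
      obtain j :: nat where "j = 0 \<or> j = 3" "real i = real j"
        using old_away[OF DiffI[OF e(1) False] hull x bounds] by (elim exE conjE)
      then show False using ik(2) by auto
    qed
  qed
  have inj': "inj_on pos' (V \<union> W)"
  proof (rule inj_onI)
    fix v w assume vw: "v \<in> V \<union> W" "w \<in> V \<union> W" "pos' v = pos' w"
    then consider "v \<in> V" "w \<in> V" | "v \<in> V" "w \<in> W" | "v \<in> W" "w \<in> V" | "v \<in> W" "w \<in> W" by blast
    then show "v = w"
    proof cases
      case 1
      then show ?thesis using inj_onD[OF straightD(1)[OF D(1)], of v w] vw(3) old by simp
    next
      case 2
      then show ?thesis using new_old[OF 2] vw(3) by simp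
    next
      case 3
      then show ?thesis using new_old[OF 3(2,1)] vw(3) by simp
    next
      case 4
      obtain i k where ik: "v = node i k" "i = 1 \<or> i = 2" "k < 2" using W_node[OF 4(1)] by (elim exE conjE)
      obtain j m where jm: "w = node j m" "j = 1 \<or> j = 2" "m < 2" using W_node[OF 4(2)] by (elim exE conjE)
      have "\<Psi> (real i) (real k) = \<Psi> (real j) (real m)" using vw(3) node[of i k] node[of j m] ik jm by auto
      from inj[OF this] show ?thesis using ik jm by simp
    qed
  qed
  have disj: "x \<in> pos' ` (e \<inter> e')"
    if e: "e \<in> E'" "e' \<in> E'" "e \<noteq> e'" and x: "x \<in> convex hull (pos' ` e)" "x \<in> convex hull (pos' ` e')" for e e' x
  proof -
    have mixed: "x \<in> pos' ` (d \<inter> l)"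
      if h: "d \<in> E - quad_set" "l \<in> ladder_edges" "x \<in> convex hull (pos' ` d)" "x \<in> convex hull (pos' ` l)" for d l
    proof -
      obtain s u where su: "x = \<Psi> s u" "0 \<le> s" "s \<le> 3" "0 \<le> u" "u \<le> 1" using param[OF h(2,4)] by (elim exE conjE)
      obtain i k where ik: "x = \<Psi> (real i) (real k)" "node i k \<in> d" "i = 0 \<or> i = 3" "k < 2"
        using old_away[OF h(1,3) su] by (elim exE conjE)
      then have "node i k \<in> l" using at_node[OF h(2), of i k] h(4) by auto
      moreover have "x = pos' (node i k)" using ik node[of i k] by auto
      ultimately show ?thesis using ik(2) by simp
    qed
    consider "e \<in> E - quad_set" "e' \<in> E - quad_set" | "e \<in> E - quad_set" "e' \<in> ladder_edges"
      | "e \<in> ladder_edges" "e' \<in> E - quad_set" | "e \<in> ladder_edges" "e' \<in> ladder_edges"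
      using e(1,2) unfolding E'_split by (elim UnE)
    then show ?thesis
    proof cases
      case 1
      then have "e \<in> E" "e' \<in> E" by simp_all
      note V = straightD(2)[OF D(1) this(1)] straightD(2)[OF D(1) this(2)]
      have "e \<inter> e' \<subseteq> V" using V(1) by auto
      show ?thesis
        using straightD(4)[OF D(1) \<open>e \<in> E\<close> \<open>e' \<in> E\<close> e(3)] x
        unfolding old_image[OF V(1)] old_image[OF V(2)] old_image[OF \<open>e \<inter> e' \<subseteq> V\<close>] by simp
    next
      case 2
      then show ?thesis using mixed[OF 2 x] by simp
    next
      case 3
      then show ?thesis using mixed[OF 3(2,1) x(2,1)] by (simp add: Int_commute)
    next
      case 4
      \<comment> \<open>Two different ladder edges can meet only at a grid point, which
        \<open>at_node\<close> then makes a common end.\<close>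
      have "\<exists>i k. i < 4 \<and> k < 2 \<and> x = \<Psi> (real i) (real k)"
        using 4(1)
      proof (cases rule: ladder_edge_cases)
        case ik: (1 i k)
        obtain s where s: "x = \<Psi> s (real k)" "real i \<le> s" "s \<le> real i + 1"
          using rail_hull[of x i k] x(1) ik by auto
        show ?thesis using 4(2)
        proof (cases rule: ladder_edge_cases)
          case jm: (1 j m)
          obtain s' where s': "x = \<Psi> s' (real m)" "real j \<le> s'" "s' \<le> real j + 1"
            using rail_hull[of x j m] x(2) jm by auto
          have eq: "s = s' \<and> real k = real m" using inj[of s "real k" s' "real m"] s(1) s'(1) by simp
          have "i \<noteq> j" using eq ik(3) jm(3) e(3) by auto
          \<comment> \<open>Two pieces of the same rail meet at most in the column where the later
            one starts.\<close>
          then have "s = real (max i j)"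
            using eq s(2,3) s'(2,3) by (cases "i < j") auto
          then show ?thesis using s(1) ik(1,2) jm(1) by (intro exI[of _ "max i j"] exI[of _ k]) auto
        next
          case j: (2 j)
          obtain u where u: "x = \<Psi> (real j) u" using rung_hull[of x j] x(2) j by auto
          have "s = real j" using inj[of s "real k" "real j" u] s(1) u by simp
          then show ?thesis using s(1) ik(2) j(1) by (intro exI[of _ j] exI[of _ k]) simp
        qed
      next
        case i: (2 i)
        obtain u where u: "x = \<Psi> (real i) u" using rung_hull[of x i] x(1) i by auto
        show ?thesis using 4(2)
        proof (cases rule: ladder_edge_cases)
          case jm: (1 j m)
          obtain s' where s': "x = \<Psi> s' (real m)" using rail_hull[of x j m] x(2) jm by auto
          have "u = real m" using inj[of "real i" u s' "real m"] s'(1) u by simp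
          then show ?thesis using u jm(2) i(1) by (intro exI[of _ i] exI[of _ m]) simp
        next
          case j: (2 j)
          obtain u' where u': "x = \<Psi> (real j) u'" using rung_hull[of x j] x(2) j by auto
          have "real i = real j" using inj[of "real i" u "real j" u'] u u' by simp
          then show ?thesis using i(2) j(2) e(3) by simp
        qed
      qed
      then obtain i k where ik: "i < 4" "k < 2" "x = \<Psi> (real i) (real k)" by (elim exE conjE)
      then have "node i k \<in> e" "node i k \<in> e'"
        using at_node[OF 4(1), of i k] at_node[OF 4(2), of i k] x by auto
      moreover have "x = pos' (node i k)" using ik node[of i k] by simp
      ultimately show ?thesis by simp
    qed
  qed
  have straight': "straight (V \<union> W) E' pos'"
    unfolding straight_def
  proof (intro conjI ballI impI)
    show "inj_on pos' (V \<union> W)" by (rule inj')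
    show "e \<subseteq> V \<union> W" if h: "e \<in> E'" for e
      using h unfolding E'_split
    proof
      assume "e \<in> E - quad_set"
      then show ?thesis using straightD(2)[OF D(1), of e] by auto
    next
      assume "e \<in> ladder_edges"
      then show ?thesis
        by (cases rule: ladder_edge_cases) (use nodeV in \<open>auto simp: rail_def rung_def\<close>)
    qed
    show "\<exists>e\<in>E'. v \<in> e" if v: "v \<in> V \<union> W" for v
    proof -
      consider "v \<in> {t1, b1}" | "v \<in> {t2, b2}" | "v \<in> {x1, y1}" | "v \<in> {x2, y2}" | "v \<in> V" "v \<notin> {t1, t2, b1, b2}"
        using v by blast
      then show ?thesis
      proof cases
        case 5
        obtain e where e: "e \<in> E" "v \<in> e" using straightD(3)[OF D(1) 5(1)] by (elim bexE)
        have "e \<notin> quad_set" using e(2) 5(2) by auto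
        then show ?thesis using e unfolding E'_split by (intro bexI[of _ e]) simp_all
      qed (use rungs new_edges in blast)+
    qed
    show "convex hull (pos' ` e) \<inter> convex hull (pos' ` e') \<subseteq> pos' ` (e \<inter> e')"
      if h: "e \<in> E'" "e' \<in> E'" "e \<noteq> e'" for e e'
      using disj[OF h] by blast
  qed
  have sector': "pos' ` (V \<union> W) \<subseteq> sector"
  proof -
    have t: "pos t1 \<in> sector" "pos t2 \<in> sector" "pos b1 \<in> sector" "pos b2 \<in> sector"
      using D(2) quad_verts by auto
    have c: "(1 - u) *\<^sub>R p + u *\<^sub>R r \<in> sector" if h: "p \<in> sector" "r \<in> sector" "0 \<le> u" "u \<le> 1" for p r u
      using convexD_alt[OF convex_sector h(1,2)] h(3,4) by simp
    have "\<Psi> 1 0 = (1 - 1/3) *\<^sub>R pos t1 + (1/3) *\<^sub>R pos t2" "\<Psi> 2 0 = (1 - 2/3) *\<^sub>R pos t1 + (2/3) *\<^sub>R pos t2"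
      "\<Psi> 1 1 = (1 - 1/3) *\<^sub>R pos b1 + (1/3) *\<^sub>R pos b2" "\<Psi> 2 1 = (1 - 2/3) *\<^sub>R pos b1 + (2/3) *\<^sub>R pos b2"
      unfolding \<Psi>_def q by (simp_all add: prod_eq_iff field_simps)
    then have "\<Psi> 1 0 \<in> sector" "\<Psi> 2 0 \<in> sector" "\<Psi> 1 1 \<in> sector" "\<Psi> 2 1 \<in> sector"
      using c[OF t(1,2), of "1/3"] c[OF t(1,2), of "2/3"] c[OF t(3,4), of "1/3"] c[OF t(3,4), of "2/3"] by simp_all
    then have "pos' w \<in> sector" if h: "w \<in> W" for w
      using h new_distinct unfolding pos'_def by (elim insertE emptyE) simp_all
    moreover have "pos' v \<in> sector" if h: "v \<in> V" for v using D(2) h old[OF h] by auto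
    ultimately show ?thesis by auto
  qed
  have new_pos: "pos' x1 = \<Psi> 1 0" "pos' x2 = \<Psi> 2 0" "pos' y1 = \<Psi> 1 1" "pos' y2 = \<Psi> 2 1"
    unfolding pos'_def using new_distinct by auto
  \<comment> \<open>For \<open>s\<close> between 1 and 2 old edges are out of reach, the outer rail
    pieces touch only columns 1 and 2, and the outer rungs lie in columns 0 and 3.\<close>
  have away': "\<Psi> s u \<in> pos' ` (e \<inter> W)"
    if e: "e \<in> E' - {{x1, x2}, {y1, y2}, {x1, y1}, {x2, y2}}" and su: "1 \<le> s" "s \<le> 2" "0 \<le> u" "u \<le> 1"
      and x: "\<Psi> s u \<in> convex hull (pos' ` e)" for e s u
  proof -
    have "e \<in> E - quad_set \<or> e \<in> ladder_edges" using e unfolding E'_split by simp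
    then show ?thesis
    proof
      assume old_e: "e \<in> E - quad_set"
      have bounds: "0 \<le> s" "s \<le> 3" using su by simp_all
      obtain i :: nat where "i = 0 \<or> i = 3" "s = real i"
        using old_away[OF old_e x refl bounds su(3,4)] by (elim exE conjE)
      then show ?thesis using su by auto
    next
      assume "e \<in> ladder_edges"
      then show ?thesis
      proof (cases rule: ladder_edge_cases)
        case (1 i k)
        obtain s' where s': "\<Psi> s u = \<Psi> s' (real k)" "real i \<le> s'" "s' \<le> real i + 1"
          using rail_hull[of "\<Psi> s u" i k] x 1 by auto
        have k: "k = 0 \<or> k = 1" using 1(2) by auto
        have "i \<noteq> 1"
        proof
          assume "i = 1"
          with k 1(3) have "e = {x1, x2} \<or> e = {y1, y2}"
            by (elim disjE) (simp_all add: rail_def node_def)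
          with e show False by (elim disjE) simp_all
        qed
        then have "i = 0 \<or> i = 2" using 1(1) by auto
        moreover have "s = s'" "u = real k" using inj[OF s'(1)] by simp_all
        ultimately have "i = 0 \<and> s = 1 \<or> i = 2 \<and> s = 2" using s' su by auto
        then show ?thesis
        proof
          assume *: "i = 0 \<and> s = 1"
          have "node 1 k \<in> e \<inter> W" using k * 1(3) by (elim disjE) (simp_all add: rail_def node_def)
          moreover have "\<Psi> s u = pos' (node 1 k)" using node[of 1 k] 1(2) * \<open>u = real k\<close> by simp
          ultimately show ?thesis by blast
        next
          assume *: "i = 2 \<and> s = 2"
          have "node 2 k \<in> e \<inter> W" using k * 1(3) by (elim disjE) (simp_all add: rail_def node_def)
          moreover have "\<Psi> s u = pos' (node 2 k)" using node[of 2 k] 1(2) * \<open>u = real k\<close> by simp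
          ultimately show ?thesis by blast
        qed
      next
        case (2 i)
        obtain u' where "\<Psi> s u = \<Psi> (real i) u'" using rung_hull[of "\<Psi> s u" i] x 2 by auto
        from inj[OF this] have "s = real i" by simp
        then have "i = 1 \<or> i = 2" using su by auto
        with 2(2) have "e = {x1, y1} \<or> e = {x2, y2}"
          by (elim disjE) (simp_all add: rung_def node_def)
        with e show ?thesis by (elim disjE) simp_all
      qed
    qed
  qed
  have "ladder_drawn (V \<union> W) E' a b c x1 x2 y1 y2 pos' ((1/3) *\<^sub>R A) B"
    unfolding ladder_drawn_def drawn_def
  proof (intro conjI allI impI ballI straight' sector')
    show "pos' a = (1, 2)" "pos' b = (1, 1)" "pos' c = (0, 0)"
      using old terminals D by simp_all
    show "pos' x2 = pos' x1 + (1/3) *\<^sub>R A" "pos' y1 = pos' x1 + B" "pos' y2 = pos' x1 + (1/3) *\<^sub>R A + B"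
      unfolding new_pos \<Psi>_def by (simp_all add: prod_eq_iff field_simps)
    show "s = 0" "u = 0" if h: "s *\<^sub>R (1/3) *\<^sub>R A + u *\<^sub>R B = 0" for s u
      using indep[of "s / 3" u] h by simp_all
    fix e s u
    assume h: "e \<in> E' - {{x1, x2}, {y1, y2}, {x1, y1}, {x2, y2}}" "(0::real) \<le> s" "s \<le> 1" "(0::real) \<le> u" "u \<le> 1"
      "pos' x1 + s *\<^sub>R (1/3) *\<^sub>R A + u *\<^sub>R B \<in> convex hull (pos' ` e)"
    have eq: "pos' x1 + s *\<^sub>R (1/3) *\<^sub>R A + u *\<^sub>R B = \<Psi> (1 + s) u"
      unfolding new_pos \<Psi>_def by (simp add: prod_eq_iff field_simps)
    show "pos' x1 + s *\<^sub>R (1/3) *\<^sub>R A + u *\<^sub>R B \<in> pos' ` (e \<inter> W)"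
      unfolding eq using away'[OF h(1), of "1 + s" u] h(2-6) unfolding eq by simp
  qed
  then show ?thesis by blast
qed

end

section \<open>Excluding spanning paths by search\<close>

text \<open>A search for spanning paths between two of the vertices in \<open>T\<close> that decides the edges one by
  one. A state lists, for the vertices met so far, the other end of the chosen path ending there; the
  value \<open>-1\<close> marks a vertex that already lies on two chosen edges, and a vertex without entry lies
  on none. Each edge is annotated with the numbers of later edges at its two ends; terminals get the
  value 2 instead, since they need not lie on two path edges.\<close>

type_synonym state = "(int \<times> int) list"

text \<open>By default a vertex is its own mate: on no chosen edge, it is both ends of a trivial
  path.\<close>

definition mate :: "state \<Rightarrow> int \<Rightarrow> int" where
  "mate m k = (case map_of m k of None \<Rightarrow> k | Some w \<Rightarrow> w)"

definition del :: "int \<Rightarrow> state \<Rightarrow> state" where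
  "del k m = filter (\<lambda>(x, w). x \<noteq> k) m"

definition upd :: "int \<Rightarrow> int \<Rightarrow> state \<Rightarrow> state" where
  "upd k w m = (k, w) # del k m"

text \<open>\<open>a\<close> is the mate of \<open>u\<close> before the new edge. If it is
  \<open>u\<close> itself, \<open>u\<close> has become the end of a path and keeps its entry;
  otherwise \<open>u\<close> has become interior.\<close>

definition saturate :: "int \<Rightarrow> int \<Rightarrow> state \<Rightarrow> state" where
  "saturate u a m = (if a = u then m else upd u (-1) m)"

text \<open>All mates are read off the old state. The far ends are paired first and
  \<open>u\<close>, \<open>v\<close> are saturated afterwards, so that a far end equal to
  \<open>u\<close> or \<open>v\<close> keeps its new entry.\<close>

definition link :: "int \<Rightarrow> int \<Rightarrow> state \<Rightarrow> state" where
  "link u v m = saturate u (mate m u) (saturate v (mate m v) (upd (mate m u) (mate m v) (upd (mate m v) (mate m u) m)))"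

text \<open>The last condition forbids closing a cycle.\<close>

definition linkable :: "int \<Rightarrow> int \<Rightarrow> state \<Rightarrow> bool" where
  "linkable u v m \<longleftrightarrow> mate m u \<noteq> -1 \<and> mate m v \<noteq> -1 \<and> mate m u \<noteq> v"

text \<open>Can \<open>k\<close> later edges still raise the degree of \<open>z\<close> to 2? Here
  \<open>w\<close> is the mate of \<open>z\<close>: -1 stands for degree 2 and \<open>z\<close>
  itself for degree 0.\<close>

definition enough :: "int \<Rightarrow> int \<Rightarrow> int \<Rightarrow> bool" where
  "enough k z w \<longleftrightarrow> (w = -1 \<or> 1 \<le> k) \<and> (w \<noteq> z \<or> 2 \<le> k)"

definition viable :: "int \<Rightarrow> int \<Rightarrow> int \<Rightarrow> int \<Rightarrow> state \<Rightarrow> bool" where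
  "viable u v ku kv m \<longleftrightarrow> enough ku u (mate m u) \<and> enough kv v (mate m v)"

text \<open>Without later edges, a vertex that passed \<open>enough\<close> lies on two chosen edges
  and no longer matters; removing its entry keeps the states short.\<close>

definition trim :: "int \<Rightarrow> int \<Rightarrow> state \<Rightarrow> state" where
  "trim k z m = (if k = 0 then del z m else m)"

fun occ :: "(int \<times> int) list \<Rightarrow> int \<Rightarrow> int" where
  "occ [] z = 0"
| "occ ((u, v) # es) z = (if u = z \<or> v = z then 1 else 0) + occ es z"

definition quota :: "int list \<Rightarrow> (int \<times> int) list \<Rightarrow> int \<Rightarrow> int" where
  "quota T es z = (if List.member T z then 2 else occ es z)"

fun annotate :: "int list \<Rightarrow> (int \<times> int) list \<Rightarrow> (int \<times> int \<times> int \<times> int) list" where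
  "annotate T [] = []"
| "annotate T ((u, v) # es) = (u, v, quota T es u, quota T es v) # annotate T es"

text \<open>At the end it is enough that no terminal lies on two chosen edges: a spanning path
  between two of three terminals has the third one in its interior. The conditionals let a branch be
  skipped once its test fails.\<close>

fun dead :: "int list \<Rightarrow> (int \<times> int \<times> int \<times> int) list \<Rightarrow> state \<Rightarrow> bool" where
  "dead T [] m \<longleftrightarrow> list_all (\<lambda>r. mate m r \<noteq> -1) T"
| "dead T ((u, v, ku, kv) # es) m \<longleftrightarrow>
    (if viable u v ku kv m then dead T es (trim ku u (trim kv v m)) else True) \<and>
    (if linkable u v m then
       if viable u v ku kv (link u v m) then dead T es (trim ku u (trim kv v (link u v m))) else True
     else True)"

definition edge_set :: "(int \<times> int) list \<Rightarrow> int set set" where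
  "edge_set es = (\<lambda>(u, v). {u, v}) ` set es"

definition vdeg :: "int set set \<Rightarrow> int \<Rightarrow> nat" where
  "vdeg X z = card {e \<in> X. z \<in> e}"

definition joined :: "int set set \<Rightarrow> (int \<times> int) set" where
  "joined X = {(x, y). {x, y} \<in> X}\<^sup>*"

text \<open>The state has to be right only on \<open>Z\<close>, which will consist of the terminals
  and the ends of undecided edges; other entries may have been trimmed.\<close>

definition describes :: "(int \<Rightarrow> int) \<Rightarrow> int set set \<Rightarrow> int set \<Rightarrow> bool" where
  "describes \<mu> X Z \<longleftrightarrow> (\<forall>z\<in>Z. (\<mu> z = z \<longrightarrow> vdeg X z = 0) \<and> (\<mu> z = -1 \<longrightarrow> vdeg X z = 2) \<and>
     (\<mu> z \<noteq> z \<longrightarrow> \<mu> z \<noteq> -1 \<longrightarrow> vdeg X z = 1 \<and> (z, \<mu> z) \<in> joined X \<and> \<mu> (\<mu> z) = z))"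

section \<open>Soundness of the search\<close>

lemma mate_del: "mate (del k m) z = (if z = k then z else mate m z)"
proof -
  have "map_of (del k m) z = (if z = k then None else map_of m z)"
    unfolding del_def by (induction m) auto
  then show ?thesis unfolding mate_def by simp
qed

lemma mate_upd: "mate (upd k w m) z = (if z = k then w else mate m z)"
proof (cases "z = k")
  case True
  then show ?thesis unfolding upd_def mate_def by simp
next
  case False
  then have "mate (upd k w m) z = mate (del k m) z" unfolding upd_def mate_def by simp
  then show ?thesis using False by (simp add: mate_del)
qed

lemma mate_saturate: "mate (saturate u a m) z = (if z = u \<and> a \<noteq> u then -1 else mate m z)"
  unfolding saturate_def by (auto simp: mate_upd)

lemma mate_link:
  "mate (link u v m) z = (if z = u \<and> mate m u \<noteq> u then -1 else if z = v \<and> mate m v \<noteq> v then -1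
     else if z = mate m u then mate m v else if z = mate m v then mate m u else mate m z)"
  unfolding link_def mate_saturate mate_upd by simp

lemma joined_mono: "X \<subseteq> Y \<Longrightarrow> joined X \<subseteq> joined Y"
  unfolding joined_def by (rule rtrancl_mono) auto

lemma joined_sym: "(x, y) \<in> joined X \<Longrightarrow> (y, x) \<in> joined X"
proof -
  have "sym {(x, y). {x, y} \<in> X}" by (rule symI) (simp add: insert_commute)
  then show "(x, y) \<in> joined X \<Longrightarrow> (y, x) \<in> joined X"
    unfolding joined_def using sym_rtrancl by (meson symD)
qed

lemma joined_trans: "(x, y) \<in> joined X \<Longrightarrow> (y, z) \<in> joined X \<Longrightarrow> (x, z) \<in> joined X"
  unfolding joined_def by (rule rtrancl_trans)

lemma joined_refl: "(x, x) \<in> joined X"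
  unfolding joined_def by simp

lemma joined_edge: "{x, y} \<in> X \<Longrightarrow> (x, y) \<in> joined X"
  unfolding joined_def by (rule r_into_rtrancl) simp

lemma finite_pedges: "finite (pedges p)"
  by (induction p rule: pedges.induct) auto

lemma vdeg_pedges:
  assumes "distinct p" "z \<in> set p"
  shows "vdeg (pedges p) z = (if hd p = last p then 0 else if z = hd p \<or> z = last p then 1 else 2)"
  using assms
proof (induction p rule: pedges.induct)
  case (1 x y zs)
  have "y \<noteq> x" "x \<notin> set (y # zs)" using 1(2) by auto
  have ends: "hd (x # y # zs) \<noteq> last (x # y # zs)" using 1(2) last_in_set[of "y # zs"] by auto
  have no_x: "e \<in> pedges (y # zs) \<Longrightarrow> x \<notin> e" for e
    using pedges_subset[of e "y # zs"] \<open>x \<notin> set (y # zs)\<close> by blast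
  show ?case
  proof (cases "z = x")
    case True
    then have "{e \<in> pedges (x # y # zs). z \<in> e} = {{x, y}}" using no_x by auto
    then show ?thesis using True ends unfolding vdeg_def by simp
  next
    case False
    then have z: "z \<in> set (y # zs)" using 1(3) by simp
    have IH: "vdeg (pedges (y # zs)) z = (if y = last (y # zs) then 0 else if z = y \<or> z = last (y # zs) then 1 else 2)"
      using 1(1)[OF _ z] 1(2) by simp
    show ?thesis
    proof (cases "z = y")
      case zy: True
      have "{e \<in> pedges (x # y # zs). z \<in> e} = insert {x, y} {e \<in> pedges (y # zs). z \<in> e}" using zy by auto
      moreover have notin: "{x, y} \<notin> {e \<in> pedges (y # zs). z \<in> e}" using no_x by auto
      have fin: "finite {e \<in> pedges (y # zs). z \<in> e}" using finite_pedges[of "y # zs"] by simp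
      ultimately have "vdeg (pedges (x # y # zs)) z = Suc (vdeg (pedges (y # zs)) z)"
        unfolding vdeg_def using card_insert_disjoint[OF fin notin] by metis
      then show ?thesis using IH zy False ends 1(2) by (cases zs) auto
    next
      case zy: False
      have "{e \<in> pedges (x # y # zs). z \<in> e} = {e \<in> pedges (y # zs). z \<in> e}" using zy False by auto
      then have "vdeg (pedges (x # y # zs)) z = vdeg (pedges (y # zs)) z" unfolding vdeg_def by simp
      then show ?thesis using IH zy False ends z 1(2) by (cases zs) auto
    qed
  qed
qed (auto simp: vdeg_def)

text \<open>Without the edge \<open>{u, v}\<close> only the vertices of \<open>xs @ [u]\<close> can
  be reached from \<open>u\<close>.\<close>

lemma not_joined_aux:
  assumes "p = xs @ u # v # ys" "distinct p"
  shows "(u, v) \<notin> joined (pedges p - {{u, v}})"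
proof
  assume "(u, v) \<in> joined (pedges p - {{u, v}})"
  then have "v \<in> set (xs @ [u])"
    unfolding joined_def
  proof (induction rule: rtrancl_induct)
    case base
    then show ?case by simp
  next
    case (step x y)
    then have "{x, y} \<in> pedges p - {{u, v}}" by simp
    moreover have "pedges p = pedges (xs @ [u]) \<union> insert {u, v} (pedges (v # ys))"
      unfolding assms(1) using pedges_append[of xs u "v # ys"] by simp
    ultimately have "{x, y} \<in> pedges (xs @ [u]) \<or> {x, y} \<in> pedges (v # ys)" by auto
    then show ?case
    proof
      assume "{x, y} \<in> pedges (xs @ [u])"
      then show ?thesis using pedges_subset[of "{x, y}" "xs @ [u]"] by simp
    next
      assume "{x, y} \<in> pedges (v # ys)"
      then have "x \<in> set (v # ys)" using pedges_subset[of "{x, y}" "v # ys"] by simp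
      then show ?thesis using step(3) assms by auto
    qed
  qed
  then show False using assms by auto
qed

text \<open>Ensures that choosing the next edge of a path never looks to the search like closing a
  cycle.\<close>

lemma not_joined:
  assumes "{u, v} \<in> pedges p" "distinct p"
  shows "(u, v) \<notin> joined (pedges p - {{u, v}})"
  using assms(1)
proof (cases rule: pedges_split)
  case (1 xs ys)
  then show ?thesis using not_joined_aux assms(2) by blast
next
  case (2 xs ys)
  then have "(v, u) \<notin> joined (pedges p - {{v, u}})" using not_joined_aux assms(2) by blast
  then show ?thesis using joined_sym by (metis insert_commute)
qed

lemma vdeg_insert:
  assumes "finite X" "e \<notin> X"
  shows "vdeg (insert e X) z = vdeg X z + (if z \<in> e then 1 else 0)"
proof -
  have "{d \<in> insert e X. z \<in> d} = (if z \<in> e then insert e {d \<in> X. z \<in> d} else {d \<in> X. z \<in> d})" by auto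
  then show ?thesis using assms unfolding vdeg_def by simp
qed

lemma vdeg_mono: "finite Y \<Longrightarrow> X \<subseteq> Y \<Longrightarrow> vdeg X z \<le> vdeg Y z"
  unfolding vdeg_def by (rule card_mono) auto

lemma vdeg_Un: "finite X \<Longrightarrow> finite Y \<Longrightarrow> vdeg (X \<union> Y) z \<le> vdeg X z + vdeg Y z"
proof -
  have "{e \<in> X \<union> Y. z \<in> e} = {e \<in> X. z \<in> e} \<union> {e \<in> Y. z \<in> e}" by auto
  then show ?thesis unfolding vdeg_def using card_Un_le by metis
qed

lemma vdeg_edge_set: "int (vdeg (edge_set es) z) \<le> occ es z"
proof (induction es)
  case Nil
  then show ?case unfolding edge_set_def vdeg_def by simp
next
  case (Cons e es)
  obtain u v where e: "e = (u, v)" by (cases e)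
  have "edge_set (e # es) = insert {u, v} (edge_set es)" unfolding edge_set_def e by simp
  then have "{d \<in> edge_set (e # es). z \<in> d} \<subseteq> (if u = z \<or> v = z then {{u, v}} else {}) \<union> {d \<in> edge_set es. z \<in> d}"
    by auto
  moreover have "finite ((if u = z \<or> v = z then {{u, v}} else {}) \<union> {d \<in> edge_set es. z \<in> d})"
    unfolding edge_set_def by simp
  ultimately have "vdeg (edge_set (e # es)) z \<le> card ((if u = z \<or> v = z then {{u, v}} else {}) \<union> {d \<in> edge_set es. z \<in> d})"
    unfolding vdeg_def by (intro card_mono)
  also have "\<dots> \<le> card (if u = z \<or> v = z then {{u, v}} else {}) + vdeg (edge_set es) z"
    unfolding vdeg_def by (rule card_Un_le)
  also have "\<dots> = (if u = z \<or> v = z then 1 else 0) + vdeg (edge_set es) z" by simp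
  finally have le: "vdeg (edge_set (e # es)) z \<le> (if u = z \<or> v = z then 1 else 0) + vdeg (edge_set es) z" .
  have "occ (e # es) z = (if u = z \<or> v = z then 1 else 0) + occ es z" by (simp add: e)
  then show ?case using le Cons by (cases "u = z \<or> v = z") auto
qed

text \<open>As \<open>X\<close> does not join \<open>u\<close> and \<open>v\<close>, the vertices
  \<open>u\<close>, \<open>\<mu> u\<close>, \<open>v\<close>, \<open>\<mu> v\<close> coincide at
  most as \<open>\<mu> u = u\<close> or \<open>\<mu> v = v\<close>. The new edge merges two paths
  into one with the ends \<open>\<mu> u\<close> and \<open>\<mu> v\<close>.\<close>

lemma describes_link:
  assumes d: "describes \<mu> X Z" and uv: "u \<in> Z" "v \<in> Z" "u \<noteq> v"
    and nonneg: "\<And>z. z \<in> Z \<Longrightarrow> z \<noteq> -1" and X: "finite X" "{u, v} \<notin> X"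
    and nj: "(u, v) \<notin> joined X" and deg: "vdeg X u \<noteq> 2" "vdeg X v \<noteq> 2"
  shows "\<mu> u \<noteq> -1" "\<mu> v \<noteq> -1" "\<mu> u \<noteq> v"
    and "describes (\<lambda>z. if z = u \<and> \<mu> u \<noteq> u then -1 else if z = v \<and> \<mu> v \<noteq> v then -1
     else if z = \<mu> u then \<mu> v else if z = \<mu> v then \<mu> u else \<mu> z) (insert {u, v} X) Z"
proof -
  have D0: "\<mu> z = z \<Longrightarrow> vdeg X z = 0" and D2: "\<mu> z = -1 \<Longrightarrow> vdeg X z = 2"
    and D1: "\<mu> z \<noteq> z \<Longrightarrow> \<mu> z \<noteq> -1 \<Longrightarrow> vdeg X z = 1"
    and DJ: "\<mu> z \<noteq> z \<Longrightarrow> \<mu> z \<noteq> -1 \<Longrightarrow> (z, \<mu> z) \<in> joined X" and DM: "\<mu> z \<noteq> z \<Longrightarrow> \<mu> z \<noteq> -1 \<Longrightarrow> \<mu> (\<mu> z) = z"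
    if "z \<in> Z" for z using d that unfolding describes_def by blast+
  show a: "\<mu> u \<noteq> -1" and b: "\<mu> v \<noteq> -1" using D2 uv deg by blast+
  have ja: "(u, \<mu> u) \<in> joined X" and jb: "(v, \<mu> v) \<in> joined X"
    using DJ[OF uv(1)] DJ[OF uv(2)] a b joined_refl by metis+
  show av: "\<mu> u \<noteq> v" using ja nj by metis
  have bu: "\<mu> v \<noteq> u" using joined_sym[OF jb] nj by metis
  have ab: "\<mu> u \<noteq> \<mu> v" using joined_trans[OF ja] joined_sym[OF jb] nj by metis
  have ma: "\<mu> (\<mu> u) = u" and mb: "\<mu> (\<mu> v) = v"
    using DM[OF uv(1)] DM[OF uv(2)] a b by metis+
  let ?X = "insert {u, v} X"
  let ?n = "\<lambda>z. if z = u \<and> \<mu> u \<noteq> u then -1 else if z = v \<and> \<mu> v \<noteq> v then -1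
     else if z = \<mu> u then \<mu> v else if z = \<mu> v then \<mu> u else \<mu> z"
  have deg': "vdeg ?X z = vdeg X z + (if z = u \<or> z = v then 1 else 0)" for z
    using vdeg_insert[OF X, of z] by auto
  have mono: "(x, y) \<in> joined X \<Longrightarrow> (x, y) \<in> joined ?X" for x y using joined_mono[of X ?X] by blast
  have jab: "(\<mu> u, \<mu> v) \<in> joined ?X"
    by (rule joined_trans[OF joined_sym[OF mono[OF ja]] joined_trans[OF joined_edge mono[OF jb]]]) simp
  have na: "?n (\<mu> u) = \<mu> v" using av ab ma by auto
  have nb: "?n (\<mu> v) = \<mu> u" using bu ab mb by auto
  show "describes ?n ?X Z"
    unfolding describes_def
  proof
    fix z assume z: "z \<in> Z"
    have z1: "z \<noteq> -1" by (rule nonneg[OF z])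
    consider (u) "z = u" "\<mu> u \<noteq> u" | (v) "z = v" "\<mu> v \<noteq> v" | (a) "z = \<mu> u" | (b) "z = \<mu> v"
      | (other) "z \<noteq> u" "z \<noteq> v" "z \<noteq> \<mu> u" "z \<noteq> \<mu> v" by metis
    then show "(?n z = z \<longrightarrow> vdeg ?X z = 0) \<and> (?n z = -1 \<longrightarrow> vdeg ?X z = 2) \<and>
     (?n z \<noteq> z \<longrightarrow> ?n z \<noteq> -1 \<longrightarrow> vdeg ?X z = 1 \<and> (z, ?n z) \<in> joined ?X \<and> ?n (?n z) = z)"
    proof cases
      case u
      then have "?n z = -1" by simp
      moreover have "vdeg ?X z = 2" using deg'[of z] D1[OF uv(1)] u a by simp
      ultimately show ?thesis using z1 by simp
    next
      case v
      then have "?n z = -1" using uv(3) by simp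
      moreover have "vdeg ?X z = 2" using deg'[of z] D1[OF uv(2)] v b by simp
      ultimately show ?thesis using z1 by simp
    next
      case a': a
      have "vdeg ?X z = 1"
      proof (cases "\<mu> u = u")
        case True
        then show ?thesis using deg'[of z] D0[OF uv(1)] a' by simp
      next
        case False
        then show ?thesis using deg'[of z] D1[OF z] a' av ma a uv z1 nonneg[OF uv(1)] by auto
      qed
      moreover have "?n z = \<mu> v" unfolding a' by (rule na)
      moreover have "?n (?n z) = z" unfolding \<open>?n z = \<mu> v\<close> unfolding a' by (rule nb)
      ultimately show ?thesis using ab b jab a' by simp
    next
      case b': b
      have "vdeg ?X z = 1"
      proof (cases "\<mu> v = v")
        case True
        then show ?thesis using deg'[of z] D0[OF uv(2)] b' by simp
      next
        case False
        then show ?thesis using deg'[of z] D1[OF z] b' bu mb b uv z1 nonneg[OF uv(2)] by auto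
      qed
      moreover have "?n z = \<mu> u" unfolding b' by (rule nb)
      moreover have "?n (?n z) = z" unfolding \<open>?n z = \<mu> u\<close> unfolding b' by (rule na)
      ultimately show ?thesis using ab a joined_sym[OF jab] b' by simp
    next
      case other
      then have n: "?n z = \<mu> z" by simp
      have dz: "vdeg ?X z = vdeg X z" using deg'[of z] other by simp
      have "?n (\<mu> z) = z" if m: "\<mu> z \<noteq> z" "\<mu> z \<noteq> -1"
      proof -
        have mm: "\<mu> (\<mu> z) = z" by (rule DM[OF z m])
        have "\<mu> z \<noteq> u" "\<mu> z \<noteq> v" using mm other by auto
        moreover have "\<mu> z \<noteq> \<mu> u" "\<mu> z \<noteq> \<mu> v" using mm ma mb other by metis+
        ultimately show ?thesis using mm by simp
      qed
      then show ?thesis unfolding n dz using D0[OF z] D2[OF z] D1[OF z] mono[OF DJ[OF z]] by blast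
    qed
  qed
qed

text \<open>For \<open>k = 0\<close>, \<open>enough\<close> forces the mate of \<open>z\<close> to
  be -1. Mates being mutual, \<open>z\<close> is then not the mate of a described vertex, and
  forgetting it disturbs no other entry.\<close>

lemma describes_trim:
  assumes "describes (mate m) X Z" "enough k z (mate m z)" "\<And>y. y \<in> Z' \<Longrightarrow> y \<noteq> -1" "Z' \<subseteq> Z"
    "k = 0 \<Longrightarrow> z \<notin> Z' \<and> z \<in> Z"
  shows "describes (mate (trim k z m)) X Z'"
proof (cases "k = 0")
  case False
  then show ?thesis using assms(1,4) unfolding trim_def describes_def by auto
next
  case True
  then have z: "z \<notin> Z'" "mate m z = -1" using assms(2,5) unfolding enough_def by auto
  show ?thesis
    unfolding describes_def
  proof
    fix y assume y: "y \<in> Z'"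
    then have yz: "y \<noteq> z" "y \<in> Z" "y \<noteq> -1" using z assms(3,4) by auto
    have my: "mate (trim k z m) y = mate m y" using True yz by (simp add: trim_def mate_del)
    have D: "(mate m y = y \<longrightarrow> vdeg X y = 0) \<and> (mate m y = -1 \<longrightarrow> vdeg X y = 2) \<and>
     (mate m y \<noteq> y \<longrightarrow> mate m y \<noteq> -1 \<longrightarrow> vdeg X y = 1 \<and> (y, mate m y) \<in> joined X \<and> mate m (mate m y) = y)"
      using assms(1) yz(2) unfolding describes_def by blast
    moreover have "mate m y \<noteq> z" if "mate m y \<noteq> y" "mate m y \<noteq> -1"
      using D that z(2) yz(3) by auto
    then have "mate (trim k z m) (mate m y) = mate m (mate m y)" if "mate m y \<noteq> y" "mate m y \<noteq> -1"
      using True that by (simp add: trim_def mate_del)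
    ultimately show "(mate (trim k z m) y = y \<longrightarrow> vdeg X y = 0) \<and> (mate (trim k z m) y = -1 \<longrightarrow> vdeg X y = 2) \<and>
     (mate (trim k z m) y \<noteq> y \<longrightarrow> mate (trim k z m) y \<noteq> -1 \<longrightarrow> vdeg X y = 1 \<and>
       (y, mate (trim k z m) y) \<in> joined X \<and> mate (trim k z m) (mate (trim k z m) y) = y)"
      unfolding my by simp
  qed
qed

lemma occ_nonneg: "0 \<le> occ es z"
  by (induction es z rule: occ.induct) auto

lemma occ_zero: "occ es z = 0 \<longleftrightarrow> z \<notin> \<Union> (edge_set es)"
proof (induction es z rule: occ.induct)
  case (1 z)
  then show ?case by (simp add: edge_set_def)
next
  case (2 u v es z)
  have "edge_set ((u, v) # es) = insert {u, v} (edge_set es)" by (simp add: edge_set_def)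
  then show ?case using 2 occ_nonneg[of es z] by auto
qed

text \<open>A hypothetical path \<open>p\<close> steers the argument through the search tree;
  \<open>r\<close> is a terminal in its interior.\<close>

locale spanning_path =
  fixes p :: "int list" and T :: "int list" and r :: int
  assumes distinct_p: "distinct p" and nonneg: "\<And>z. z \<in> set p \<Longrightarrow> 0 \<le> z"
    and ends: "hd p \<in> set T" "last p \<in> set T" "hd p \<noteq> last p" and T: "set T \<subseteq> set p"
    and r: "r \<in> set T" "r \<noteq> hd p" "r \<noteq> last p"
begin

lemma vdeg_interior: "z \<in> set p \<Longrightarrow> z \<noteq> hd p \<Longrightarrow> z \<noteq> last p \<Longrightarrow> vdeg (pedges p) z = 2"
  using vdeg_pedges[OF distinct_p] ends by simp

lemma vdeg_le: "z \<in> set p \<Longrightarrow> vdeg (pedges p) z \<le> 2"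
  using vdeg_pedges[OF distinct_p] by simp

text \<open>A vertex outside \<open>T\<close> is interior to \<open>p\<close>, and its two path
  edges are chosen or still to come. Terminals pass by their quota 2.\<close>

lemma enough_quota:
  assumes "describes \<mu> X Z" "z \<in> Z" "z \<in> set p" "pedges p \<subseteq> X \<union> edge_set es" "finite X"
  shows "enough (quota T es z) z (\<mu> z)"
proof (cases "z \<in> set T")
  case True
  then show ?thesis by (simp add: enough_def quota_def)
next
  case False
  then have "vdeg (pedges p) z = 2" using vdeg_interior[OF assms(3)] ends by metis
  moreover have "vdeg (pedges p) z \<le> vdeg X z + vdeg (edge_set es) z"
    using vdeg_mono[OF _ assms(4), of z] vdeg_Un[OF assms(5), of "edge_set es" z] assms(5)
    by (simp add: edge_set_def)
  ultimately have "2 \<le> int (vdeg X z) + occ es z" using vdeg_edge_set[of es z] by linarith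
  moreover have "quota T es z = occ es z" using False by (simp add: quota_def)
  moreover have "(\<mu> z = z \<longrightarrow> vdeg X z = 0) \<and> (\<mu> z \<noteq> z \<longrightarrow> \<mu> z \<noteq> -1 \<longrightarrow> vdeg X z = 1)"
    using assms(1,2) unfolding describes_def by blast
  ultimately show ?thesis unfolding enough_def by (cases "\<mu> z = z"; cases "\<mu> z = -1") auto
qed

text \<open>The invariant is that \<open>X\<close> consists of the decided edges of
  \<open>p\<close>. At each edge the branch agreeing with \<open>p\<close> is followed, where all
  tests succeed; at the end \<open>r\<close> has degree 2 in \<open>X\<close>, contrary to
  \<open>dead\<close>.\<close>

lemma dead_sound:
  assumes "dead T (annotate T es) m" "describes (mate m) X (set T \<union> \<Union> (edge_set es))"
    "X \<subseteq> pedges p" "pedges p \<subseteq> X \<union> edge_set es" "X \<inter> edge_set es = {}"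
    "distinct (map (\<lambda>(u, v). {u, v}) es)" "\<And>u v. (u, v) \<in> set es \<Longrightarrow> u \<noteq> v \<and> u \<in> set p \<and> v \<in> set p"
  shows False
  using assms
proof (induction es arbitrary: m X)
  case Nil
  then have X: "X = pedges p" by (auto simp: edge_set_def)
  have "vdeg X r = 2" unfolding X by (rule vdeg_interior[OF subsetD[OF T r(1)] r(2,3)])
  moreover have "mate m r \<noteq> -1" using Nil(1) r(1) by (simp add: list_all_iff)
  moreover have "(mate m r = r \<longrightarrow> vdeg X r = 0) \<and> (mate m r \<noteq> r \<longrightarrow> mate m r \<noteq> -1 \<longrightarrow> vdeg X r = 1)"
    using Nil(2) r(1) unfolding describes_def by simp
  ultimately show ?case by (cases "mate m r = r") simp_all
next
  case (Cons e es)
  obtain u v where e: "e = (u, v)" by (cases e)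
  have es: "edge_set (e # es) = insert {u, v} (edge_set es)" by (simp add: edge_set_def e)
  have uv: "u \<noteq> v" "u \<in> set p" "v \<in> set p" using Cons(8)[of u v] e by auto
  have new: "{u, v} \<notin> edge_set es" using Cons(7) unfolding e edge_set_def by auto
  have finX: "finite X" by (rule finite_subset[OF Cons(4) finite_pedges])
  let ?Z = "set T \<union> \<Union> (edge_set (e # es))" and ?Z' = "set T \<union> \<Union> (edge_set es)"
  have Zsub: "?Z' \<subseteq> ?Z" unfolding es by blast
  have edge_p: "z \<in> set p" if "z \<in> \<Union> (edge_set (e # es))" for z
    using that Cons(8) unfolding edge_set_def by (auto split: prod.splits)
  have Zp: "z \<in> set p" if "z \<in> ?Z" for z using that edge_p[of z] subsetD[OF T, of z] by (elim UnE)
  have Zneg: "z \<noteq> -1" if "z \<in> ?Z" for z using nonneg[OF Zp[OF that]] by simp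
  have uvZ: "u \<in> ?Z" "v \<in> ?Z" unfolding es by simp_all
  \<comment> \<open>Common to both branches: the state \<open>m'\<close> after the decision is
    viable, stays correct under trimming, and falls under the induction hypothesis.\<close>
  have step: False
    if d: "describes (mate m') X' ?Z" and X': "X' \<subseteq> pedges p" "pedges p \<subseteq> X' \<union> edge_set es" "X' \<inter> edge_set es = {}"
      and dead: "viable u v (quota T es u) (quota T es v) m' \<Longrightarrow>
        dead T (annotate T es) (trim (quota T es u) u (trim (quota T es v) v m'))" for m' X'
  proof -
    have finX': "finite X'" by (rule finite_subset[OF X'(1) finite_pedges])
    have en: "enough (quota T es u) u (mate m' u)" "enough (quota T es v) v (mate m' v)"
      using enough_quota[OF d uvZ(1) uv(2) X'(2) finX'] enough_quota[OF d uvZ(2) uv(3) X'(2) finX'] by simp_all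
    then have viable: "viable u v (quota T es u) (quota T es v) m'" unfolding viable_def by simp
    have q0: "z \<notin> ?Z'" if "quota T es z = 0" for z
      using that occ_zero[of es z] unfolding quota_def by (auto split: if_splits)
    \<comment> \<open>\<open>v\<close> is trimmed first. The described set loses at most
      \<open>v\<close> at this point, because \<open>u\<close> still has to be described for its own
      trimming.\<close>
    have d1: "describes (mate (trim (quota T es v) v m')) X' (?Z - (if quota T es v = 0 then {v} else {}))"
      by (rule describes_trim[OF d en(2)]) (use Zneg uvZ in auto)
    have "mate (trim (quota T es v) v m') u = mate m' u"
      using uv(1) by (simp add: trim_def mate_del)
    then have en1: "enough (quota T es u) u (mate (trim (quota T es v) v m') u)" using en(1) by simp
    have d2: "describes (mate (trim (quota T es u) u (trim (quota T es v) v m'))) X' ?Z'"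
    proof (rule describes_trim[OF d1 en1])
      show "y \<noteq> -1" if "y \<in> ?Z'" for y by (rule Zneg[OF subsetD[OF Zsub that]])
      show "?Z' \<subseteq> ?Z - (if quota T es v = 0 then {v} else {})"
        using Zsub q0[of v] by (cases "quota T es v = 0") auto
      show "u \<notin> ?Z' \<and> u \<in> ?Z - (if quota T es v = 0 then {v} else {})" if "quota T es u = 0"
        using q0[OF that] uvZ(1) uv(1) by simp
    qed
    show False
      by (rule Cons(1)[OF dead[OF viable] d2 X']) (use Cons(7,8) in auto)
  qed
  have dd: "viable u v (quota T es u) (quota T es v) m \<Longrightarrow> dead T (annotate T es) (trim (quota T es u) u (trim (quota T es v) v m))"
    "linkable u v m \<Longrightarrow> viable u v (quota T es u) (quota T es v) (link u v m) \<Longrightarrow>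
      dead T (annotate T es) (trim (quota T es u) u (trim (quota T es v) v (link u v m)))"
    using Cons(2) unfolding e by simp_all
  show ?case
  proof (cases "{u, v} \<in> pedges p")
    case False
    show False
      by (rule step[OF Cons(3) Cons(4) _ _ dd(1)]) (use Cons(5,6) False es in auto)
  next
    case True
    have uvX: "{u, v} \<notin> X" using Cons(6) es by auto
    \<comment> \<open>With the new edge, a vertex on two edges of \<open>X\<close> would have degree
      3 in \<open>p\<close>.\<close>
    have deg: "vdeg X z \<noteq> 2" if "z \<in> {u, v}" for z
    proof
      assume "vdeg X z = 2"
      then have "vdeg (insert {u, v} X) z = 3" using vdeg_insert[OF finX uvX] that by simp
      moreover have "vdeg (insert {u, v} X) z \<le> vdeg (pedges p) z"
        by (rule vdeg_mono[OF finite_pedges]) (use True Cons(4) in auto)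
      moreover have "vdeg (pedges p) z \<le> 2" using vdeg_le[OF uv(2)] vdeg_le[OF uv(3)] that by auto
      ultimately show False by simp
    qed
    have "X \<subseteq> pedges p - {{u, v}}" using Cons(4) uvX by auto
    from subsetD[OF joined_mono[OF this], of "(u, v)"] have "(u, v) \<notin> joined X"
      using not_joined[OF True distinct_p] by auto
    note L = describes_link[OF Cons(3) uvZ uv(1) Zneg finX uvX this deg[of u] deg[of v]]
    have lk: "linkable u v m" unfolding linkable_def using L(1-3) by simp
    have "mate (link u v m) = (\<lambda>z. if z = u \<and> mate m u \<noteq> u then -1 else if z = v \<and> mate m v \<noteq> v then -1
     else if z = mate m u then mate m v else if z = mate m v then mate m u else mate m z)"
      by (rule ext) (rule mate_link)
    then have d: "describes (mate (link u v m)) (insert {u, v} X) ?Z" using L(4) by simp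
    show False
      by (rule step[OF d _ _ _ dd(2)[OF lk]]) (use Cons(4,5,6) True es new in auto)
  qed
qed

end

section \<open>Assembling the graphs\<close>

lemma pedges_map: "pedges (map f p) = (`) f ` pedges p"
  by (induction p rule: pedges.induct) auto

lemma spath_image:
  assumes "spath E S s t" "inj_on \<phi> S"
  shows "spath ((`) \<phi> ` E) (\<phi> ` S) (\<phi> s) (\<phi> t)"
proof -
  obtain p where p: "p \<noteq> []" "distinct p" "set p = S" "pedges p \<subseteq> E" "hd p = s" "last p = t"
    using assms(1) unfolding spath_def successively_iff_pedges by (elim exE conjE)
  show ?thesis
    by (rule spathI[of "map \<phi> p"])
      (use p assms(2) in \<open>simp_all add: successively_iff_pedges pedges_map image_mono distinct_map hd_map last_map\<close>)
qed

text \<open>The absence of terminal paths is carried back along the inverse of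
  \<open>\<phi>\<close>; the existence statements are carried forward.\<close>

lemma fragment_relabel:
  assumes "fragment V E a b c" "inj_on \<phi> V"
  shows "fragment (\<phi> ` V) ((`) \<phi> ` E) (\<phi> a) (\<phi> b) (\<phi> c)"
proof -
  interpret fragment V E a b c by (rule assms(1))
  let ?\<psi> = "inv_into V \<phi>"
  have inv: "?\<psi> (\<phi> v) = v" if "v \<in> V" for v by (rule inv_into_f_f[OF assms(2) that])
  have invS: "?\<psi> ` \<phi> ` S = S" if "S \<subseteq> V" for S by (rule inv_into_image_cancel[OF assms(2) that])
  have "(`) ?\<psi> ` (`) \<phi> ` E = (\<lambda>e. e) ` E"
    unfolding image_image[of "(`) ?\<psi>"] by (rule image_cong) (use invS edges in auto)
  then have invE: "(`) ?\<psi> ` (`) \<phi> ` E = E" by simp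
  have T: "{\<phi> a, \<phi> b, \<phi> c} = \<phi> ` {a, b, c}" "{a, b, c} \<subseteq> V" using terminals by simp_all
  have eq: "\<phi> x = \<phi> y \<longleftrightarrow> x = y" if "x \<in> V" "y \<in> V" for x y using inj_on_eq_iff[OF assms(2)] that by simp
  have del: "\<phi> ` V - {\<phi> v} = \<phi> ` (V - {v})" if "v \<in> V" for v
    using inj_on_image_set_diff[OF assms(2), of V "{v}"] that by auto
  show ?thesis
  proof
    show "finite (\<phi> ` V)" using finite_verts by simp
    show "e \<subseteq> \<phi> ` V \<and> card e = 2" if e: "e \<in> (`) \<phi> ` E" for e
    proof -
      obtain e' where e': "e' \<in> E" "e = \<phi> ` e'" using e by (elim imageE)
      then show ?thesis using edges[OF e'(1)] card_image[OF inj_on_subset[OF assms(2)], of e'] by auto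
    qed
    show "\<phi> a \<in> \<phi> ` V" "\<phi> b \<in> \<phi> ` V" "\<phi> c \<in> \<phi> ` V" using terminals by simp_all
    show "\<phi> a \<noteq> \<phi> b" "\<phi> a \<noteq> \<phi> c" "\<phi> b \<noteq> \<phi> c" using eq terminals by simp_all
    show "\<not> spath ((`) \<phi> ` E) (\<phi> ` V) s t"
      if st: "s \<in> {\<phi> a, \<phi> b, \<phi> c}" "t \<in> {\<phi> a, \<phi> b, \<phi> c}" "s \<noteq> t" for s t
    proof
      assume sp: "spath ((`) \<phi> ` E) (\<phi> ` V) s t"
      obtain x where x: "x \<in> {a, b, c}" "s = \<phi> x" using st(1) unfolding T by (elim imageE)
      obtain y where y: "y \<in> {a, b, c}" "t = \<phi> y" using st(2) unfolding T by (elim imageE)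
      from spath_image[OF sp inj_on_inv_into[OF subset_refl]] have "spath E V x y"
        unfolding invE invS[OF subset_refl] x(2) y(2) inv[OF subsetD[OF T(2) x(1)]] inv[OF subsetD[OF T(2) y(1)]] .
      moreover have "x \<noteq> y" using st(3) x y by auto
      ultimately show False using no_terminal_path[OF x(1) y(1)] by simp
    qed
    show "\<exists>s\<in>{\<phi> a, \<phi> b, \<phi> c}. \<exists>t\<in>{\<phi> a, \<phi> b, \<phi> c}. s \<noteq> t \<and> spath ((`) \<phi> ` E) (\<phi> ` V - {w}) s t"
      if w: "w \<in> \<phi> ` V" for w
    proof -
      obtain v where v: "v \<in> V" "w = \<phi> v" using w by (elim imageE)
      obtain s t where st: "s \<in> {a, b, c}" "t \<in> {a, b, c}" "s \<noteq> t" "spath E (V - {v}) s t"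
        using deletion_path[OF v(1)] by (elim bexE conjE)
      have "spath ((`) \<phi> ` E) (\<phi> ` V - {w}) (\<phi> s) (\<phi> t)"
        unfolding v(2) del[OF v(1)] by (rule spath_image[OF st(4) inj_on_subset[OF assms(2)]]) auto
      moreover have "\<phi> s \<noteq> \<phi> t" using eq subsetD[OF T(2) st(1)] subsetD[OF T(2) st(2)] st(3) by simp
      ultimately show ?thesis unfolding T using st(1,2) by (intro bexI[of _ "\<phi> s"] bexI[of _ "\<phi> t"] conjI imageI)
    qed
    show "\<exists>t. spath ((`) \<phi> ` E) (\<phi> ` V) (\<phi> a) t" "\<exists>t. spath ((`) \<phi> ` E) (\<phi> ` V) (\<phi> b) t"
      using path_from_a path_from_b spath_image[OF _ assms(2)] by (elim exE, intro exI, assumption | blast)+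
  qed
qed

section \<open>Sizes of drawn fragments and of their composites\<close>

definition piece :: "nat \<Rightarrow> bool" where
  "piece n \<longleftrightarrow> (\<exists>(V :: int set) E a b c pos. fragment V E a b c \<and> drawn V E a b c pos \<and> card V = n)"

definition ladder_piece :: "nat \<Rightarrow> bool" where
  "ladder_piece n \<longleftrightarrow> (\<exists>(V :: int set) E a b c t1 t2 b1 b2 pos A B. laddered_fragment V E a b c t1 t2 b1 b2 \<and>
     ladder_drawn V E a b c t1 t2 b1 b2 pos A B \<and> card V = n)"

lemma ladder_piece_piece: "ladder_piece n \<Longrightarrow> piece n"
  unfolding ladder_piece_def piece_def ladder_drawn_def laddered_fragment_def by (elim exE conjE) (intro exI conjI)

lemma ladder_piece_step:
  assumes "ladder_piece n"
  shows "ladder_piece (n + 4)"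
proof -
  obtain V :: "int set" and E a b c t1 t2 b1 b2 pos A B where
    F: "laddered_fragment V E a b c t1 t2 b1 b2" "ladder_drawn V E a b c t1 t2 b1 b2 pos A B" "card V = n"
    using assms unfolding ladder_piece_def by (elim exE conjE)
  interpret laddered_fragment V E a b c t1 t2 b1 b2 by (rule F(1))
  define k where "k = Max V + 1"
  have k: "v < k" if "v \<in> V" for v unfolding k_def using Max_ge[OF finite_verts that] by simp
  then have new: "{k, k + 1, k + 2, k + 3} \<inter> V = {}" by fastforce
  interpret ladder_extension V E a b c t1 t2 b1 b2 k "k + 1" "k + 2" "k + 3"
    by unfold_locales (simp, rule new)
  obtain pos' A' B' where
    "ladder_drawn (V \<union> {k, k + 1, k + 2, k + 3}) E' a b c k (k + 1) (k + 2) (k + 3) pos' A' B'"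
    using ladder_drawn_extended[OF F(2)] by (elim exE)
  moreover have "card (V \<union> {k, k + 1, k + 2, k + 3}) = n + 4"
    using new finite_verts F(3) by (subst card_Un_disjoint) auto
  ultimately show ?thesis
    unfolding ladder_piece_def using extended by (intro exI conjI)
qed

lemma ladder_piece_add: "ladder_piece n \<Longrightarrow> ladder_piece (n + 4 * j)"
proof (induction j)
  case (Suc j)
  then show ?case using ladder_piece_step[of "n + 4 * j"] by (simp add: algebra_simps)
qed simp

lemma drawn_relabel:
  assumes "drawn V E a b c pos" "inj_on \<phi> V" "a \<in> V" "b \<in> V" "c \<in> V"
  shows "drawn (\<phi> ` V) ((`) \<phi> ` E) (\<phi> a) (\<phi> b) (\<phi> c) (pos \<circ> inv_into V \<phi>)"
proof -
  have "(pos \<circ> inv_into V \<phi>) ` \<phi> ` V = pos ` V"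
    by (simp only: image_comp[symmetric] inv_into_image_cancel[OF assms(2) subset_refl])
  then show ?thesis
    using assms(1) straight_relabel[OF _ assms(2)] inv_into_f_f[OF assms(2)] assms(3-5)
    unfolding drawn_def by simp
qed

text \<open>The copy number \<open>k\<close> occupies the residue class of \<open>2 + k\<close>
  modulo 4, except for its gluing terminal \<open>c\<close>, which goes to \<open>z\<close>: 0 in
  the first pair and 1 in the second. All other vertices receive numbers from 2 on.\<close>

definition place :: "nat \<Rightarrow> nat \<Rightarrow> int \<Rightarrow> int \<Rightarrow> nat" where
  "place z k c v = (if v = c then z else 2 + 4 * to_nat v + k)"

lemma place_inj: "z < 2 \<Longrightarrow> inj_on (place z k c) V"
  unfolding place_def by (rule inj_onI) (auto split: if_splits)

lemma place_eq:
  assumes "place z k c v = place z' k' c' v'" "z < 2" "z' < 2" "k < 4" "k' < 4" "k \<noteq> k'"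
  shows "v = c \<and> v' = c' \<and> z = z'"
proof -
  have "2 + 4 * x + k \<noteq> 2 + 4 * y + k'" for x y :: nat
    using assms(4-6) by presburger
  then show ?thesis using assms(1-3) unfolding place_def by (auto split: if_splits)
qed

lemma pieces_combine:
  assumes "piece n1" "piece n2" "piece n3" "piece n4" "n + 2 = n1 + n2 + n3 + n4"
  shows "\<exists>G :: nat ugraph. finite_simple_graph G \<and> planar G \<and> hypotraceable G \<and> card (uverts G) = n"
proof -
  obtain V1 :: "int set" and E1 a1 b1 c1 p1 where 1: "fragment V1 E1 a1 b1 c1" "drawn V1 E1 a1 b1 c1 p1" "card V1 = n1"
    using assms(1) unfolding piece_def by (elim exE conjE)
  obtain V2 :: "int set" and E2 a2 b2 c2 p2 where 2: "fragment V2 E2 a2 b2 c2" "drawn V2 E2 a2 b2 c2 p2" "card V2 = n2"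
    using assms(2) unfolding piece_def by (elim exE conjE)
  obtain V3 :: "int set" and E3 a3 b3 c3 p3 where 3: "fragment V3 E3 a3 b3 c3" "drawn V3 E3 a3 b3 c3 p3" "card V3 = n3"
    using assms(3) unfolding piece_def by (elim exE conjE)
  obtain V4 :: "int set" and E4 a4 b4 c4 p4 where 4: "fragment V4 E4 a4 b4 c4" "drawn V4 E4 a4 b4 c4 p4" "card V4 = n4"
    using assms(4) unfolding piece_def by (elim exE conjE)
  note t1 = fragment.terminals[OF 1(1)] and t2 = fragment.terminals[OF 2(1)]
    and t3 = fragment.terminals[OF 3(1)] and t4 = fragment.terminals[OF 4(1)]
  let ?f1 = "place 0 0 c1" and ?f2 = "place 0 1 c2" and ?f3 = "place 1 2 c3" and ?f4 = "place 1 3 c4"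
  have i: "inj_on ?f1 V1" "inj_on ?f2 V2" "inj_on ?f3 V3" "inj_on ?f4 V4" by (simp_all add: place_inj)
  have c: "?f1 c1 = 0" "?f2 c2 = 0" "?f3 c3 = 1" "?f4 c4 = 1" by (simp_all add: place_def)
  note f = fragment_relabel[OF 1(1) i(1)] fragment_relabel[OF 2(1) i(2)]
    fragment_relabel[OF 3(1) i(3)] fragment_relabel[OF 4(1) i(4)]
  note d = drawn_relabel[OF 1(2) i(1) t1(1-3)] drawn_relabel[OF 2(2) i(2) t2(1-3)]
    drawn_relabel[OF 3(2) i(3) t3(1-3)] drawn_relabel[OF 4(2) i(4) t4(1-3)]
  have m12: "?f1 ` V1 \<inter> ?f2 ` V2 = {0}"
  proof
    show "?f1 ` V1 \<inter> ?f2 ` V2 \<subseteq> {0}"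
    proof
      fix x assume "x \<in> ?f1 ` V1 \<inter> ?f2 ` V2"
      then obtain v w where vw: "x = ?f1 v" "x = ?f2 w" by (elim IntE imageE)
      then have "v = c1" using place_eq[of 0 0 c1 v 0 1 c2 w] by simp
      then show "x \<in> {0}" using vw(1) c(1) by simp
    qed
    show "{0} \<subseteq> ?f1 ` V1 \<inter> ?f2 ` V2"
      using imageI[OF t1(3), of ?f1] imageI[OF t2(3), of ?f2] c(1,2) by simp
  qed
  have m34: "?f3 ` V3 \<inter> ?f4 ` V4 = {1}"
  proof
    show "?f3 ` V3 \<inter> ?f4 ` V4 \<subseteq> {1}"
    proof
      fix x assume "x \<in> ?f3 ` V3 \<inter> ?f4 ` V4"
      then obtain v w where vw: "x = ?f3 v" "x = ?f4 w" by (elim IntE imageE)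
      then have "v = c3" using place_eq[of 1 2 c3 v 1 3 c4 w] by simp
      then show "x \<in> {1}" using vw(1) c(3) by simp
    qed
    show "{1} \<subseteq> ?f3 ` V3 \<inter> ?f4 ` V4"
      using imageI[OF t3(3), of ?f3] imageI[OF t4(3), of ?f4] c(3,4) by simp
  qed
  have ne: "place 0 k c v \<noteq> place 1 k' c' w" if "k < 2" "k' = 2 \<or> k' = 3" for k k' c c' v w
    using place_eq[of 0 k c v 1 k' c' w] that by auto
  have dis: "(?f1 ` V1 \<union> ?f2 ` V2) \<inter> (?f3 ` V3 \<union> ?f4 ` V4) = {}"
    using ne[of 0 2] ne[of 0 3] ne[of 1 2] ne[of 1 3] by (auto simp: image_iff)
  interpret four_fragments "?f1 ` V1" "(`) ?f1 ` E1" "?f1 a1" "?f1 b1" 0 "?f2 ` V2" "(`) ?f2 ` E2" "?f2 a2" "?f2 b2"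
    "?f3 ` V3" "(`) ?f3 ` E3" "?f3 a3" "?f3 b3" 1 "?f4 ` V4" "(`) ?f4 ` E4" "?f4 a4" "?f4 b4"
    unfolding four_fragments_def four_fragments_axioms_def glued_pair_def glued_pair_axioms_def
    using f m12 m34 dis unfolding c by simp
  have "planar (verts, edges)" by (rule planar) (rule d[unfolded c])+
  moreover have "card verts = n"
    using card_verts assms(5) 1(3) 2(3) 3(3) 4(3) i by (simp add: card_image)
  ultimately show ?thesis
    using finite_simple_graph hypotraceable by (intro exI[of _ "(verts, edges)"]) simp
qed

lemma edge_iff: "{x, y} \<in> edge_set es \<longleftrightarrow> (x, y) \<in> set es \<or> (y, x) \<in> set es"
  unfolding edge_set_def by (auto simp: doubleton_eq_iff)

section \<open>Certificates\<close>

text \<open>Each edge is listed once with its smaller end first. Hence pairs correspond injectively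
  to edges, and adjacency is tested by looking up a single pair.\<close>

definition ordered :: "int \<Rightarrow> (int \<times> int) list \<Rightarrow> bool" where
  "ordered n es \<longleftrightarrow> distinct es \<and> list_all (\<lambda>(u, v). 0 \<le> u \<and> u < v \<and> v < n) es"

fun walk :: "(int \<times> int) list \<Rightarrow> int list \<Rightarrow> bool" where
  "walk es (x # y # zs) \<longleftrightarrow> (if x < y then List.member es (x, y) else List.member es (y, x)) \<and> walk es (y # zs)"
| "walk es _ \<longleftrightarrow> True"

lemma walk_pedges: "walk es p \<Longrightarrow> pedges p \<subseteq> edge_set es"
  by (induction es p rule: walk.induct) (auto simp: edge_iff split: if_splits)

text \<open>Together with length \<open>n\<close> this makes \<open>p\<close> a permutation of the
  vertices, without comparing sets.\<close>

definition covers :: "int \<Rightarrow> int list \<Rightarrow> bool" where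
  "covers n p \<longleftrightarrow> distinct p \<and> list_all (\<lambda>x. 0 \<le> x \<and> x < n) p"

lemma coversD:
  assumes "covers n p" "int (length p) = n"
  shows "distinct p" "set p = {0..<n}"
proof -
  show d: "distinct p" using assms(1) unfolding covers_def by simp
  have "set p \<subseteq> {0..<n}" using assms(1) unfolding covers_def list_all_iff by auto
  moreover have "card (set p) = card {0..<n}" using distinct_card[OF d] assms(2) by simp
  ultimately show "set p = {0..<n}" by (intro card_subset_eq) auto
qed

definition through :: "int list \<Rightarrow> int set set \<Rightarrow> bool" where
  "through p Q \<longleftrightarrow> pedges p \<inter> Q \<noteq> {}"

lemma spath_certificate:
  assumes "walk es p" "covers n p" "int (length p) = n" "p \<noteq> []"
  shows "spath (edge_set es) {0..<n} (hd p) (last p)"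
  by (rule spathI[of p]) (use coversD[OF assms(2,3)] walk_pedges[OF assms(1)] assms(4) in \<open>simp_all add: successively_iff_pedges\<close>)

lemma deletion_certificate:
  assumes "walk es p" "covers n (v # p)" "int (length (v # p)) = n" "p \<noteq> []"
  shows "spath (edge_set es) ({0..<n} - {v}) (hd p) (last p)"
proof -
  have "distinct (v # p)" "set (v # p) = {0..<n}" by (rule coversD[OF assms(2,3)])+
  then have "set p = {0..<n} - {v}" "distinct p" by auto
  then show ?thesis
    using walk_pedges[OF assms(1)] assms(4) by (intro spathI[of p]) (simp_all add: successively_iff_pedges)
qed

text \<open>A certificate \<open>v # p\<close> stands for the path \<open>p\<close> that spans all vertices but \<open>v\<close>.\<close>

definition deletion_ok :: "(int \<times> int) list \<Rightarrow> int \<Rightarrow> int list \<Rightarrow> int list \<Rightarrow> bool" where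
  "deletion_ok es n T q \<longleftrightarrow> (case q of [] \<Rightarrow> False | v # p \<Rightarrow> walk es p \<and> covers n q \<and> int (length q) = n \<and> p \<noteq> [] \<and>
     List.member T (hd p) \<and> List.member T (last p) \<and> hd p \<noteq> last p)"

text \<open>The required paths are listed explicitly; their absence between terminals comes from the
  search, started in the empty state in which no edge is chosen.\<close>

lemma fragment_certificate:
  assumes es: "ordered n es" and abc: "list_all (\<lambda>x. 0 \<le> x \<and> x < n) [a, b, c]" "distinct [a, b, c]"
    and dead: "dead [a, b, c] (annotate [a, b, c] es) []"
    and del: "list_all (deletion_ok es n [a, b, c]) qs" "map hd qs = [0..n - 1]"
    and starts: "walk es pa" "covers n pa" "int (length pa) = n" "hd pa = a"
      "walk es pb" "covers n pb" "int (length pb) = n" "hd pb = b"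
  shows "fragment {0..<n} (edge_set es) a b c"
proof
  have ord: "0 \<le> u \<and> u < v \<and> v < n" if "(u, v) \<in> set es" for u v
    using es that unfolding ordered_def list_all_iff by auto
  show "finite {0..<n}" by simp
  show "e \<subseteq> {0..<n} \<and> card e = 2" if "e \<in> edge_set es" for e
    using that ord unfolding edge_set_def by fastforce
  show "a \<in> {0..<n}" "b \<in> {0..<n}" "c \<in> {0..<n}" "a \<noteq> b" "a \<noteq> c" "b \<noteq> c" using abc by simp_all
  have n: "0 < n" using abc by simp
  show "\<exists>t. spath (edge_set es) {0..<n} a t" "\<exists>t. spath (edge_set es) {0..<n} b t"
    using spath_certificate[OF starts(1-3)] spath_certificate[OF starts(5-7)] starts n by fastforce+
  show "\<exists>s\<in>{a, b, c}. \<exists>t\<in>{a, b, c}. s \<noteq> t \<and> spath (edge_set es) ({0..<n} - {v}) s t" if v: "v \<in> {0..<n}" for v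
  proof -
    have "v \<in> set (map hd qs)" unfolding del(2) using v by simp
    then obtain q where q: "q \<in> set qs" "hd q = v" by auto
    then have "deletion_ok es n [a, b, c] q" using del(1) unfolding list_all_iff by simp
    then obtain p where p: "q = v # p" "walk es p" "covers n q" "int (length q) = n" "p \<noteq> []"
      "hd p \<in> {a, b, c}" "last p \<in> {a, b, c}" "hd p \<noteq> last p"
      using q(2) unfolding deletion_ok_def by (cases q) auto
    show ?thesis
      using deletion_certificate[OF p(2) p(3,4)[unfolded p(1)] p(5)] p(6-8) by (intro bexI conjI)
  qed
  show "\<not> spath (edge_set es) {0..<n} s t" if st: "s \<in> {a, b, c}" "t \<in> {a, b, c}" "s \<noteq> t" for s t
  proof
    assume "spath (edge_set es) {0..<n} s t"
    then obtain p where p: "p \<noteq> []" "distinct p" "set p = {0..<n}" "pedges p \<subseteq> edge_set es" "hd p = s" "last p = t"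
      unfolding spath_def successively_iff_pedges by (elim exE conjE)
    \<comment> \<open>The third terminal, which lies in the interior of \<open>p\<close>.\<close>
    obtain r where r: "r \<in> {a, b, c}" "r \<noteq> s" "r \<noteq> t" using st abc(2) by auto
    interpret spanning_path p "[a, b, c]" r
      by unfold_locales (use p st r abc in auto)
    have inj: "inj_on (\<lambda>(u, v). {u, v}) (set es)"
    proof (rule inj_onI)
      fix x y assume xy: "x \<in> set es" "y \<in> set es" "(case x of (u, v) \<Rightarrow> {u, v}) = (case y of (u, v) \<Rightarrow> {u, v})"
      obtain u v u' v' where x: "x = (u, v)" and y: "y = (u', v')" by (cases x, cases y)
      have "u < v" "u' < v'" using ord xy(1,2) x y by auto
      then show "x = y" using xy(3) unfolding x y by (auto simp: doubleton_eq_iff)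
    qed
    show False
    proof (rule dead_sound[OF dead, of "{}"])
      show "describes (mate []) {} (set [a, b, c] \<union> \<Union> (edge_set es))"
      proof -
        \<comment> \<open>In the empty state every vertex is its own mate; nonnegative names keep
          this apart from the mark -1.\<close>
        have "z \<noteq> -1" if "z \<in> set [a, b, c] \<union> \<Union> (edge_set es)" for z
          using that ord abc unfolding edge_set_def by fastforce
        then show ?thesis unfolding describes_def mate_def vdeg_def by simp
      qed
      show "distinct (map (\<lambda>(u, v). {u, v}) es)"
        using es inj unfolding ordered_def distinct_map by simp
      show "u \<noteq> v \<and> u \<in> set p \<and> v \<in> set p" if "(u, v) \<in> set es" for u v
        using ord[OF that] p(3) by auto
    qed (use p(4) in auto)
  qed
qed

fun uses :: "int \<Rightarrow> int \<Rightarrow> int list \<Rightarrow> bool" where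
  "uses x y (u # v # zs) \<longleftrightarrow> (u = x \<and> v = y \<or> u = y \<and> v = x) \<or> uses x y (v # zs)"
| "uses x y _ \<longleftrightarrow> False"

lemma uses_iff: "uses x y p \<longleftrightarrow> {x, y} \<in> pedges p"
  by (induction x y p rule: uses.induct) (auto simp: doubleton_eq_iff)

definition uses_quad :: "int \<Rightarrow> int \<Rightarrow> int \<Rightarrow> int \<Rightarrow> int list \<Rightarrow> bool" where
  "uses_quad t1 t2 b1 b2 p \<longleftrightarrow> uses t1 t2 p \<or> uses b1 b2 p \<or> uses t1 b1 p \<or> uses t2 b2 p"

definition ladder_ok :: "int \<Rightarrow> int \<Rightarrow> int \<Rightarrow> int \<Rightarrow> int list \<Rightarrow> bool" where
  "ladder_ok t1 t2 b1 b2 q \<longleftrightarrow> (case q of [] \<Rightarrow> False | v # p \<Rightarrow>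
     if v = t1 \<or> v = t2 then uses b1 b2 p else if v = b1 \<or> v = b2 then uses t1 t2 p else uses_quad t1 t2 b1 b2 p)"

lemma laddered_certificate:
  assumes fragment: "fragment {0..<n} (edge_set es) a b c"
    and quad: "distinct [t1, t2, b1, b2]" "{t1, t2} \<in> edge_set es" "{b1, b2} \<in> edge_set es"
      "{t1, b1} \<in> edge_set es" "{t2, b2} \<in> edge_set es"
    and del: "list_all (deletion_ok es n [a, b, c]) qs" "list_all (ladder_ok t1 t2 b1 b2) qs" "map hd qs = [0..n - 1]"
    and starts: "walk es pa" "covers n pa" "int (length pa) = n" "hd pa = a" "uses_quad t1 t2 b1 b2 pa"
      "walk es pb" "covers n pb" "int (length pb) = n" "hd pb = b" "uses_quad t1 t2 b1 b2 pb"
  shows "laddered_fragment {0..<n} (edge_set es) a b c t1 t2 b1 b2"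
proof -
  interpret fragment "{0..<n}" "edge_set es" a b c by (rule fragment)
  have quad_verts: "t1 \<in> {0..<n}" "t2 \<in> {0..<n}" "b1 \<in> {0..<n}" "b2 \<in> {0..<n}"
    using edges[OF quad(2)] edges[OF quad(3)] by simp_all
  have start: "\<exists>t. spath_via (edge_set es) {0..<n} x t {{t1, t2}, {b1, b2}, {t1, b1}, {t2, b2}}"
    if "walk es p" "covers n p" "int (length p) = n" "hd p = x" "uses_quad t1 t2 b1 b2 p" for p x
  proof -
    have "pedges p \<inter> {{t1, t2}, {b1, b2}, {t1, b1}, {t2, b2}} \<noteq> {}"
      using that(5) unfolding uses_quad_def uses_iff by auto
    moreover from this have "p \<noteq> []" by auto
    ultimately have "spath_via (edge_set es) {0..<n} x (last p) {{t1, t2}, {b1, b2}, {t1, b1}, {t2, b2}}"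
      using coversD[OF that(2,3)] walk_pedges[OF that(1)] that(4) by (intro spath_viaI[of p]) simp_all
    then show ?thesis by (rule exI)
  qed
  have deletion: "\<exists>s\<in>{a, b, c}. \<exists>t\<in>{a, b, c}. s \<noteq> t \<and> spath_via (edge_set es) ({0..<n} - {v}) s t Q"
    if v: "v \<in> {0..<n}" and Q: "\<And>p. ladder_ok t1 t2 b1 b2 (v # p) \<Longrightarrow> pedges p \<inter> Q \<noteq> {}" for v Q
  proof -
    have "v \<in> set (map hd qs)" unfolding del(3) using v by simp
    then obtain q where q: "q \<in> set qs" "hd q = v" by auto
    then have ok: "deletion_ok es n [a, b, c] q" "ladder_ok t1 t2 b1 b2 q" using del(1,2) unfolding list_all_iff by simp_all
    obtain p where p: "q = v # p" "walk es p" "covers n q" "int (length q) = n" "p \<noteq> []"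
      "hd p \<in> {a, b, c}" "last p \<in> {a, b, c}" "hd p \<noteq> last p"
      using q(2) ok(1) unfolding deletion_ok_def by (cases q) auto
    have "distinct (v # p)" "set (v # p) = {0..<n}" by (rule coversD[OF p(3,4)[unfolded p(1)]])+
    then have "set p = {0..<n} - {v}" "distinct p" by auto
    then have "spath_via (edge_set es) ({0..<n} - {v}) (hd p) (last p) Q"
      using walk_pedges[OF p(2)] p(5) Q[of p] ok(2) p(1) by (intro spath_viaI[of p]) simp_all
    then show ?thesis using p(6-8) by (intro bexI conjI)
  qed
  show ?thesis
  proof
    show "distinct [t1, t2, b1, b2]" "{t1, t2} \<in> edge_set es" "{b1, b2} \<in> edge_set es"
      "{t1, b1} \<in> edge_set es" "{t2, b2} \<in> edge_set es" by (rule quad)+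
    show "\<exists>t. spath_via (edge_set es) {0..<n} a t {{t1, t2}, {b1, b2}, {t1, b1}, {t2, b2}}"
      by (rule start[OF starts(1-5)])
    show "\<exists>t. spath_via (edge_set es) {0..<n} b t {{t1, t2}, {b1, b2}, {t1, b1}, {t2, b2}}"
      by (rule start[OF starts(6-10)])
    show "\<exists>s\<in>{a, b, c}. \<exists>t\<in>{a, b, c}. s \<noteq> t \<and>
        spath_via (edge_set es) ({0..<n} - {v}) s t {{t1, t2}, {b1, b2}, {t1, b1}, {t2, b2}}"
      if v: "v \<in> {0..<n} - {t1, t2, b1, b2}" for v
      by (rule deletion) (use v in \<open>auto simp: ladder_ok_def uses_quad_def uses_iff\<close>)
    show "\<exists>s\<in>{a, b, c}. \<exists>t\<in>{a, b, c}. s \<noteq> t \<and> spath_via (edge_set es) ({0..<n} - {v}) s t {{b1, b2}}"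
      if v: "v \<in> {t1, t2}" for v
      by (rule deletion) (use v quad_verts in \<open>auto simp: ladder_ok_def uses_iff\<close>)
    show "\<exists>s\<in>{a, b, c}. \<exists>t\<in>{a, b, c}. s \<noteq> t \<and> spath_via (edge_set es) ({0..<n} - {v}) s t {{t1, t2}}"
      if v: "v \<in> {b1, b2}" for v
      by (rule deletion) (use v quad_verts quad(1) in \<open>auto simp: ladder_ok_def uses_iff\<close>)
  qed
qed

section \<open>Exact tests for straight-line drawings\<close>

text \<open>Twice the signed area of the triangle \<open>p q r\<close>; its sign tells on which side
  of the line from \<open>p\<close> to \<open>q\<close> the point \<open>r\<close> lies.\<close>

definition cross :: "int \<times> int \<Rightarrow> int \<times> int \<Rightarrow> int \<times> int \<Rightarrow> int" where
  "cross p q r = (fst q - fst p) * (snd r - snd p) - (snd q - snd p) * (fst r - fst p)"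

definition rcross :: "real \<times> real \<Rightarrow> real \<times> real \<Rightarrow> real \<times> real \<Rightarrow> real" where
  "rcross p q r = (fst q - fst p) * (snd r - snd p) - (snd q - snd p) * (fst r - fst p)"

lemma rcross_affine: "rcross p q ((1 - t) *\<^sub>R x + t *\<^sub>R y) = (1 - t) * rcross p q x + t * rcross p q y"
  unfolding rcross_def by (simp add: algebra_simps)

lemma rcross_ends [simp]: "rcross p q p = 0" "rcross p q q = 0"
  unfolding rcross_def by simp_all

text \<open>An affine function on a segment is largest at an end, and at an inner point only if it
  is constant there.\<close>

lemma segment_touch:
  fixes l :: "real \<times> real \<Rightarrow> real"
  assumes "\<And>p q t. l ((1 - t) *\<^sub>R p + t *\<^sub>R q) = (1 - t) * l p + t * l q"
    and "x \<in> convex hull {p, q}" "0 \<le> l x" "l p \<le> 0" "l q \<le> 0"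
  shows "l p = 0 \<and> x = p \<or> l q = 0 \<and> x = q \<or> l p = 0 \<and> l q = 0"
proof -
  obtain t where t: "0 \<le> t" "t \<le> 1" "x = (1 - t) *\<^sub>R p + t *\<^sub>R q" using hull_pair[OF assms(2)] .
  have "0 \<le> (1 - t) * l p + t * l q" using assms(1,3) t(3) by simp
  moreover have "(1 - t) * l p \<le> 0" "t * l q \<le> 0" using t(1,2) assms(4,5) by (simp_all add: mult_nonneg_nonpos)
  ultimately have z: "(1 - t) * l p = 0" "t * l q = 0" by linarith+
  show ?thesis
  proof (cases "l p = 0")
    case True
    then show ?thesis using z(2) t(3) by (cases "l q = 0") auto
  next
    case False
    then have "t = 1" using z(1) by simp
    then show ?thesis using z(2) t(3) by simp
  qed
qed

definition coord :: "(int \<times> int \<times> int) list \<Rightarrow> int \<Rightarrow> int \<times> int" where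
  "coord cs v = (case map_of cs v of None \<Rightarrow> (0, 0) | Some z \<Rightarrow> z)"

text \<open>Scaling integer points by \<open>1 / k\<close> leaves the sign of \<open>cross\<close>
  unchanged, so all position tests can be done on integers.\<close>

definition loc :: "int \<Rightarrow> int \<times> int \<Rightarrow> real \<times> real" where
  "loc k z = (real_of_int (fst z) / real_of_int k, real_of_int (snd z) / real_of_int k)"

lemma rcross_loc:
  assumes "0 < k"
  shows "rcross (loc k p) (loc k q) (loc k r) = real_of_int (cross p q r) / (real_of_int k * real_of_int k)"
proof -
  have "(x / z - y / z) * (x' / z - y' / z) - (u / z - w / z) * (u' / z - w' / z) =
    ((x - y) * (x' - y') - (u - w) * (u' - w')) / (z * z)" for x y x' y' u w u' w' z :: real
    by (simp add: diff_divide_distrib[symmetric])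
  then show ?thesis unfolding rcross_def loc_def cross_def by simp
qed

lemma rcross_loc_sign:
  assumes "0 < k"
  shows "0 < rcross (loc k p) (loc k q) (loc k r) \<longleftrightarrow> 0 < cross p q r"
    "rcross (loc k p) (loc k q) (loc k r) < 0 \<longleftrightarrow> cross p q r < 0"
proof -
  have "0 < real_of_int k * real_of_int k" using assms by simp
  then show "0 < rcross (loc k p) (loc k q) (loc k r) \<longleftrightarrow> 0 < cross p q r"
    "rcross (loc k p) (loc k q) (loc k r) < 0 \<longleftrightarrow> cross p q r < 0"
    unfolding rcross_loc[OF assms] by (simp_all add: zero_less_divide_iff divide_less_0_iff)
qed

type_synonym segment = "(int \<times> int) \<times> (int \<times> int) \<times> (int \<times> int)"

text \<open>The second segment lies strictly on one side of the line through the first. Common ends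
  are exempt, since they lie on that line. \<open>apart\<close> accepts either segment of a pair as
  the one that gives the line.\<close>

fun beside :: "segment \<Rightarrow> segment \<Rightarrow> bool" where
  "beside ((u, v), p, q) ((u', v'), p', q') \<longleftrightarrow>
    (u' = u \<or> u' = v \<or> 0 < cross p q p') \<and> (v' = u \<or> v' = v \<or> 0 < cross p q q') \<or>
    (u' = u \<or> u' = v \<or> cross p q p' < 0) \<and> (v' = u \<or> v' = v \<or> cross p q q' < 0)"

fun apart :: "segment list \<Rightarrow> bool" where
  "apart [] \<longleftrightarrow> True"
| "apart (e # es) \<longleftrightarrow> list_all (\<lambda>d. beside e d \<or> beside d e) es \<and> apart es"

definition segments :: "(int \<times> int \<times> int) list \<Rightarrow> (int \<times> int) list \<Rightarrow> segment list" where
  "segments cs es = map (\<lambda>e. (e, coord cs (fst e), coord cs (snd e))) es"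

text \<open>The side function vanishes on the first segment and has one strict sign at the ends of
  the second that are not common. As at most one end is common, \<open>segment_touch\<close> leaves
  only that end as a meeting point.\<close>

lemma beside_sound:
  assumes k: "0 < k" and b: "beside ((u, v), coord cs u, coord cs v) ((u', v'), coord cs u', coord cs v')"
    and ne: "u' \<noteq> v'" "{u, v} \<noteq> {u', v'}"
    and x: "x \<in> convex hull {loc k (coord cs u), loc k (coord cs v)}" "x \<in> convex hull {loc k (coord cs u'), loc k (coord cs v')}"
  shows "x \<in> (\<lambda>w. loc k (coord cs w)) ` ({u, v} \<inter> {u', v'})"
proof -
  let ?p = "\<lambda>w. loc k (coord cs w)"
  let ?L = "rcross (?p u) (?p v)"
  have Lx: "?L x = 0"
  proof -
    obtain t where "x = (1 - t) *\<^sub>R ?p u + t *\<^sub>R ?p v" using hull_pair[OF x(1)] .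
    then show ?thesis by (simp add: rcross_affine)
  qed
  have main: "x \<in> ?p ` ({u, v} \<inter> {u', v'})"
    if aff: "\<And>p q t. l ((1 - t) *\<^sub>R p + t *\<^sub>R q) = (1 - t) * l p + t * l q" and lx: "l x = 0"
      and lu: "u' \<in> {u, v} \<and> l (?p u') = 0 \<or> l (?p u') < 0" and lv: "v' \<in> {u, v} \<and> l (?p v') = 0 \<or> l (?p v') < 0"
    for l :: "real \<times> real \<Rightarrow> real"
  proof -
    have nb: "\<not> (u' \<in> {u, v} \<and> v' \<in> {u, v})" using ne by auto
    have "l (?p u') = 0 \<and> x = ?p u' \<or> l (?p v') = 0 \<and> x = ?p v' \<or> l (?p u') = 0 \<and> l (?p v') = 0"
      by (rule segment_touch[OF aff x(2)]) (use lx lu lv in auto)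
    then show ?thesis
    proof (elim disjE conjE)
      assume "l (?p u') = 0" "x = ?p u'"
      then show ?thesis using lu by auto
    next
      assume "l (?p v') = 0" "x = ?p v'"
      then show ?thesis using lv by auto
    next
      assume "l (?p u') = 0" "l (?p v') = 0"
      then show ?thesis using lu lv nb by auto
    qed
  qed
  have zero: "w \<in> {u, v} \<Longrightarrow> ?L (?p w) = 0" for w by auto
  from b consider
      "u' \<in> {u, v} \<or> 0 < cross (coord cs u) (coord cs v) (coord cs u')" "v' \<in> {u, v} \<or> 0 < cross (coord cs u) (coord cs v) (coord cs v')"
    | "u' \<in> {u, v} \<or> cross (coord cs u) (coord cs v) (coord cs u') < 0" "v' \<in> {u, v} \<or> cross (coord cs u) (coord cs v) (coord cs v') < 0"
    by auto
  then show ?thesis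
  proof cases
    case 1
    show ?thesis
      by (rule main[of "\<lambda>z. - ?L z"])
        (use 1 zero[of u'] zero[of v'] Lx rcross_loc_sign[OF k] in \<open>auto simp: rcross_affine\<close>)
  next
    case 2
    show ?thesis
      by (rule main[of ?L]) (use 2 zero[of u'] zero[of v'] Lx rcross_loc_sign[OF k] in \<open>auto simp: rcross_affine\<close>)
  qed
qed

lemma apart_sound:
  assumes "apart (segments cs es)" "(u, v) \<in> set es" "(u', v') \<in> set es" "(u, v) \<noteq> (u', v')"
  shows "beside ((u, v), coord cs u, coord cs v) ((u', v'), coord cs u', coord cs v') \<or>
    beside ((u', v'), coord cs u', coord cs v') ((u, v), coord cs u, coord cs v)"
  using assms
proof (induction es)
  case (Cons e es)
  have ok: "list_all (\<lambda>d. beside (e, coord cs (fst e), coord cs (snd e)) d \<or> beside d (e, coord cs (fst e), coord cs (snd e))) (segments cs es)"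
    "apart (segments cs es)" using Cons(2) by (simp_all add: segments_def)
  have mem: "((w, z), coord cs w, coord cs z) \<in> set (segments cs es)" if "(w, z) \<in> set es" for w z
    using that unfolding segments_def by force
  consider "(u, v) \<in> set es" "(u', v') \<in> set es" | "e = (u, v)" "(u', v') \<in> set es" | "(u, v) \<in> set es" "e = (u', v')"
    using Cons(3-5) by auto
  then show ?case
  proof cases
    case 1
    then show ?thesis using Cons(1)[OF ok(2)] Cons(5) by simp
  next
    case 2
    then show ?thesis using ok(1) mem[OF 2(2)] unfolding list_all_iff by auto
  next
    case 3
    then show ?thesis using ok(1) mem[OF 3(1)] unfolding list_all_iff by auto
  qed
qed simp

definition in_sector :: "int \<Rightarrow> int \<times> int \<Rightarrow> bool" where
  "in_sector k z \<longleftrightarrow> fst z \<le> k \<and> fst z \<le> snd z \<and> snd z \<le> 2 * fst z"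

lemma drawn_certificate:
  assumes k: "0 < k" and es: "ordered n es" "apart (segments cs es)"
    and cs: "map fst cs = [0..n - 1]" "distinct (map snd cs)" "list_all (in_sector k) (map snd cs)"
    and cov: "list_all (\<lambda>v. list_ex (\<lambda>(x, y). x = v \<or> y = v) es) [0..n - 1]"
    and corners: "coord cs a = (k, 2 * k)" "coord cs b = (k, k)" "coord cs c = (0, 0)"
  shows "drawn {0..<n} (edge_set es) a b c (\<lambda>v. loc k (coord cs v))"
proof -
  let ?p = "\<lambda>v. loc k (coord cs v)"
  have ord: "0 \<le> u \<and> u < v \<and> v < n" if "(u, v) \<in> set es" for u v
    using es that unfolding ordered_def list_all_iff by auto
  have dist: "distinct (map fst cs)" unfolding cs(1) by simp
  have at_mem: "(v, coord cs v) \<in> set cs" if "v \<in> {0..<n}" for v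
  proof -
    have "v \<in> fst ` set cs" using that cs(1) by (metis atLeastLessThan_iff image_set set_upto atLeastAtMost_iff zle_diff1_eq)
    then obtain z where z: "(v, z) \<in> set cs" by auto
    then have "map_of cs v = Some z" by (rule map_of_is_SomeI[OF dist])
    then show ?thesis using z unfolding coord_def by simp
  qed
  have inj_at: "v = w" if "v \<in> {0..<n}" "w \<in> {0..<n}" "coord cs v = coord cs w" for v w
  proof -
    have "inj_on snd (set cs)" using cs(2) by (simp add: distinct_map)
    from inj_onD[OF this _ at_mem[OF that(1)] at_mem[OF that(2)]] that(3) show ?thesis by simp
  qed
  have loc_eq: "loc k y = loc k z \<longleftrightarrow> y = z" for y z
    using k unfolding loc_def by (auto simp: prod_eq_iff)
  have "straight {0..<n} (edge_set es) ?p"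
    unfolding straight_def
  proof (intro conjI ballI impI)
    show "inj_on ?p {0..<n}" by (rule inj_onI) (simp only: loc_eq inj_at)
    show "e \<subseteq> {0..<n}" if "e \<in> edge_set es" for e
      using that ord unfolding edge_set_def by fastforce
    show "\<exists>e\<in>edge_set es. v \<in> e" if v: "v \<in> {0..<n}" for v
    proof -
      have "list_ex (\<lambda>(x, y). x = v \<or> y = v) es" using cov v unfolding list_all_iff by simp
      then obtain x y where "(x, y) \<in> set es" "x = v \<or> y = v" unfolding list_ex_iff by auto
      then show ?thesis unfolding edge_set_def by force
    qed
    show "convex hull (?p ` e) \<inter> convex hull (?p ` e') \<subseteq> ?p ` (e \<inter> e')"
      if ee: "e \<in> edge_set es" "e' \<in> edge_set es" "e \<noteq> e'" for e e'
    proof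
      fix x assume x: "x \<in> convex hull (?p ` e) \<inter> convex hull (?p ` e')"
      obtain u v where uv: "(u, v) \<in> set es" "e = {u, v}" using ee(1) unfolding edge_set_def by auto
      obtain u' v' where uv': "(u', v') \<in> set es" "e' = {u', v'}" using ee(2) unfolding edge_set_def by auto
      have ne: "u \<noteq> v" "u' \<noteq> v'" using ord[OF uv(1)] ord[OF uv'(1)] by auto
      have "(u, v) \<noteq> (u', v')" using ee(3) uv(2) uv'(2) by auto
      from apart_sound[OF es(2) uv(1) uv'(1) this] show "x \<in> ?p ` (e \<inter> e')"
      proof
        assume "beside ((u, v), coord cs u, coord cs v) ((u', v'), coord cs u', coord cs v')"
        from beside_sound[OF k this ne(2)] show ?thesis using x ee(3) unfolding uv(2) uv'(2) by simp
      next
        assume "beside ((u', v'), coord cs u', coord cs v') ((u, v), coord cs u, coord cs v)"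
        from beside_sound[OF k this ne(1)] show ?thesis using x ee(3) unfolding uv(2) uv'(2) by (simp add: Int_commute)
      qed
    qed
  qed
  moreover have "?p v \<in> sector" if "v \<in> {0..<n}" for v
  proof -
    have "in_sector k (coord cs v)" using cs(3) at_mem[OF that] unfolding list_all_iff by force
    then have "real_of_int (fst (coord cs v)) \<le> real_of_int k" "real_of_int (fst (coord cs v)) \<le> real_of_int (snd (coord cs v))"
      "real_of_int (snd (coord cs v)) \<le> 2 * real_of_int (fst (coord cs v))"
      unfolding in_sector_def by linarith+
    then show ?thesis using k unfolding sector_def loc_def by (simp add: divide_le_eq divide_right_mono)
  qed
  ultimately show ?thesis
    using k corners unfolding drawn_def by (auto simp: loc_def)
qed

text \<open>The line through one side of the parallelogram separates it from the edge, which may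
  touch that line only at the two corners on it. The signs presuppose that \<open>t1\<close>,
  \<open>t2\<close>, \<open>b1\<close> are positively oriented.\<close>

fun clear :: "(int \<times> int \<times> int) list \<Rightarrow> int \<Rightarrow> int \<Rightarrow> int \<Rightarrow> int \<Rightarrow> int \<times> int \<Rightarrow> bool" where
  "clear cs t1 t2 b1 b2 (u, v) \<longleftrightarrow> (u, v) \<in> {(t1, t2), (t2, t1), (b1, b2), (b2, b1), (t1, b1), (b1, t1), (t2, b2), (b2, t2)} \<or>
    list_all (\<lambda>w. w = t1 \<or> w = t2 \<or> cross (coord cs t1) (coord cs t2) (coord cs w) < 0) [u, v] \<or>
    list_all (\<lambda>w. w = b1 \<or> w = b2 \<or> 0 < cross (coord cs b1) (coord cs b2) (coord cs w)) [u, v] \<or>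
    list_all (\<lambda>w. w = t1 \<or> w = b1 \<or> 0 < cross (coord cs t1) (coord cs b1) (coord cs w)) [u, v] \<or>
    list_all (\<lambda>w. w = t2 \<or> w = b2 \<or> cross (coord cs t2) (coord cs b2) (coord cs w) < 0) [u, v]"

lemma ladder_drawn_certificate:
  assumes drawn: "drawn {0..<n} (edge_set es) a b c (\<lambda>v. loc k (coord cs v))" and k: "0 < k"
    and clear: "list_all (clear cs t1 t2 b1 b2) es" and es: "ordered n es"
    and quad: "coord cs b2 = coord cs t2 + coord cs b1 - coord cs t1" "0 < cross (coord cs t1) (coord cs t2) (coord cs b1)"
  shows "\<exists>A B. ladder_drawn {0..<n} (edge_set es) a b c t1 t2 b1 b2 (\<lambda>v. loc k (coord cs v)) A B"
proof -
  let ?p = "\<lambda>v. loc k (coord cs v)"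
  define A B where "A = ?p t2 - ?p t1" and "B = ?p b1 - ?p t1"
  have AB: "?p t2 = ?p t1 + A" "?p b1 = ?p t1 + B" "?p b2 = ?p t1 + A + B"
    unfolding A_def B_def using quad(1) by (simp_all add: loc_def prod_eq_iff add_divide_distrib diff_divide_distrib)
  define D where "D = fst A * snd B - snd A * fst B"
  have "D = rcross (?p t1) (?p t2) (?p b1)" unfolding D_def rcross_def AB by simp
  then have D: "0 < D" using rcross_loc_sign(1)[OF k] quad(2) by simp
  \<comment> \<open>As \<open>D\<close> is positive, these four functions have constant sign on the
    parallelogram, opposite to the sign that \<open>clear\<close> demands of the edge.\<close>
  have sides: "rcross (?p t1) (?p t2) (?p t1 + s *\<^sub>R A + u *\<^sub>R B) = u * D"
    "rcross (?p b1) (?p b2) (?p t1 + s *\<^sub>R A + u *\<^sub>R B) = - (1 - u) * D"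
    "rcross (?p t1) (?p b1) (?p t1 + s *\<^sub>R A + u *\<^sub>R B) = - s * D"
    "rcross (?p t2) (?p b2) (?p t1 + s *\<^sub>R A + u *\<^sub>R B) = (1 - s) * D" for s u
    unfolding rcross_def AB D_def by (simp_all add: algebra_simps)
  have indep: "s = 0 \<and> u = 0" if "s *\<^sub>R A + u *\<^sub>R B = 0" for s u
  proof -
    have e: "s * fst A + u * fst B = 0" "s * snd A + u * snd B = 0" using that by (simp_all add: prod_eq_iff)
    \<comment> \<open>Cramer's rule.\<close>
    have "s * D = (s * fst A + u * fst B) * snd B - (s * snd A + u * snd B) * fst B"
      "u * D = (s * snd A + u * snd B) * fst A - (s * fst A + u * fst B) * snd A"
      unfolding D_def by (simp_all add: algebra_simps)
    then have "s * D = 0" "u * D = 0" unfolding e by simp_all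
    then show ?thesis using D by simp
  qed
  have away: "x \<in> ?p ` (e \<inter> {t1, t2, b1, b2})"
    if e: "e \<in> edge_set es - {{t1, t2}, {b1, b2}, {t1, b1}, {t2, b2}}" and su: "0 \<le> s" "s \<le> 1" "0 \<le> u" "u \<le> 1"
      and x: "x = ?p t1 + s *\<^sub>R A + u *\<^sub>R B" "x \<in> convex hull (?p ` e)" for e s u x
  proof -
    obtain w w' where w: "(w, w') \<in> set es" "e = {w, w'}" using e unfolding edge_set_def by auto
    have "w \<noteq> w'" using es w(1) unfolding ordered_def list_all_iff by auto
    have ww: "e \<noteq> {t1, t2}" "e \<noteq> {b1, b2}" "e \<noteq> {t1, b1}" "e \<noteq> {t2, b2}" using e by simp_all
    \<comment> \<open>\<open>l\<close> is the function of the separating side with corners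
      \<open>k1\<close> and \<open>k2\<close>, signed to be nonnegative on the parallelogram. By
      \<open>segment_touch\<close>, the edge meets it at most in an end that is one of these
      corners.\<close>
    have main: "x \<in> ?p ` (e \<inter> {t1, t2, b1, b2})"
      if aff: "\<And>p q t. l ((1 - t) *\<^sub>R p + t *\<^sub>R q) = (1 - t) * l p + t * l q" and lx: "0 \<le> l x"
        and K: "{k1, k2} \<subseteq> {t1, t2, b1, b2}" "e \<noteq> {k1, k2}"
        and lw: "\<And>z. z \<in> {w, w'} \<Longrightarrow> (z = k1 \<or> z = k2) \<and> l (?p z) = 0 \<or> l (?p z) < 0"
      for l :: "real \<times> real \<Rightarrow> real" and k1 k2
    proof -
      have nb: "\<not> ((w = k1 \<or> w = k2) \<and> (w' = k1 \<or> w' = k2))" using K(2) w(2) \<open>w \<noteq> w'\<close> by auto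
      have xh: "x \<in> convex hull {?p w, ?p w'}" using x(2) w(2) by simp
      have "l (?p w) = 0 \<and> x = ?p w \<or> l (?p w') = 0 \<and> x = ?p w' \<or> l (?p w) = 0 \<and> l (?p w') = 0"
        by (rule segment_touch[OF aff xh lx]) (use lw[of w] lw[of w'] in auto)
      then show ?thesis
      proof (elim disjE conjE)
        assume h: "l (?p w) = 0" "x = ?p w"
        then have "w \<in> e \<inter> {t1, t2, b1, b2}" using lw[of w] w(2) K(1) by auto
        then show ?thesis using h(2) by simp
      next
        assume h: "l (?p w') = 0" "x = ?p w'"
        then have "w' \<in> e \<inter> {t1, t2, b1, b2}" using lw[of w'] w(2) K(1) by auto
        then show ?thesis using h(2) by simp
      next
        assume "l (?p w) = 0" "l (?p w') = 0"
        then show ?thesis using lw[of w] lw[of w'] nb by auto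
      qed
    qed
    have "clear cs t1 t2 b1 b2 (w, w')" using clear w(1) unfolding list_all_iff by blast
    moreover have "(w, w') \<notin> {(t1, t2), (t2, t1), (b1, b2), (b2, b1), (t1, b1), (b1, t1), (t2, b2), (b2, t2)}"
      using ww w(2) by (auto simp: insert_commute)
    ultimately have "list_all (\<lambda>z. z = t1 \<or> z = t2 \<or> cross (coord cs t1) (coord cs t2) (coord cs z) < 0) [w, w'] \<or>
      list_all (\<lambda>z. z = b1 \<or> z = b2 \<or> 0 < cross (coord cs b1) (coord cs b2) (coord cs z)) [w, w'] \<or>
      list_all (\<lambda>z. z = t1 \<or> z = b1 \<or> 0 < cross (coord cs t1) (coord cs b1) (coord cs z)) [w, w'] \<or>
      list_all (\<lambda>z. z = t2 \<or> z = b2 \<or> cross (coord cs t2) (coord cs b2) (coord cs z) < 0) [w, w']"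
      unfolding clear.simps by (simp only: simp_thms)
    then have sep: thesis
      if "(\<And>z. z \<in> {w, w'} \<Longrightarrow> z = t1 \<or> z = t2 \<or> cross (coord cs t1) (coord cs t2) (coord cs z) < 0) \<Longrightarrow> thesis"
        "(\<And>z. z \<in> {w, w'} \<Longrightarrow> z = b1 \<or> z = b2 \<or> 0 < cross (coord cs b1) (coord cs b2) (coord cs z)) \<Longrightarrow> thesis"
        "(\<And>z. z \<in> {w, w'} \<Longrightarrow> z = t1 \<or> z = b1 \<or> 0 < cross (coord cs t1) (coord cs b1) (coord cs z)) \<Longrightarrow> thesis"
        "(\<And>z. z \<in> {w, w'} \<Longrightarrow> z = t2 \<or> z = b2 \<or> cross (coord cs t2) (coord cs b2) (coord cs z) < 0) \<Longrightarrow> thesis"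
      for thesis
    proof (elim disjE)
      assume "list_all (\<lambda>z. z = t1 \<or> z = t2 \<or> cross (coord cs t1) (coord cs t2) (coord cs z) < 0) [w, w']"
      then show thesis by (intro that(1)) (auto simp only: list_all_iff set_simps)
    next
      assume "list_all (\<lambda>z. z = b1 \<or> z = b2 \<or> 0 < cross (coord cs b1) (coord cs b2) (coord cs z)) [w, w']"
      then show thesis by (intro that(2)) (auto simp only: list_all_iff set_simps)
    next
      assume "list_all (\<lambda>z. z = t1 \<or> z = b1 \<or> 0 < cross (coord cs t1) (coord cs b1) (coord cs z)) [w, w']"
      then show thesis by (intro that(3)) (auto simp only: list_all_iff set_simps)
    next
      assume "list_all (\<lambda>z. z = t2 \<or> z = b2 \<or> cross (coord cs t2) (coord cs b2) (coord cs z) < 0) [w, w']"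
      then show thesis by (intro that(4)) (auto simp only: list_all_iff set_simps)
    qed
    have below: "(z = k1 \<or> z = k2) \<and> rcross (?p k1) (?p k2) (?p z) = 0 \<or> rcross (?p k1) (?p k2) (?p z) < 0"
      if "z = k1 \<or> z = k2 \<or> cross (coord cs k1) (coord cs k2) (coord cs z) < 0" for z k1 k2
      using that rcross_loc_sign(2)[OF k, of "coord cs k1" "coord cs k2" "coord cs z"] by (elim disjE) simp_all
    have above: "(z = k1 \<or> z = k2) \<and> - rcross (?p k1) (?p k2) (?p z) = 0 \<or> - rcross (?p k1) (?p k2) (?p z) < 0"
      if "z = k1 \<or> z = k2 \<or> 0 < cross (coord cs k1) (coord cs k2) (coord cs z)" for z k1 k2
      using that rcross_loc_sign(1)[OF k, of "coord cs k1" "coord cs k2" "coord cs z"] by (elim disjE) simp_all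
    show ?thesis
    proof (rule sep)
      assume 1: "\<And>z. z \<in> {w, w'} \<Longrightarrow> z = t1 \<or> z = t2 \<or> cross (coord cs t1) (coord cs t2) (coord cs z) < 0"
      show ?thesis
      proof (rule main[of "rcross (?p t1) (?p t2)" t1 t2])
        show "rcross (?p t1) (?p t2) ((1 - t) *\<^sub>R p + t *\<^sub>R q) = (1 - t) * (rcross (?p t1) (?p t2) p) + t * (rcross (?p t1) (?p t2) q)" for p q t
          by (rule rcross_affine)
        show "0 \<le> rcross (?p t1) (?p t2) x" unfolding x(1) sides using D su by simp
        show "{t1, t2} \<subseteq> {t1, t2, b1, b2}" by simp
        show "e \<noteq> {t1, t2}" by (rule ww(1))
        show "(z = t1 \<or> z = t2) \<and> rcross (?p t1) (?p t2) (?p z) = 0 \<or> rcross (?p t1) (?p t2) (?p z) < 0" if z: "z \<in> {w, w'}" for z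
          by (rule below[OF 1[OF z]])
      qed
    next
      assume 2: "\<And>z. z \<in> {w, w'} \<Longrightarrow> z = b1 \<or> z = b2 \<or> 0 < cross (coord cs b1) (coord cs b2) (coord cs z)"
      show ?thesis
      proof (rule main[of "\<lambda>z. - rcross (?p b1) (?p b2) z" b1 b2])
        show "- rcross (?p b1) (?p b2) ((1 - t) *\<^sub>R p + t *\<^sub>R q) = (1 - t) * (- rcross (?p b1) (?p b2) p) + t * (- rcross (?p b1) (?p b2) q)" for p q t
          unfolding rcross_affine by (simp add: algebra_simps)
        show "0 \<le> - rcross (?p b1) (?p b2) x" unfolding x(1) sides using D su by (auto simp: mult_le_0_iff)
        show "{b1, b2} \<subseteq> {t1, t2, b1, b2}" by simp
        show "e \<noteq> {b1, b2}" by (rule ww(2))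
        show "(z = b1 \<or> z = b2) \<and> - rcross (?p b1) (?p b2) (?p z) = 0 \<or> - rcross (?p b1) (?p b2) (?p z) < 0" if z: "z \<in> {w, w'}" for z
          by (rule above[OF 2[OF z]])
      qed
    next
      assume 3: "\<And>z. z \<in> {w, w'} \<Longrightarrow> z = t1 \<or> z = b1 \<or> 0 < cross (coord cs t1) (coord cs b1) (coord cs z)"
      show ?thesis
      proof (rule main[of "\<lambda>z. - rcross (?p t1) (?p b1) z" t1 b1])
        show "- rcross (?p t1) (?p b1) ((1 - t) *\<^sub>R p + t *\<^sub>R q) = (1 - t) * (- rcross (?p t1) (?p b1) p) + t * (- rcross (?p t1) (?p b1) q)" for p q t
          unfolding rcross_affine by (simp add: algebra_simps)
        show "0 \<le> - rcross (?p t1) (?p b1) x" unfolding x(1) sides using D su by (auto simp: mult_le_0_iff)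
        show "{t1, b1} \<subseteq> {t1, t2, b1, b2}" by simp
        show "e \<noteq> {t1, b1}" by (rule ww(3))
        show "(z = t1 \<or> z = b1) \<and> - rcross (?p t1) (?p b1) (?p z) = 0 \<or> - rcross (?p t1) (?p b1) (?p z) < 0" if z: "z \<in> {w, w'}" for z
          by (rule above[OF 3[OF z]])
      qed
    next
      assume 4: "\<And>z. z \<in> {w, w'} \<Longrightarrow> z = t2 \<or> z = b2 \<or> cross (coord cs t2) (coord cs b2) (coord cs z) < 0"
      show ?thesis
      proof (rule main[of "rcross (?p t2) (?p b2)" t2 b2])
        show "rcross (?p t2) (?p b2) ((1 - t) *\<^sub>R p + t *\<^sub>R q) = (1 - t) * (rcross (?p t2) (?p b2) p) + t * (rcross (?p t2) (?p b2) q)" for p q t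
          by (rule rcross_affine)
        show "0 \<le> rcross (?p t2) (?p b2) x" unfolding x(1) sides using D su by simp
        show "{t2, b2} \<subseteq> {t1, t2, b1, b2}" by simp
        show "e \<noteq> {t2, b2}" by (rule ww(4))
        show "(z = t2 \<or> z = b2) \<and> rcross (?p t2) (?p b2) (?p z) = 0 \<or> rcross (?p t2) (?p b2) (?p z) < 0" if z: "z \<in> {w, w'}" for z
          by (rule below[OF 4[OF z]])
      qed
    qed
  qed
  have "ladder_drawn {0..<n} (edge_set es) a b c t1 t2 b1 b2 ?p A B"
    unfolding ladder_drawn_def using drawn AB indep away by simp
  then show ?thesis by (intro exI)
qed

section \<open>The initial fragments\<close>

text \<open>The fragments arise from planar hypohamiltonian graphs with 34 and 37 vertices by deleting a cubic
  vertex. The terminals \<open>a\<close>, \<open>b\<close>, \<open>c\<close> are 32, 18, 28 in the small and 32, 33, 34 in the large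
  fragment; the coordinates are multiplied by 100.\<close>

definition small_edges :: "(int \<times> int) list" where
  "small_edges =
   [(0, 2), (1, 2), (2, 5), (3, 5), (0, 6), (0, 8), (3, 8), (4, 8), (4, 9), (3, 10), (9, 10), (10, 11), (5,
   12), (11, 12), (4, 13), (6, 13), (7, 13), (1, 14), (12, 14), (1, 15), (6, 15), (6, 16), (7, 17), (16, 17),
   (15, 18), (7, 20), (9, 20), (19, 20), (16, 21), (18, 21), (21, 23), (17, 24), (19, 24), (23, 24), (9, 25),
   (19, 26), (25, 26), (11, 27), (25, 27), (23, 28), (26, 28), (14, 29), (22, 29), (27, 29), (14, 30), (18,
   30), (22, 30), (22, 31), (27, 31), (28, 31), (30, 32), (31, 32)]"

definition small_coords :: "(int \<times> int \<times> int) list" where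
  "small_coords =
   [(0, 68, 82), (1, 77, 93), (2, 70, 86), (3, 62, 80), (4, 59, 73), (5, 66, 85), (6, 68, 78), (7, 55, 66), (8,
   63, 78), (9, 53, 68), (10, 58, 77), (11, 59, 81), (12, 68, 89), (13, 61, 73), (14, 75, 101), (15, 83, 91),
   (16, 65, 72), (17, 55, 63), (18, 100, 100), (19, 39, 47), (20, 50, 61), (21, 70, 72), (22, 66, 101), (23,
   39, 42), (24, 44, 50), (25, 47, 64), (26, 27, 35), (27, 54, 79), (28, 0, 0), (29, 68, 94), (30, 88, 126),
   (31, 52, 86), (32, 100, 200)]"

definition small_paths :: "int list list" where
  "small_paths =
   [[0, 28, 26, 19, 20, 7, 13, 4, 8, 3, 5, 2, 1, 15, 6, 16, 17, 24, 23, 21, 18, 30, 22, 29, 14, 12, 11, 10, 9,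
     25, 27, 31, 32],
    [1, 28, 26, 19, 20, 9, 25, 27, 31, 22, 29, 14, 12, 11, 10, 3, 5, 2, 0, 8, 4, 13, 7, 17, 24, 23, 21, 16, 6,
     15, 18, 30, 32],
    [2, 28, 23, 24, 17, 16, 21, 18, 30, 22, 29, 14, 1, 15, 6, 0, 8, 4, 13, 7, 20, 19, 26, 25, 9, 10, 3, 5, 12,
     11, 27, 31, 32],
    [3, 28, 26, 19, 20, 7, 13, 4, 8, 0, 6, 16, 17, 24, 23, 21, 18, 15, 1, 2, 5, 12, 11, 10, 9, 25, 27, 31, 22,
     29, 14, 30, 32],
    [4, 28, 26, 19, 20, 7, 13, 6, 16, 17, 24, 23, 21, 18, 15, 1, 2, 0, 8, 3, 5, 12, 11, 10, 9, 25, 27, 31, 22,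
     29, 14, 30, 32],
    [5, 28, 26, 19, 20, 7, 13, 4, 9, 25, 27, 31, 22, 29, 14, 12, 11, 10, 3, 8, 0, 2, 1, 15, 6, 16, 17, 24, 23,
     21, 18, 30, 32],
    [6, 28, 26, 25, 27, 11, 12, 5, 3, 10, 9, 20, 19, 24, 23, 21, 16, 17, 7, 13, 4, 8, 0, 2, 1, 15, 18, 30, 14,
     29, 22, 31, 32],
    [7, 28, 23, 24, 17, 16, 21, 18, 15, 1, 2, 0, 6, 13, 4, 8, 3, 5, 12, 11, 10, 9, 20, 19, 26, 25, 27, 31, 22,
     29, 14, 30, 32],
    [8, 28, 31, 22, 29, 27, 25, 26, 19, 20, 9, 4, 13, 7, 17, 24, 23, 21, 16, 6, 0, 2, 5, 3, 10, 11, 12, 14, 1,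
     15, 18, 30, 32],
    [9, 28, 23, 24, 17, 16, 21, 18, 30, 22, 29, 14, 12, 11, 10, 3, 5, 2, 1, 15, 6, 0, 8, 4, 13, 7, 20, 19, 26,
     25, 27, 31, 32],
    [10, 28, 26, 19, 20, 7, 13, 4, 9, 25, 27, 11, 12, 5, 3, 8, 0, 2, 1, 15, 6, 16, 17, 24, 23, 21, 18, 30, 14,
     29, 22, 31, 32],
    [11, 28, 26, 19, 20, 7, 13, 4, 8, 0, 2, 1, 15, 6, 16, 17, 24, 23, 21, 18, 30, 22, 29, 14, 12, 5, 3, 10, 9,
     25, 27, 31, 32],
    [12, 28, 26, 25, 9, 20, 19, 24, 23, 21, 16, 17, 7, 13, 4, 8, 0, 6, 15, 18, 30, 22, 29, 14, 1, 2, 5, 3, 10,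
     11, 27, 31, 32],
    [13, 28, 26, 19, 20, 7, 17, 24, 23, 21, 16, 6, 0, 8, 4, 9, 25, 27, 31, 22, 29, 14, 12, 11, 10, 3, 5, 2, 1,
     15, 18, 30, 32],
    [14, 28, 31, 22, 29, 27, 11, 12, 5, 3, 10, 9, 25, 26, 19, 20, 7, 13, 4, 8, 0, 2, 1, 15, 6, 16, 17, 24, 23,
     21, 18, 30, 32],
    [15, 28, 26, 19, 20, 7, 13, 4, 8, 3, 5, 12, 11, 10, 9, 25, 27, 31, 22, 29, 14, 1, 2, 0, 6, 16, 17, 24, 23,
     21, 18, 30, 32],
    [16, 28, 26, 19, 20, 7, 17, 24, 23, 21, 18, 15, 1, 2, 0, 6, 13, 4, 8, 3, 5, 12, 11, 10, 9, 25, 27, 31, 22,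
     29, 14, 30, 32],
    [17, 28, 26, 19, 24, 23, 21, 16, 6, 0, 8, 4, 13, 7, 20, 9, 25, 27, 31, 22, 29, 14, 12, 11, 10, 3, 5, 2, 1,
     15, 18, 30, 32],
    [18, 28, 26, 25, 9, 20, 19, 24, 23, 21, 16, 17, 7, 13, 4, 8, 0, 6, 15, 1, 2, 5, 3, 10, 11, 12, 14, 30, 22,
     29, 27, 31, 32],
    [19, 28, 26, 25, 27, 11, 12, 5, 3, 10, 9, 20, 7, 13, 4, 8, 0, 2, 1, 15, 6, 16, 17, 24, 23, 21, 18, 30, 14,
     29, 22, 31, 32],
    [20, 28, 26, 19, 24, 23, 21, 16, 17, 7, 13, 4, 8, 3, 5, 12, 11, 10, 9, 25, 27, 31, 22, 29, 14, 1, 2, 0, 6,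
     15, 18, 30, 32],
    [21, 28, 23, 24, 17, 16, 6, 0, 8, 4, 13, 7, 20, 19, 26, 25, 9, 10, 3, 5, 2, 1, 15, 18, 30, 22, 29, 14, 12,
     11, 27, 31, 32],
    [22, 18, 21, 23, 24, 17, 16, 6, 15, 1, 2, 0, 8, 4, 13, 7, 20, 19, 26, 25, 9, 10, 3, 5, 12, 11, 27, 29, 14,
     30, 32, 31, 28],
    [23, 28, 26, 19, 24, 17, 16, 21, 18, 30, 22, 29, 14, 12, 11, 10, 3, 5, 2, 1, 15, 6, 0, 8, 4, 13, 7, 20, 9,
     25, 27, 31, 32],
    [24, 28, 23, 21, 16, 17, 7, 13, 4, 8, 3, 5, 12, 11, 10, 9, 20, 19, 26, 25, 27, 31, 22, 29, 14, 1, 2, 0, 6,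
     15, 18, 30, 32],
    [25, 28, 26, 19, 20, 7, 13, 4, 9, 10, 3, 8, 0, 6, 16, 17, 24, 23, 21, 18, 15, 1, 2, 5, 12, 11, 27, 31, 22,
     29, 14, 30, 32],
    [26, 28, 23, 21, 16, 17, 24, 19, 20, 7, 13, 4, 8, 3, 5, 12, 11, 10, 9, 25, 27, 31, 22, 29, 14, 1, 2, 0, 6,
     15, 18, 30, 32],
    [27, 18, 30, 32, 31, 22, 29, 14, 12, 11, 10, 3, 5, 2, 1, 15, 6, 0, 8, 4, 13, 7, 17, 16, 21, 23, 24, 19, 20,
     9, 25, 26, 28],
    [28, 18, 21, 23, 24, 17, 16, 6, 15, 1, 2, 0, 8, 4, 13, 7, 20, 19, 26, 25, 9, 10, 3, 5, 12, 11, 27, 31, 22,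
     29, 14, 30, 32],
    [29, 28, 26, 19, 20, 7, 13, 4, 8, 0, 6, 16, 17, 24, 23, 21, 18, 15, 1, 2, 5, 3, 10, 9, 25, 27, 11, 12, 14,
     30, 22, 31, 32],
    [30, 28, 26, 19, 20, 7, 13, 4, 8, 0, 6, 16, 17, 24, 23, 21, 18, 15, 1, 2, 5, 3, 10, 9, 25, 27, 11, 12, 14,
     29, 22, 31, 32],
    [31, 28, 26, 19, 20, 7, 13, 4, 8, 3, 5, 2, 0, 6, 16, 17, 24, 23, 21, 18, 15, 1, 14, 12, 11, 10, 9, 25, 27,
     29, 22, 30, 32],
    [32, 18, 21, 23, 24, 17, 16, 6, 15, 1, 2, 0, 8, 4, 13, 7, 20, 19, 26, 25, 9, 10, 3, 5, 12, 11, 27, 29, 14,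
     30, 22, 31, 28]]"

definition small_from_a :: "int list" where
  "small_from_a = [32, 31, 22, 29, 27, 11, 12, 5, 3, 10, 9, 25, 26, 28, 23, 21, 16, 17, 24, 19, 20, 7, 13, 4, 8, 0, 6, 15, 18,
     30, 14, 1, 2]"

definition small_from_b :: "int list" where
  "small_from_b = [18, 21, 16, 17, 7, 13, 4, 8, 0, 6, 15, 1, 2, 5, 3, 10, 11, 12, 14, 30, 32, 31, 22, 29, 27, 25, 9, 20, 19,
     26, 28, 23, 24]"

definition large_edges :: "(int \<times> int) list" where
  "large_edges =
   [(0, 4), (2, 4), (3, 4), (0, 5), (3, 6), (3, 7), (0, 8), (1, 8), (7, 8), (7, 9), (1, 10), (9, 10), (10, 11),
   (2, 12), (5, 12), (1, 13), (5, 13), (2, 14), (6, 14), (6, 15), (9, 15), (15, 16), (14, 17), (16, 17), (12,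
   19), (17, 19), (18, 19), (9, 20), (16, 21), (18, 21), (16, 22), (20, 22), (22, 23), (21, 24), (23, 24), (11,
   25), (20, 25), (23, 26), (25, 26), (24, 27), (18, 28), (27, 28), (26, 29), (27, 29), (12, 30), (28, 30),
   (13, 31), (30, 31), (29, 32), (30, 32), (11, 33), (13, 33), (11, 34), (29, 34), (31, 35), (32, 35), (33,
   35)]"

definition large_coords :: "(int \<times> int \<times> int) list" where
  "large_coords =
   [(0, 78, 120), (1, 76, 108), (2, 76, 124), (3, 75, 116), (4, 76, 118), (5, 84, 124), (6, 74, 119), (7, 72,
   106), (8, 77, 113), (9, 71, 103), (10, 65, 91), (11, 51, 65), (12, 82, 133), (13, 87, 120), (14, 75, 123),
   (15, 72, 113), (16, 73, 118), (17, 76, 126), (18, 80, 132), (19, 79, 129), (20, 66, 102), (21, 73, 123),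
   (22, 69, 110), (23, 68, 114), (24, 70, 118), (25, 61, 92), (26, 66, 108), (27, 72, 127), (28, 82, 137), (29,
   68, 121), (30, 89, 162), (31, 92, 142), (32, 100, 200), (33, 100, 100), (34, 0, 0), (35, 96, 151)]"

definition large_paths :: "int list list" where
  "large_paths =
   [[0, 32, 35, 31, 30, 28, 18, 19, 17, 14, 6, 15, 16, 21, 24, 27, 29, 34, 11, 25, 26, 23, 22, 20, 9, 10, 1, 8,
     7, 3, 4, 2, 12, 5, 13, 33],
    [1, 32, 35, 31, 30, 28, 18, 21, 24, 27, 29, 34, 11, 10, 9, 20, 25, 26, 23, 22, 16, 15, 6, 14, 17, 19, 12, 2,
     4, 3, 7, 8, 0, 5, 13, 33],
    [2, 32, 35, 31, 30, 28, 18, 21, 24, 27, 29, 34, 11, 10, 1, 8, 0, 4, 3, 7, 9, 20, 25, 26, 23, 22, 16, 15, 6,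
     14, 17, 19, 12, 5, 13, 33],
    [3, 32, 35, 31, 30, 28, 18, 21, 24, 27, 29, 34, 11, 10, 1, 8, 7, 9, 20, 25, 26, 23, 22, 16, 15, 6, 14, 17,
     19, 12, 2, 4, 0, 5, 13, 33],
    [4, 32, 35, 31, 30, 28, 18, 19, 17, 14, 2, 12, 5, 0, 8, 7, 3, 6, 15, 16, 21, 24, 27, 29, 34, 11, 25, 26, 23,
     22, 20, 9, 10, 1, 13, 33],
    [5, 32, 35, 31, 13, 1, 10, 9, 20, 25, 26, 23, 22, 16, 15, 6, 3, 7, 8, 0, 4, 2, 14, 17, 19, 12, 30, 28, 18,
     21, 24, 27, 29, 34, 11, 33],
    [6, 32, 35, 31, 30, 28, 27, 29, 34, 11, 10, 1, 8, 0, 4, 3, 7, 9, 15, 16, 22, 20, 25, 26, 23, 24, 21, 18, 19,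
     17, 14, 2, 12, 5, 13, 33],
    [7, 32, 35, 31, 30, 28, 18, 21, 24, 27, 29, 34, 11, 10, 9, 20, 25, 26, 23, 22, 16, 15, 6, 3, 4, 2, 14, 17,
     19, 12, 5, 0, 8, 1, 13, 33],
    [8, 32, 35, 31, 30, 12, 19, 17, 14, 2, 4, 0, 5, 13, 1, 10, 9, 7, 3, 6, 15, 16, 22, 20, 25, 26, 23, 24, 21,
     18, 28, 27, 29, 34, 11, 33],
    [9, 34, 29, 26, 23, 22, 20, 25, 11, 10, 1, 8, 7, 3, 6, 15, 16, 17, 14, 2, 4, 0, 5, 12, 19, 18, 21, 24, 27,
     28, 30, 32, 35, 31, 13, 33],
    [10, 32, 35, 31, 30, 28, 18, 19, 12, 5, 0, 4, 2, 14, 17, 16, 21, 24, 27, 29, 34, 11, 25, 26, 23, 22, 20, 9,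
     15, 6, 3, 7, 8, 1, 13, 33],
    [11, 34, 29, 26, 25, 20, 22, 23, 24, 27, 28, 18, 21, 16, 17, 19, 12, 5, 0, 8, 7, 3, 4, 2, 14, 6, 15, 9, 10,
     1, 13, 31, 30, 32, 35, 33],
    [12, 32, 29, 34, 11, 25, 26, 23, 22, 20, 9, 10, 1, 13, 5, 0, 8, 7, 3, 4, 2, 14, 6, 15, 16, 17, 19, 18, 21,
     24, 27, 28, 30, 31, 35, 33],
    [13, 32, 29, 34, 11, 25, 26, 23, 22, 20, 9, 10, 1, 8, 7, 3, 6, 15, 16, 17, 14, 2, 4, 0, 5, 12, 19, 18, 21,
     24, 27, 28, 30, 31, 35, 33],
    [14, 32, 35, 31, 30, 28, 18, 21, 24, 27, 29, 34, 11, 25, 26, 23, 22, 20, 9, 10, 1, 8, 7, 3, 6, 15, 16, 17,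
     19, 12, 2, 4, 0, 5, 13, 33],
    [15, 32, 35, 31, 30, 28, 18, 19, 17, 14, 6, 3, 4, 2, 12, 5, 0, 8, 7, 9, 20, 25, 26, 23, 22, 16, 21, 24, 27,
     29, 34, 11, 10, 1, 13, 33],
    [16, 34, 29, 26, 23, 22, 20, 25, 11, 10, 1, 8, 0, 5, 12, 2, 4, 3, 7, 9, 15, 6, 14, 17, 19, 18, 21, 24, 27,
     28, 30, 32, 35, 31, 13, 33],
    [17, 32, 35, 31, 30, 28, 18, 19, 12, 5, 0, 8, 7, 3, 4, 2, 14, 6, 15, 16, 21, 24, 27, 29, 34, 11, 25, 26, 23,
     22, 20, 9, 10, 1, 13, 33],
    [18, 32, 29, 34, 11, 25, 26, 23, 22, 20, 9, 10, 1, 8, 7, 3, 6, 15, 16, 21, 24, 27, 28, 30, 12, 19, 17, 14,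
     2, 4, 0, 5, 13, 31, 35, 33],
    [19, 32, 35, 31, 30, 12, 5, 13, 1, 10, 9, 15, 6, 3, 7, 8, 0, 4, 2, 14, 17, 16, 22, 20, 25, 26, 23, 24, 21,
     18, 28, 27, 29, 34, 11, 33],
    [20, 32, 35, 31, 30, 28, 18, 21, 24, 27, 29, 34, 11, 25, 26, 23, 22, 16, 17, 19, 12, 5, 0, 8, 7, 3, 4, 2,
     14, 6, 15, 9, 10, 1, 13, 33],
    [21, 32, 35, 31, 30, 28, 18, 19, 12, 5, 13, 1, 10, 9, 15, 6, 3, 7, 8, 0, 4, 2, 14, 17, 16, 22, 20, 25, 26,
     23, 24, 27, 29, 34, 11, 33],
    [22, 32, 35, 31, 30, 28, 18, 21, 16, 17, 19, 12, 5, 0, 8, 7, 3, 4, 2, 14, 6, 15, 9, 20, 25, 26, 23, 24, 27,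
     29, 34, 11, 10, 1, 13, 33],
    [23, 32, 35, 31, 30, 28, 27, 24, 21, 18, 19, 12, 5, 13, 1, 10, 9, 15, 6, 3, 7, 8, 0, 4, 2, 14, 17, 16, 22,
     20, 25, 26, 29, 34, 11, 33],
    [24, 34, 29, 27, 28, 18, 21, 16, 17, 19, 12, 5, 0, 8, 7, 3, 4, 2, 14, 6, 15, 9, 20, 22, 23, 26, 25, 11, 10,
     1, 13, 31, 30, 32, 35, 33],
    [25, 34, 11, 10, 1, 8, 0, 4, 2, 14, 17, 19, 18, 28, 27, 24, 21, 16, 15, 6, 3, 7, 9, 20, 22, 23, 26, 29, 32,
     35, 31, 30, 12, 5, 13, 33],
    [26, 34, 29, 27, 28, 18, 19, 17, 14, 6, 3, 4, 2, 12, 5, 0, 8, 7, 9, 15, 16, 21, 24, 23, 22, 20, 25, 11, 10,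
     1, 13, 31, 30, 32, 35, 33],
    [27, 32, 35, 31, 30, 28, 18, 19, 12, 5, 13, 1, 10, 9, 15, 6, 3, 7, 8, 0, 4, 2, 14, 17, 16, 21, 24, 23, 22,
     20, 25, 26, 29, 34, 11, 33],
    [28, 32, 35, 31, 30, 12, 5, 13, 1, 10, 9, 20, 25, 26, 23, 22, 16, 15, 6, 3, 7, 8, 0, 4, 2, 14, 17, 19, 18,
     21, 24, 27, 29, 34, 11, 33],
    [29, 34, 11, 25, 26, 23, 22, 20, 9, 10, 1, 8, 7, 3, 6, 15, 16, 17, 14, 2, 4, 0, 5, 12, 19, 18, 21, 24, 27,
     28, 30, 32, 35, 31, 13, 33],
    [30, 32, 35, 31, 13, 1, 10, 9, 7, 8, 0, 5, 12, 19, 17, 14, 2, 4, 3, 6, 15, 16, 22, 20, 25, 26, 23, 24, 21,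
     18, 28, 27, 29, 34, 11, 33],
    [31, 34, 29, 26, 25, 11, 10, 1, 13, 5, 0, 8, 7, 9, 20, 22, 23, 24, 27, 28, 18, 21, 16, 15, 6, 3, 4, 2, 14,
     17, 19, 12, 30, 32, 35, 33],
    [32, 34, 29, 26, 25, 11, 10, 1, 8, 0, 4, 2, 14, 17, 19, 18, 21, 16, 15, 6, 3, 7, 9, 20, 22, 23, 24, 27, 28,
     30, 12, 5, 13, 31, 35, 33],
    [33, 34, 11, 25, 26, 29, 27, 28, 18, 19, 17, 14, 6, 15, 16, 21, 24, 23, 22, 20, 9, 10, 1, 13, 5, 0, 8, 7, 3,
     4, 2, 12, 30, 31, 35, 32],
    [34, 32, 35, 31, 30, 28, 18, 19, 12, 5, 13, 1, 10, 9, 15, 6, 3, 7, 8, 0, 4, 2, 14, 17, 16, 21, 24, 27, 29,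
     26, 23, 22, 20, 25, 11, 33],
    [35, 32, 29, 34, 11, 25, 26, 23, 22, 20, 9, 10, 1, 8, 7, 3, 6, 15, 16, 17, 14, 2, 4, 0, 5, 12, 19, 18, 21,
     24, 27, 28, 30, 31, 13, 33]]"

definition large_from_a :: "int list" where
  "large_from_a = [32, 35, 33, 13, 31, 30, 28, 18, 19, 12, 5, 0, 4, 2, 14, 17, 16, 21, 24, 27, 29, 34, 11, 25, 26, 23, 22, 20,
     9, 10, 1, 8, 7, 3, 6, 15]"

definition large_from_b :: "int list" where
  "large_from_b = [33, 35, 32, 29, 34, 11, 25, 26, 23, 22, 20, 9, 10, 1, 8, 7, 3, 6, 15, 16, 17, 14, 2, 4, 0, 5, 13, 31, 30,
     12, 19, 18, 28, 27, 24, 21]"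

section \<open>Evaluation of the certificates\<close>

text \<open>The edges are listed by increasing larger end, and a vertex other than a terminal is
  trimmed as soon as its last listed edge is decided. The order thus keeps the states short during
  the evaluation.\<close>

lemma small_dead: "dead [32, 18, 28] (annotate [32, 18, 28] small_edges) []"
  by code_simp

lemma large_dead: "dead [32, 33, 34] (annotate [32, 33, 34] large_edges) []"
  by code_simp

lemma small_ordered: "ordered 33 small_edges"
  by code_simp

lemma small_deletion: "list_all (deletion_ok small_edges 33 [32, 18, 28]) small_paths"
  by code_simp

lemma small_apart: "apart (segments small_coords small_edges)"
  by code_simp

lemma small_cover: "list_all (\<lambda>v. list_ex (\<lambda>(x, y). x = v \<or> y = v) small_edges) [0..33 - 1]"
  by code_simp

lemma small_coords_ok: "map fst small_coords = [0..33 - 1]" "distinct (map snd small_coords)"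
  "list_all (in_sector 100) (map snd small_coords)"
  "coord small_coords 32 = (100, 2 * 100)" "coord small_coords 18 = (100, 100)" "coord small_coords 28 = (0, 0)"
  by code_simp+

lemma small_starts: "walk small_edges small_from_a" "covers 33 small_from_a" "int (length small_from_a) = 33" "hd small_from_a = 32"
  "walk small_edges small_from_b" "covers 33 small_from_b" "int (length small_from_b) = 33" "hd small_from_b = 18"
  by code_simp+

lemma small_heads: "map hd small_paths = [0..33 - 1]"
  by code_simp

lemma small_fragment: "fragment {0..<33} (edge_set small_edges) 32 18 28"
  by (rule fragment_certificate[OF small_ordered _ _ small_dead small_deletion small_heads small_starts]) simp_all

lemma small_drawn: "drawn {0..<33} (edge_set small_edges) 32 18 28 (\<lambda>v. loc 100 (coord small_coords v))"
  by (rule drawn_certificate[OF _ small_ordered small_apart small_coords_ok(1-3) small_cover small_coords_ok(4-6)]) simp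

lemma large_ordered: "ordered 36 large_edges"
  by code_simp

lemma large_deletion: "list_all (deletion_ok large_edges 36 [32, 33, 34]) large_paths"
  by code_simp

lemma large_apart: "apart (segments large_coords large_edges)"
  by code_simp

lemma large_cover: "list_all (\<lambda>v. list_ex (\<lambda>(x, y). x = v \<or> y = v) large_edges) [0..36 - 1]"
  by code_simp

lemma large_coords_ok: "map fst large_coords = [0..36 - 1]" "distinct (map snd large_coords)"
  "list_all (in_sector 100) (map snd large_coords)"
  "coord large_coords 32 = (100, 2 * 100)" "coord large_coords 33 = (100, 100)" "coord large_coords 34 = (0, 0)"
  by code_simp+

lemma large_starts: "walk large_edges large_from_a" "covers 36 large_from_a" "int (length large_from_a) = 36" "hd large_from_a = 32"
  "walk large_edges large_from_b" "covers 36 large_from_b" "int (length large_from_b) = 36" "hd large_from_b = 33"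
  by code_simp+

lemma large_heads: "map hd large_paths = [0..36 - 1]"
  by code_simp

lemma large_fragment: "fragment {0..<36} (edge_set large_edges) 32 33 34"
  by (rule fragment_certificate[OF large_ordered _ _ large_dead large_deletion large_heads large_starts]) simp_all

lemma large_drawn: "drawn {0..<36} (edge_set large_edges) 32 33 34 (\<lambda>v. loc 100 (coord large_coords v))"
  by (rule drawn_certificate[OF _ large_ordered large_apart large_coords_ok(1-3) large_cover large_coords_ok(4-6)]) simp

text \<open>Here \<open>t1\<close>, \<open>t2\<close>, \<open>b1\<close>, \<open>b2\<close> are 22,
  31, 29, 27: the rails are 22 31 and 29 27, the rungs 22 29 and 31 27.\<close>

lemma small_ladder_ok: "list_all (ladder_ok 22 31 29 27) small_paths"
  "uses_quad 22 31 29 27 small_from_a" "uses_quad 22 31 29 27 small_from_b"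
  by code_simp+

lemma small_quad: "{22, 31} \<in> edge_set small_edges" "{29, 27} \<in> edge_set small_edges"
  "{22, 29} \<in> edge_set small_edges" "{31, 27} \<in> edge_set small_edges"
  unfolding edge_iff by code_simp+

lemma small_clear: "list_all (clear small_coords 22 31 29 27) small_edges"
  by code_simp

lemma small_parallelogram:
  "coord small_coords 27 = coord small_coords 31 + coord small_coords 29 - coord small_coords 22"
  "0 < cross (coord small_coords 22) (coord small_coords 31) (coord small_coords 29)"
  by code_simp+

lemma ladder_piece_33: "ladder_piece 33"
proof -
  have "laddered_fragment {0..<33} (edge_set small_edges) 32 18 28 22 31 29 27"
    by (rule laddered_certificate[OF small_fragment _ small_quad small_deletion small_ladder_ok(1) small_heads
          small_starts(1-4) small_ladder_ok(2) small_starts(5-8) small_ladder_ok(3)]) simp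
  moreover obtain A B where "ladder_drawn {0..<33} (edge_set small_edges) 32 18 28 22 31 29 27 (\<lambda>v. loc 100 (coord small_coords v)) A B"
    using ladder_drawn_certificate[OF small_drawn _ small_clear small_ordered small_parallelogram] by auto
  moreover have "card {0..<33 :: int} = 33" by simp
  ultimately show ?thesis
    unfolding ladder_piece_def by (intro exI conjI)
qed

lemma piece_36: "piece 36"
proof -
  have "card {0..<36 :: int} = 36" by simp
  then show ?thesis
    unfolding piece_def using large_fragment large_drawn by (intro exI conjI)
qed

theorem theorem3p6:
  shows "(\<exists>G :: nat ugraph. finite_simple_graph G \<and> planar G \<and> hypotraceable G \<and>
             card (uverts G) = 130) \<and>
         (\<forall>n :: nat. n \<ge> 154 \<longrightarrow>
            (\<exists>G :: nat ugraph. finite_simple_graph G \<and> planar G \<and> hypotraceable G \<and>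
               card (uverts G) = n))"
proof (intro conjI allI impI)
  have p33: "piece (33 + 4 * j)" for j
    by (rule ladder_piece_piece[OF ladder_piece_add[OF ladder_piece_33]])
  have 33: "piece 33" using p33[of 0] by simp
  note 36 = piece_36
  show "\<exists>G :: nat ugraph. finite_simple_graph G \<and> planar G \<and> hypotraceable G \<and> card (uverts G) = 130"
    \<comment> \<open>Four small pieces: 4 * 33 - 2 = 130.\<close>
    by (rule pieces_combine[OF 33 33 33 33]) simp
  fix n :: nat assume n: "n \<ge> 154"
  \<comment> \<open>139 = 3 * 36 + 33 - 2 is the size with three large pieces. Replacing a large
    piece by a small one and extending the ladder once more changes the size by -3 + 4 = 1, so the
    remainder \<open>r\<close> is reached with \<open>3 - r\<close> large pieces and
    \<open>q + r\<close> extensions.\<close>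
  obtain q r where "n - 139 = 4 * q + r" "r < 4"
    by (metis mult_div_mod_eq mod_less_divisor zero_less_numeral)
  then have "n + 2 = 36 + 36 + 36 + (33 + 4 * q) \<or> n + 2 = 36 + 36 + 33 + (33 + 4 * (q + 1)) \<or>
    n + 2 = 36 + 33 + 33 + (33 + 4 * (q + 2)) \<or> n + 2 = 33 + 33 + 33 + (33 + 4 * (q + 3))"
    using n by presburger
  then show "\<exists>G :: nat ugraph. finite_simple_graph G \<and> planar G \<and> hypotraceable G \<and> card (uverts G) = n"
    by (elim disjE) (erule pieces_combine[OF 36 36 36 p33] pieces_combine[OF 36 36 33 p33]
        pieces_combine[OF 36 33 33 p33] pieces_combine[OF 33 33 33 p33])+
qed

end
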